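(* Let $T>0$, let $g_1,\dots,g_{n-1}\colon\mathbb{R}^m\to\mathbb{R}^m$ be continuous and let $h\colon[0,T]\times(\mathbb{R}^m)^n\to\mathbb{R}^m$ be an $L^1$-Carathéodory function. Let $\Omega$ be an open and bounded subset of $X=\mathcal{C}([0,T],\mathbb{R}^{mn})$. Suppose that the following conditions hold. ($c_1'$) For each $\vartheta\in\,]0,1[$ there is no $T$-periodic solution $x$ of $$x_i'=g_i(x_{i+1}),\ i=1,\dots,n-1,\qquad x_n'=\vartheta h(t,x_1,\dots,x_n)$$ with $x\in\partial\Omega$. ($c_2'$) $\hat g^{-1}(0)\cap\partial\Omega=\emptyset$. If $$\deg_B(\hat g,\Omega\cap\mathbb{R}^{mn},0)\neq0,$$ then there exists at least a $T$-periodic solution in $\overline\Omega$ of $$x_i'=g_i(x_{i+1}),\ i=1,\dots,n-1,\qquad x_n'=h(t,x_1,\dots,x_n).$$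
   Context: $X=\mathcal{C}([0,T],\mathbb{R}^{mn})$ carries the sup-norm; closure and boundary of $\Omega$ are taken in $X$. $\mathbb{R}^{mn}$ is identified with the constant functions in $X$. A $T$-periodic solution of a system $x_i'=g_i(x_{i+1})$, $i=1,\dots,n-1$, $x_n'=f(t,x_1,\dots,x_n)$ (where $f=\vartheta h$ or $f=h$) is a function $x=(x_1,\dots,x_n)$ with each $x_i\colon[0,T]\to\mathbb{R}^m$ absolutely continuous, $x_i(0)=x_i(T)$, satisfying the system for a.e. $t\in[0,T]$. $h^{\#}(s):=\frac1T\int_0^Th(t,s_1,\dots,s_n)\,dt$ and $\hat g\colon\mathbb{R}^{mn}\to\mathbb{R}^{mn}$ is $\hat g(s):=(g_1(s_2),\dots,g_{n-1}(s_n),h^{\#}(s))$ for $s=(s_1,\dots,s_n)$. $\deg_B$ is the Brouwer degree. *)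

theory Defs
  imports "HOL-Analysis.Analysis"
begin

section \<open>Brouwer degree\<close>

primrec Ck :: "nat \<Rightarrow> ('a::real_normed_vector \<Rightarrow> 'b::real_normed_vector) \<Rightarrow> bool" where
  "Ck 0 f \<longleftrightarrow> continuous_on UNIV f"
| "Ck (Suc k) f \<longleftrightarrow>
     (\<forall>x. f differentiable (at x)) \<and> (\<forall>v. Ck k (\<lambda>x. frechet_derivative f (at x) v))"

definition smooth :: "('a::real_normed_vector \<Rightarrow> 'b::real_normed_vector) \<Rightarrow> bool" where
  "smooth f \<longleftrightarrow> (\<forall>k. Ck k f)"

definition regular_value_on ::
  "(real^'k::finite \<Rightarrow> real^'k) \<Rightarrow> (real^'k) set \<Rightarrow> real^'k \<Rightarrow> bool" where
  "regular_value_on f U y \<longleftrightarrow> (\<forall>x\<in>U. f x = y \<longrightarrow> det (jacobian f (at x)) \<noteq> 0)"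

text \<open>
  The Brouwer degree of \<^term>\<open>f\<close> on \<^term>\<open>U\<close> at \<^term>\<open>y\<close>: the common value of the signed count of
  preimages of \<^term>\<open>y\<close> over all smooth maps that are sufficiently close to \<^term>\<open>f\<close> on the closure
  of \<^term>\<open>U\<close> and have \<^term>\<open>y\<close> as a regular value in \<^term>\<open>U\<close>.  It is meaningful only if
  \<^term>\<open>U\<close> is open and bounded, \<^term>\<open>f\<close> is continuous on the closure of \<^term>\<open>U\<close> and
  \<^term>\<open>y\<close> is not in the image of the boundary of \<^term>\<open>U\<close>; then, for small \<open>\<epsilon>\<close>, the set of
  preimages is finite.
\<close>

definition brouwer_degree ::
  "(real^'k::finite \<Rightarrow> real^'k) \<Rightarrow> (real^'k) set \<Rightarrow> real^'k \<Rightarrow> int" where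
  "brouwer_degree f U y = (THE d. \<exists>\<epsilon>>0. \<forall>g.
     smooth g \<and> (\<forall>x\<in>closure U. dist (g x) (f x) < \<epsilon>) \<and> regular_value_on g U y \<longrightarrow>
     real_of_int d = (\<Sum>x | x \<in> U \<and> g x = y. sgn (det (jacobian g (at x)))))"


section \<open>Function spaces and solutions\<close>

definition absolutely_continuous_on ::
  "real set \<Rightarrow> (real \<Rightarrow> 'a::real_normed_vector) \<Rightarrow> bool" where
  "absolutely_continuous_on I f \<longleftrightarrow> (\<forall>\<epsilon>>0. \<exists>\<delta>>0. \<forall>D.
     finite D \<and> (\<forall>(a, b)\<in>D. a \<le> b \<and> {a..b} \<subseteq> I) \<and>
     disjoint_family_on (\<lambda>(a, b). {a<..<b}) D \<and> (\<Sum>(a, b)\<in>D. b - a) < \<delta> \<longrightarrow>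
     (\<Sum>(a, b)\<in>D. norm (f b - f a)) < \<epsilon>)"

definition L1_Caratheodory ::
  "real \<Rightarrow> (real \<Rightarrow> 'a::euclidean_space \<Rightarrow> 'b::euclidean_space) \<Rightarrow> bool" where
  "L1_Caratheodory T h \<longleftrightarrow>
     (\<forall>s. (\<lambda>t. h t s) \<in> borel_measurable (lebesgue_on {0..T})) \<and>
     (AE t in lebesgue_on {0..T}. continuous_on UNIV (h t)) \<and>
     (\<forall>r>0. \<exists>\<rho>. integrable (lebesgue_on {0..T}) \<rho> \<and>
        (AE t in lebesgue_on {0..T}. \<forall>s. norm s \<le> r \<longrightarrow> norm (h t s) \<le> \<rho> t))"

text \<open>
  The space of continuous functions on $[0,T]$ with the sup-distance; as usual for
  \<^const>\<open>cfunspace\<close>, its elements are \<^const>\<open>undefined\<close> outside $[0,T]$.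
\<close>

definition C_space :: "real \<Rightarrow> (real \<Rightarrow> 'a::euclidean_space) metric" where
  "C_space T = cfunspace (top_of_set {0..T}) euclidean_metric"

definition const_fun :: "real \<Rightarrow> 'a \<Rightarrow> real \<Rightarrow> 'a" where
  "const_fun T s = (\<lambda>t\<in>{0..T}. s)"

text \<open>
  $\mathbb{R}^{mn}$ is \<^typ>\<open>real^('n \<times> 'm)\<close>.  The index set $1 < \dots < n$ is represented by a finite
  linearly ordered type \<^typ>\<open>'n\<close>: \<open>Max UNIV\<close> plays the role of $n$ and \<open>next_index i\<close> that of $i + 1$
  for $i < n$.
\<close>

definition block :: "real^('n::finite \<times> 'm::finite) \<Rightarrow> 'n \<Rightarrow> real^'m" where
  "block s i = (\<chi> j. s $ (i, j))"

definition of_blocks :: "('n::finite \<Rightarrow> real^'m::finite) \<Rightarrow> real^('n \<times> 'm)" where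
  "of_blocks u = (\<chi> p. u (fst p) $ snd p)"

definition next_index :: "'n::{finite,linorder} \<Rightarrow> 'n" where
  "next_index i = Min {j. i < j}"

text \<open>The vector with blocks $g_1(s_2), \dots, g_{n-1}(s_n), w$; the value of \<open>g (Max UNIV)\<close> is not used.\<close>

definition cyclic_field ::
  "('n \<Rightarrow> real^'m \<Rightarrow> real^'m) \<Rightarrow> real^'m \<Rightarrow> real^('n::{finite,linorder} \<times> 'm::finite)
    \<Rightarrow> real^('n \<times> 'm)" where
  "cyclic_field g w s =
     of_blocks (\<lambda>i. if i = Max UNIV then w else g i (block s (next_index i)))"

definition time_mean ::
  "real \<Rightarrow> (real \<Rightarrow> 'a \<Rightarrow> 'b::euclidean_space) \<Rightarrow> 'a \<Rightarrow> 'b" where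
  "time_mean T h s = (1 / T) *\<^sub>R (LINT t|lebesgue_on {0..T}. h t s)"

definition g_hat ::
  "real \<Rightarrow> ('n \<Rightarrow> real^'m \<Rightarrow> real^'m) \<Rightarrow>
   (real \<Rightarrow> real^('n::{finite,linorder} \<times> 'm::finite) \<Rightarrow> real^'m) \<Rightarrow>
   real^('n \<times> 'm) \<Rightarrow> real^('n \<times> 'm)" where
  "g_hat T g h s = cyclic_field g (time_mean T h s) s"

definition periodic_solution ::
  "real \<Rightarrow> ('n \<Rightarrow> real^'m \<Rightarrow> real^'m) \<Rightarrow>
   (real \<Rightarrow> real^('n::{finite,linorder} \<times> 'm::finite) \<Rightarrow> real^'m) \<Rightarrow>
   (real \<Rightarrow> real^('n \<times> 'm)) \<Rightarrow> bool" where
  "periodic_solution T g f x \<longleftrightarrow>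
     (\<forall>i. absolutely_continuous_on {0..T} (\<lambda>t. block (x t) i)) \<and>
     (\<forall>i. block (x 0) i = block (x T) i) \<and>
     (AE t in lebesgue_on {0..T}. \<forall>i.
        ((\<lambda>\<tau>. block (x \<tau>) i) has_vector_derivative block (cyclic_field g (f t (x t)) (x t)) i)
          (at t within {0..T}))"

end

theory Submission
  imports Defs "HOL-Complex_Analysis.Great_Picard"
begin

text \<open>
  Along the path \<open>(a, b)\<close> from \<open>(0, 0)\<close> via \<open>(1, 0)\<close> to \<open>(1, 1)\<close> consider \<open>x\<^sub>i' = a g\<^sub>i(x\<^sub>i\<^sub>+\<^sub>1)\<close>,
  \<open>x\<^sub>n' = b h(t, x)\<close>.  Evaluating the right-hand side at \<open>x(t - \<delta>)\<close> instead (Tonelli) makes the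
  solution with \<open>x(0) = s\<close> unique and continuous in all parameters, and the time mean \<open>F(s)\<close> of the
  unscaled field along it vanishes only if it is periodic; initially \<open>F\<close> is \<open>g_hat\<close>.  Without a
  solution in the closure of \<open>\<Omega>\<close>, by Arzela-Ascoli some \<open>\<delta>\<close> would give an \<open>F\<close> having no zero with
  \<open>x \<in> \<partial>\<Omega>\<close> along the path and none with \<open>x\<close> in the closure of \<open>\<Omega>\<close> at its end, so
  the degree of \<open>g_hat\<close> would be zero by homotopy invariance.

  Homotopy invariance comes from \<open>\<integral>\<^sub>U \<phi>(f(s)) det Df(s) ds\<close> with a bump function \<open>\<phi>\<close>: the derivative
  along a homotopy is the integral of a divergence, and at a regular value one gets the signed count
  of zeros times the mass of \<open>\<phi>\<close>.
\<close>

section \<open>Homotopy invariance of the degree integral\<close>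

text \<open>A Caratheodory field may have many solutions through one initial value, so the system
  itself has no shooting map on \<open>R^k\<close>. The delayed system has one for each
  \<open>\<delta>\<close>, and compactness returns to the system as \<open>\<delta>\<close> tends to
  0. The map is the time mean and not the displacement \<open>x(T) - s\<close>, because the
  displacement carries the factors \<open>a\<close>, \<open>b\<close> and is identically zero at
  \<open>(0, 0)\<close>.

  The corner \<open>(1, 0)\<close> fits the hypotheses: on the first leg a limit solution is
  constant, and \<open>c2\<close> keeps it off the boundary; inside the second leg it solves the
  system of \<open>c1\<close> with \<open>\<vartheta> = b\<close>; at \<open>(1, 1)\<close> it is a
  solution of the kind sought.

  The initial values whose trajectory lies in \<open>\<Omega>\<close> change along the path, so
  homotopy invariance is proved for regions of \<open>[0, 1] x R^k\<close> with varying slices.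
  Since the degree is a definite description, the argument is by contradiction: only the value 0 is
  ever computed.\<close>

lemmas hk_integral_cong = Henstock_Kurzweil_Integration.integral_cong
  and hk_integral_combine = Henstock_Kurzweil_Integration.integral_combine
  and hk_integral_diff = Henstock_Kurzweil_Integration.integral_diff
  and hk_integral_restrict_UNIV = Henstock_Kurzweil_Integration.integral_restrict_UNIV

section \<open>Determinants: derivative and replacement of rows\<close>

text \<open>Product rule in every term of the permutation expansion; the terms in which the factor
  from row \<open>l\<close> is differentiated recombine into one determinant.\<close>

lemma det_has_field_derivative:
  fixes A :: "real \<Rightarrow> real^'k^'k" and A' :: "real^'k^'k"
  assumes "\<And>i j. ((\<lambda>t. A t $ i $ j) has_field_derivative A' $ i $ j) (at t)"
  shows "((\<lambda>t. det (A t)) has_field_derivative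
           (\<Sum>l\<in>UNIV. det (\<chi> i. if i = l then A' $ l else A t $ i))) (at t)"
proof -
  let ?P = "{p. p permutes (UNIV::'k set)}"
  have "((\<lambda>t. det (A t)) has_field_derivative
      (\<Sum>p\<in>?P. of_int (sign p) * (\<Sum>l\<in>UNIV. A' $ l $ p l * (\<Prod>i\<in>UNIV - {l}. A t $ i $ p i)))) (at t)"
    unfolding det_def
    by (intro DERIV_sum DERIV_cmult has_field_derivative_prod assms)
  also have "(\<Sum>p\<in>?P. of_int (sign p) * (\<Sum>l\<in>UNIV. A' $ l $ p l * (\<Prod>i\<in>UNIV - {l}. A t $ i $ p i)))
    = (\<Sum>l\<in>UNIV. \<Sum>p\<in>?P. of_int (sign p) * (A' $ l $ p l * (\<Prod>i\<in>UNIV - {l}. A t $ i $ p i)))"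
    by (subst sum.swap) (simp add: sum_distrib_left)
  also have "\<dots> = (\<Sum>l\<in>UNIV. det (\<chi> i. if i = l then A' $ l else A t $ i))"
  proof (rule sum.cong[OF refl])
    fix l :: 'k
    have "(\<Prod>i\<in>UNIV. (\<chi> i. if i = l then A' $ l else A t $ i) $ i $ p i)
        = A' $ l $ p l * (\<Prod>i\<in>UNIV - {l}. A t $ i $ p i)" for p
      by (subst prod.remove[of _ l]) (auto intro!: prod.cong)
    then show "(\<Sum>p\<in>?P. of_int (sign p) * (A' $ l $ p l * (\<Prod>i\<in>UNIV - {l}. A t $ i $ p i)))
        = det (\<chi> i. if i = l then A' $ l else A t $ i)"
      unfolding det_def by simp
  qed
  finally show ?thesis .
qed

text \<open>Cofactors are written as determinants of full matrices with one row replaced by a unit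
  vector, so that their derivatives and their products with rows stay within the multilinear
  calculus of rows.\<close>

definition setrow :: "'k::finite \<Rightarrow> real^'k \<Rightarrow> real^'k^'k \<Rightarrow> real^'k^'k" where
  "setrow i x A = (\<chi> k. if k = i then x else A $ k)"

lemma setrow_nth [simp]: "setrow i x A $ k = (if k = i then x else A $ k)"
  by (simp add: setrow_def)

lemma det_setrow_expand: "det (setrow i x A) = (\<Sum>j\<in>UNIV. x $ j * det (setrow i (axis j 1) A))"
proof -
  have "det (setrow i x A) = det (\<chi> k. if k = i then (\<Sum>j\<in>UNIV. x $ j *s axis j 1) else A $ k)"
    unfolding setrow_def basis_expansion ..
  also have "\<dots> = (\<Sum>j\<in>UNIV. det (\<chi> k. if k = i then x $ j *s axis j 1 else A $ k))"
    using det_linear_row_sum[of UNIV i "\<lambda>_ j. x $ j *s axis j 1" "\<lambda>k. A $ k"] by simp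
  also have "\<dots> = (\<Sum>j\<in>UNIV. x $ j * det (setrow i (axis j 1) A))"
    unfolding setrow_def
    using det_row_mul[of i _ "\<lambda>_. axis _ 1" "\<lambda>k. A $ k"] by simp
  finally show ?thesis .
qed

text \<open>Together with \<open>det_setrow_expand\<close> this is the identity
  \<open>A adj(A) = det(A) I\<close>.\<close>

lemma det_setrow_self: "det (setrow i (A $ k) A) = (if i = k then det A else 0)"
proof (cases "i = k")
  case True
  then have "setrow i (A $ k) A = A" by (auto simp: vec_eq_iff)
  then show ?thesis using True by simp
next
  case False
  then show ?thesis
    by (auto intro!: det_identical_rows[of i k] simp: row_def vec_eq_iff)
qed

lemma det_setrow_swap:
  assumes "l \<noteq> i"
  shows "det (setrow l x (setrow i y A)) = - det (setrow l y (setrow i x A))"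
proof -
  let ?p = "Transposition.transpose l i"
  have "setrow l x (setrow i y A) = (\<chi> k. setrow l y (setrow i x A) $ ?p k)"
    using assms by (auto simp: vec_eq_iff transpose_def)
  then have "det (setrow l x (setrow i y A)) = of_int (sign ?p) * det (setrow l y (setrow i x A))"
    by (simp only: det_permute_rows[OF permutes_swap_id[OF UNIV_I UNIV_I]])
  then show ?thesis using assms by (simp add: sign_swap_id)
qed

text \<open>Exchanging \<open>j\<close> and \<open>p\<close> changes the sign of the determinant and
  leaves \<open>H\<close> fixed, so the sum equals its own negative. With second derivatives in the
  place of \<open>H\<close>, this makes the rows of the cofactor matrix divergence-free.\<close>

lemma sum_setrow_symmetric:
  fixes H :: "'k::finite \<Rightarrow> 'k \<Rightarrow> real"
  assumes "l \<noteq> i" "\<And>j p. H j p = H p j"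
  shows "(\<Sum>j\<in>UNIV. \<Sum>p\<in>UNIV. H j p * det (setrow l (axis p 1) (setrow i (axis j 1) A))) = 0"
    (is "?S = 0")
proof -
  have "?S = (\<Sum>j\<in>UNIV. \<Sum>p\<in>UNIV. - (H j p * det (setrow l (axis j 1) (setrow i (axis p 1) A))))"
    using det_setrow_swap[OF assms(1)] by (intro sum.cong refl) (metis mult_minus_right)
  also have "\<dots> = - (\<Sum>p\<in>UNIV. \<Sum>j\<in>UNIV. H p j * det (setrow l (axis j 1) (setrow i (axis p 1) A)))"
    by (subst sum.swap) (simp add: sum_negf assms(2))
  finally show ?thesis by linarith
qed

section \<open>Integral of a partial derivative of a compactly supported function\<close>

lemma integral_eq_superset:
  fixes f :: "'a::euclidean_space \<Rightarrow> 'b::banach"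
  assumes "S \<subseteq> T" "\<And>x. x \<in> T - S \<Longrightarrow> f x = 0"
  shows "integral S f = integral T f"
proof -
  have "integral S f = integral UNIV (\<lambda>x. if x \<in> S then f x else 0)"
    by (rule hk_integral_restrict_UNIV[symmetric])
  also have "(\<lambda>x. if x \<in> S then f x else 0) = (\<lambda>x. if x \<in> T then f x else 0)"
    using assms by fastforce
  also have "integral UNIV \<dots> = integral T f"
    by (rule hk_integral_restrict_UNIV)
  finally show ?thesis .
qed

lemma integral_UNIV_shift:
  fixes f :: "'a::euclidean_space \<Rightarrow> real"
  assumes "bounded {x. f x \<noteq> 0}"
  shows "integral UNIV (\<lambda>x. f (x - c)) = integral UNIV f"
proof -
  obtain B where B: "{x. f x \<noteq> 0} \<subseteq> cbox (- B) B" using bounded_subset_cbox_symmetric[OF assms] by blast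
  have "integral (cbox (- B) B) f = integral UNIV f"
    by (rule integral_eq_superset) (use B in auto)
  moreover have "integral (cbox (- B + c) (B + c)) (\<lambda>x. f (x - c)) = integral UNIV (\<lambda>x. f (x - c))"
  proof (rule integral_eq_superset)
    fix x assume x: "x \<in> UNIV - cbox (- B + c) (B + c)"
    have "x - c \<notin> cbox (- B) B"
      using x by (auto simp: mem_box algebra_simps inner_add_left inner_diff_left)
    then show "f (x - c) = 0" using B by blast
  qed simp
  moreover have "integral (cbox (- B) B) ((\<lambda>x. f (x - c)) \<circ> ((+) c)) = integral (cbox (- B + c) (B + c)) (\<lambda>x. f (x - c))"
    by (rule integral_shift_cbox_plus)
  ultimately show ?thesis by (simp add: o_def)
qed

text \<open>The integral of the translate of \<open>p\<close> by \<open>t\<close> along the axis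
  does not depend on \<open>t\<close>; differentiating it under the integral sign at
  \<open>t = 0\<close> gives the integral of \<open>p'\<close>.\<close>

lemma integral_partial_derivative_eq_0:
  fixes p p' :: "real^'k \<Rightarrow> real"
  assumes cont: "continuous_on UNIV p" and cont': "continuous_on UNIV p'"
    and der: "\<And>s. ((\<lambda>t. p (s + t *\<^sub>R axis j 1)) has_field_derivative p' s) (at 0)"
    and bdd: "bounded {s. p s \<noteq> 0}"
  shows "integral UNIV p' = 0"
proof -
  let ?e = "axis j 1 :: real^'k"
  obtain B where B: "B > 0" "\<And>s. p s \<noteq> 0 \<Longrightarrow> norm s \<le> B"
    using bdd unfolding bounded_pos by auto
  have psi0: "p s = 0" if "norm s > B" for s using B(2)[of s] that by force
  \<comment> \<open>The support lies within radius \<open>B\<close>; the margin leaves room for the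
    translations with \<open>\<bar>t\<bar> \<le> 1\<close>, so points outside \<open>C\<close> stay
    outside the support.\<close>
  define C where "C = cbox (\<chi> i. - (B + 2) :: real^'k) (\<chi> i. B + 2)"
  have C: "s \<in> C" if "norm s \<le> B + 2" for s
  proof -
    have "- (B + 2) \<le> s $ i \<and> s $ i \<le> B + 2" for i
      using component_le_norm_cart[of s i] that by linarith
    then show ?thesis unfolding C_def mem_box_cart by simp
  qed
  have out: "p (s + t *\<^sub>R ?e) = 0" if "s \<notin> C" "\<bar>t\<bar> \<le> 1" for s t
  proof (rule psi0)
    have "norm s > B + 2" using C that by force
    moreover have "norm s \<le> norm (s + t *\<^sub>R ?e) + norm (t *\<^sub>R ?e)"
      using norm_triangle_ineq4[of "s + t *\<^sub>R ?e" "t *\<^sub>R ?e"] by simp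
    ultimately show "norm (s + t *\<^sub>R ?e) > B" using that by (simp add: norm_axis_1)
  qed
  have der2: "((\<lambda>t. p (s + t *\<^sub>R ?e)) has_field_derivative p' (s + t *\<^sub>R ?e)) (at t)" for s t
  proof -
    have eq: "s + t *\<^sub>R ?e + x *\<^sub>R ?e = s + (x + t) *\<^sub>R ?e" for x
      by (simp add: scaleR_left_distrib)
    have "((\<lambda>x. p (s + (x + t) *\<^sub>R ?e)) has_field_derivative p' (s + t *\<^sub>R ?e)) (at 0)"
      using der[of "s + t *\<^sub>R ?e"] unfolding eq .
    from iffD2[OF DERIV_shift[of "\<lambda>t. p (s + t *\<^sub>R ?e)" "p' (s + t *\<^sub>R ?e)" 0 t] this]
    show ?thesis by (simp only: add_0_left)
  qed
  have out': "p' s = 0" if "s \<notin> C" for s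
  proof -
    have "((\<lambda>t. 0) has_field_derivative p' s) (at 0 within {-1<..<1})"
      by (rule has_field_derivative_transform_within[OF has_field_derivative_at_within[OF der[of s]]
            zero_less_one]) (use out[OF that] in auto)
    then have "((\<lambda>t. 0) has_field_derivative p' s) (at 0)"
      by (simp add: at_within_open[of 0 "{-1<..<1::real}"])
    then show ?thesis using DERIV_unique[OF _ DERIV_const] by blast
  qed
  have contT: "continuous_on A (\<lambda>s. p (s + t *\<^sub>R ?e))" for t A
    by (intro continuous_on_compose2[OF cont] continuous_intros) auto
  have contT': "continuous_on A (\<lambda>(t, s). p' (s + t *\<^sub>R ?e))" for A
    unfolding split_beta by (intro continuous_on_compose2[OF cont'] continuous_intros) auto
  have "((\<lambda>t. integral C (\<lambda>s. p (s + t *\<^sub>R ?e))) has_field_derivative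
           integral C (\<lambda>s. p' (s + 0 *\<^sub>R ?e))) (at 0 within {-1<..<1})"
    unfolding C_def
    by (rule leibniz_rule_field_derivative[where fx = "\<lambda>t s. p' (s + t *\<^sub>R ?e)"])
      (auto intro: has_field_derivative_at_within der2 integrable_continuous contT contT')
  then have D: "((\<lambda>t. integral C (\<lambda>s. p (s + t *\<^sub>R ?e))) has_field_derivative integral C p') 
      (at 0 within {-1<..<1})" by simp
  have const: "integral C (\<lambda>s. p (s + t *\<^sub>R ?e)) = integral C p" if "\<bar>t\<bar> \<le> 1" for t
  proof -
    have "integral C (\<lambda>s. p (s + t *\<^sub>R ?e)) = integral UNIV (\<lambda>s. p (s - - (t *\<^sub>R ?e)))"
      unfolding diff_minus_eq_add by (rule integral_eq_superset) (use out that in auto)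
    also have "\<dots> = integral UNIV p" by (rule integral_UNIV_shift[OF bdd])
    also have "\<dots> = integral C p"
      by (rule sym, rule integral_eq_superset) (use out[of _ 0] in auto)
    finally show ?thesis .
  qed
  have "((\<lambda>t. integral C p) has_field_derivative integral C p') (at 0 within {-1<..<1})"
    by (rule has_field_derivative_transform_within[OF D zero_less_one]) (use const in auto)
  then have "((\<lambda>t. integral C p) has_field_derivative integral C p') (at 0)"
    by (simp add: at_within_open[of 0 "{-1<..<1::real}"])
  then have "integral C p' = 0"
    using DERIV_unique[OF _ DERIV_const] by blast
  moreover have "integral C p' = integral UNIV p'"
    by (rule integral_eq_superset) (use out' in auto)
  ultimately show ?thesis by simp
qed

section \<open>The bump function and its gradient\<close>

lemma has_field_derivative_max0_power2:
  "((\<lambda>x::real. (max 0 x)\<^sup>2) has_field_derivative 2 * max 0 x) (at x)"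
proof (cases x "0::real" rule: linorder_cases)
  case less
  have "((\<lambda>x::real. 0) has_field_derivative 0) (at x)" by simp
  then have "((\<lambda>x::real. (max 0 x)\<^sup>2) has_field_derivative 0) (at x)"
    by (rule has_field_derivative_transform_within_open[of _ _ _ "{..<0}"]) (use less in auto)
  then show ?thesis using less by simp
next
  case greater
  have "((\<lambda>x::real. x\<^sup>2) has_field_derivative 2 * x) (at x)" by (auto intro!: derivative_eq_intros)
  then have "((\<lambda>x::real. (max 0 x)\<^sup>2) has_field_derivative 2 * x) (at x)"
    by (rule has_field_derivative_transform_within_open[of _ _ _ "{0<..}"]) (use greater in auto)
  then show ?thesis using greater by simp
next
  case equal
  have "((\<lambda>h::real. (max 0 h)\<^sup>2 / h) \<longlongrightarrow> 0) (at 0)"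
  proof (rule Lim_null_comparison)
    show "\<forall>\<^sub>F h::real in at 0. norm ((max 0 h)\<^sup>2 / h) \<le> \<bar>h\<bar>"
      by (auto simp: max_def power2_eq_square intro!: always_eventually)
    show "((\<lambda>h::real. \<bar>h\<bar>) \<longlongrightarrow> 0) (at 0)" by (rule tendsto_rabs_zero) simp
  qed
  then show ?thesis using equal by (simp add: DERIV_def)
qed

text \<open>Squaring the positive part makes the cut-off continuously differentiable, as the
  divergence argument requires. The total integral is left as a factor \<open>bump_mass\<close> in
  the counting formulas.\<close>

definition bump :: "real \<Rightarrow> 'a::real_inner \<Rightarrow> real" where
  "bump \<eta> y = (max 0 (\<eta>\<^sup>2 - y \<bullet> y))\<^sup>2"

definition bump_grad :: "real \<Rightarrow> 'a::real_inner \<Rightarrow> 'a" where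
  "bump_grad \<eta> y = (- 4 * max 0 (\<eta>\<^sup>2 - y \<bullet> y)) *\<^sub>R y"

abbreviation bump_mass :: "'k::finite itself \<Rightarrow> real \<Rightarrow> real" where
  "bump_mass K \<eta> \<equiv> integral UNIV (bump \<eta> :: real^'k \<Rightarrow> real)"

lemma bump_eq_0: "0 \<le> \<eta> \<Longrightarrow> \<eta> \<le> norm y \<Longrightarrow> bump \<eta> y = 0"
  by (simp add: bump_def dot_square_norm abs_le_square_iff[symmetric] max_def)

lemma bump_grad_eq_0: "0 \<le> \<eta> \<Longrightarrow> \<eta> \<le> norm y \<Longrightarrow> bump_grad \<eta> y = 0"
  by (simp add: bump_grad_def dot_square_norm abs_le_square_iff[symmetric] max_def)

lemma continuous_on_bump [continuous_intros]:
  "continuous_on S f \<Longrightarrow> continuous_on S (\<lambda>x. bump \<eta> (f x))"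
  unfolding bump_def by (intro continuous_intros)

lemma continuous_on_bump_grad [continuous_intros]:
  "continuous_on S f \<Longrightarrow> continuous_on S (\<lambda>x. bump_grad \<eta> (f x))"
  unfolding bump_grad_def by (intro continuous_intros)

lemma has_field_derivative_bump:
  assumes "(u has_vector_derivative u') (at t)"
  shows "((\<lambda>t. bump \<eta> (u t)) has_field_derivative bump_grad \<eta> (u t) \<bullet> u') (at t)"
proof -
  have "((\<lambda>t. u t \<bullet> u t) has_derivative (\<lambda>h. u t \<bullet> (h *\<^sub>R u') + (h *\<^sub>R u') \<bullet> u t)) (at t)"
    using assms unfolding has_vector_derivative_def by (intro has_derivative_inner)
  then have "((\<lambda>t. u t \<bullet> u t) has_field_derivative 2 * (u t \<bullet> u')) (at t)"
    unfolding has_field_derivative_def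
    by (rule has_derivative_eq_rhs) (auto simp: inner_commute algebra_simps)
  then have "((\<lambda>t. \<eta>\<^sup>2 - u t \<bullet> u t) has_field_derivative - (2 * (u t \<bullet> u'))) (at t)"
    by (auto intro!: derivative_eq_intros)
  from DERIV_chain2[OF has_field_derivative_max0_power2 this] show ?thesis
    unfolding bump_def bump_grad_def by (simp add: algebra_simps)
qed

lemma continuous_on_det [continuous_intros]:
  fixes A :: "'a::topological_space \<Rightarrow> real^'k^'k"
  assumes "continuous_on S A"
  shows "continuous_on S (\<lambda>x. det (A x))"
  unfolding det_def by (intro continuous_intros assms)

lemma continuous_on_setrow [continuous_intros]:
  fixes A :: "'a::topological_space \<Rightarrow> real^'k::finite^'k"
  assumes "continuous_on S A" "continuous_on S f"
  shows "continuous_on S (\<lambda>x. setrow i (f x) (A x))"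
proof -
  have "continuous_on S (\<lambda>x. if k = i then f x else A x $ k)" for k
    using assms by (cases "k = i") (auto intro!: continuous_intros)
  then show ?thesis unfolding setrow_def by (intro continuous_on_vec_lambda)
qed

section \<open>Twice differentiable maps with explicit partial derivatives\<close>

type_synonym 'k vfield = "real^'k \<Rightarrow> real^'k"

abbreviation has_partials :: "(real^'k::finite \<Rightarrow> 'b::real_normed_vector) \<Rightarrow> ('k \<Rightarrow> real^'k \<Rightarrow> 'b) \<Rightarrow> real^'k \<Rightarrow> bool" where
  "has_partials f f1 x \<equiv> (f has_derivative (\<lambda>v. \<Sum>j\<in>UNIV. v $ j *\<^sub>R f1 j x)) (at x)"

text \<open>The derivatives are arguments, so that linear homotopies and affine maps come with
  theirs by formula. The symmetry of the second derivatives is what cancels the divergence of the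
  cofactors.\<close>

definition C2 :: "('k::finite) vfield \<Rightarrow> ('k \<Rightarrow> 'k vfield) \<Rightarrow>
    ('k \<Rightarrow> 'k \<Rightarrow> 'k vfield) \<Rightarrow> bool" where
  "C2 f f1 f2 \<longleftrightarrow>
     (\<forall>x. has_partials f f1 x) \<and>
     (\<forall>j x. has_partials (f1 j) (f2 j) x) \<and>
     (\<forall>j p. continuous_on UNIV (f2 j p)) \<and>
     (\<forall>j p x. f2 j p x = f2 p j x)"

definition jac :: "('k \<Rightarrow> 'k vfield) \<Rightarrow> real^'k \<Rightarrow> real^'k^'k::finite" where
  "jac f1 x = (\<chi> i j. f1 j x $ i)"

abbreviation bump_integral :: "real \<Rightarrow> ('k::finite) vfield \<Rightarrow> ('k \<Rightarrow> 'k vfield) \<Rightarrow> (real^'k) set \<Rightarrow> real" where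
  "bump_integral \<eta> f f1 U \<equiv> integral U (\<lambda>s. bump \<eta> (f s) * det (jac f1 s))"

lemma jac_nth [simp]: "jac f1 x $ i $ j = f1 j x $ i"
  by (simp add: jac_def)

lemma continuous_on_jac [continuous_intros]:
  "(\<And>j. continuous_on S (\<lambda>x. F x j (h x))) \<Longrightarrow> continuous_on S (\<lambda>x. jac (F x) (h x))"
  unfolding jac_def by (intro continuous_intros)

lemma has_vector_derivative_along_axis_at:
  assumes "\<And>x. has_partials f f1 x"
  shows "((\<lambda>t. f (x + t *\<^sub>R axis j 1)) has_vector_derivative f1 j (x + t *\<^sub>R axis j 1)) (at t)"
proof -
  let ?y = "x + t *\<^sub>R axis j (1::real)"
  have "((\<lambda>t. x + t *\<^sub>R axis j (1::real)) has_derivative (\<lambda>t. t *\<^sub>R axis j 1)) (at t)"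
    by (auto intro!: derivative_eq_intros)
  from has_derivative_compose[OF this assms]
  have "((\<lambda>t. f (x + t *\<^sub>R axis j 1)) has_derivative
      (\<lambda>t. \<Sum>i\<in>UNIV. (t *\<^sub>R axis j (1::real)) $ i *\<^sub>R f1 i ?y)) (at t)" .
  moreover have "(\<Sum>i\<in>UNIV. (t *\<^sub>R axis j (1::real)) $ i *\<^sub>R f1 i ?y) = t *\<^sub>R f1 j ?y" for t
    by (subst sum.remove[of _ j]) (auto intro!: sum.neutral simp: axis_def)
  ultimately show ?thesis by (simp add: has_vector_derivative_def)
qed

lemma has_vector_derivative_along_axis:
  assumes "\<And>x. has_partials f f1 x"
  shows "((\<lambda>t. f (x + t *\<^sub>R axis j 1)) has_vector_derivative f1 j x) (at 0)"
  using has_vector_derivative_along_axis_at[OF assms, of x j 0] by simp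

lemma C2_linear_homotopy:
  assumes "C2 f f1 f2" "C2 g g1 g2"
  shows "C2 (\<lambda>x. f x + t *\<^sub>R (g x - f x)) (\<lambda>j x. f1 j x + t *\<^sub>R (g1 j x - f1 j x))
     (\<lambda>j p x. f2 j p x + t *\<^sub>R (g2 j p x - f2 j p x))"
proof -
  have lin: "(\<Sum>j\<in>UNIV. v $ j *\<^sub>R a j) + t *\<^sub>R ((\<Sum>j\<in>UNIV. v $ j *\<^sub>R b j) - (\<Sum>j\<in>UNIV. v $ j *\<^sub>R a j))
     = (\<Sum>j\<in>UNIV. v $ j *\<^sub>R (a j + t *\<^sub>R (b j - a j)))" for v :: "real^'a" and a b :: "'a \<Rightarrow> real^'a"
    by (simp add: algebra_simps sum.distrib sum_subtractf scaleR_sum_right)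
  show ?thesis
    using assms unfolding C2_def lin[symmetric]
    by (auto intro!: has_derivative_add has_derivative_scaleR_right has_derivative_diff continuous_intros)
qed

lemma C2_continuous:
  assumes "C2 f f1 f2"
  shows "continuous_on S f" "continuous_on S (f1 j)" "continuous_on S (f2 j p)"
  using assms unfolding C2_def
  by (meson continuous_on_eq_continuous_at has_derivative_continuous continuous_at_imp_continuous_on
      continuous_on_subset subset_UNIV)+

lemma has_field_derivative_cart_nth:
  "(f has_vector_derivative f') (at t) \<Longrightarrow> ((\<lambda>t. f t $ i) has_field_derivative f' $ i) (at t)"
  unfolding has_real_derivative_iff_has_vector_derivative
  by (rule bounded_linear.has_vector_derivative[OF bounded_linear_vec_nth])

section \<open>The cofactor field and its divergence\<close>

abbreviation cofac :: "real^'k::finite^'k \<Rightarrow> 'k \<Rightarrow> 'k \<Rightarrow> real" where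
  "cofac A i j \<equiv> det (setrow i (axis j 1) A)"

text \<open>The contribution of row \<open>l\<close> when the cofactor \<open>(i, j)\<close> of the
  Jacobian of \<open>G\<close> is differentiated along the axis \<open>j\<close>: row
  \<open>l\<close> is replaced by its partial derivative in that direction.\<close>

abbreviation row_deriv where
  "row_deriv A G2 s i j l \<equiv> det (setrow l (\<chi> p. G2 p j s $ l) (setrow i (axis j 1) A))"

text \<open>The field whose divergence is the derivative of \<open>\<phi>(G) det DG\<close> in the direction \<open>w\<close>:
  \<open>\<phi>(G)\<close> times the \<open>w\<close>-combination of the rows of the cofactor matrix, which are divergence-free.\<close>

definition cof_field :: "real \<Rightarrow> ('k::finite) vfield \<Rightarrow> ('k \<Rightarrow> 'k vfield) \<Rightarrow>
    'k vfield \<Rightarrow> 'k \<Rightarrow> real^'k \<Rightarrow> real" where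
  "cof_field \<eta> G G1 w j s =
     bump \<eta> (G s) * (\<Sum>i\<in>UNIV. w s $ i * cofac (jac G1 s) i j)"

definition cof_field_deriv :: "real \<Rightarrow> ('k::finite) vfield \<Rightarrow> ('k \<Rightarrow> 'k vfield) \<Rightarrow>
    ('k \<Rightarrow> 'k \<Rightarrow> 'k vfield) \<Rightarrow>
    'k vfield \<Rightarrow> ('k \<Rightarrow> 'k vfield) \<Rightarrow> 'k \<Rightarrow> real^'k \<Rightarrow> real" where
  "cof_field_deriv \<eta> G G1 G2 w w1 j s =
     (bump_grad \<eta> (G s) \<bullet> G1 j s) * (\<Sum>i\<in>UNIV. w s $ i * cofac (jac G1 s) i j) +
     bump \<eta> (G s) * (\<Sum>i\<in>UNIV. w1 j s $ i * cofac (jac G1 s) i j +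
        w s $ i * (\<Sum>l\<in>UNIV - {i}. row_deriv (jac G1 s) G2 s i j l))"

lemma cof_field_has_field_derivative:
  assumes G: "C2 G G1 G2"
    and w: "\<And>x. has_partials w w1 x"
  shows "((\<lambda>t. cof_field \<eta> G G1 w j (s + t *\<^sub>R axis j 1)) has_field_derivative
           cof_field_deriv \<eta> G G1 G2 w w1 j s) (at 0)"
proof -
  let ?s = "\<lambda>t. s + t *\<^sub>R axis j (1::real)"
  have dG: "((\<lambda>t. G (?s t)) has_vector_derivative G1 j s) (at 0)"
    using G by (intro has_vector_derivative_along_axis) (auto simp: C2_def)
  have dG1: "((\<lambda>t. G1 p (?s t)) has_vector_derivative G2 p j s) (at 0)" for p
    using G unfolding C2_def by (intro has_vector_derivative_along_axis[of _ "G2 p"]) blast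
  have dw: "((\<lambda>t. w (?s t)) has_vector_derivative w1 j s) (at 0)"
    using w by (intro has_vector_derivative_along_axis)
  have ddet: "((\<lambda>t. cofac (jac G1 (?s t)) i j) has_field_derivative
     (\<Sum>l\<in>UNIV - {i}. row_deriv (jac G1 s) G2 s i j l)) (at 0)" for i
  proof -
    \<comment> \<open>Row \<open>i\<close> is the fixed unit vector, so its derivative is zero and
      the term \<open>l = i\<close> drops out of the sum.\<close>
    define A' :: "real^'a^'a" where "A' = (\<chi> k p. if k = i then 0 else G2 p j s $ k)"
    have "((\<lambda>t. cofac (jac G1 (?s t)) i j) has_field_derivative
      (\<Sum>l\<in>UNIV. det (\<chi> k. if k = l then A' $ l else setrow i (axis j 1) (jac G1 (?s 0)) $ k))) (at 0)"
    proof (rule det_has_field_derivative)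
      fix k p
      show "((\<lambda>t. setrow i (axis j 1) (jac G1 (?s t)) $ k $ p) has_field_derivative A' $ k $ p) (at 0)"
        using has_field_derivative_cart_nth[OF dG1[of p], of k] by (auto simp: A'_def)
    qed
    also have "(\<Sum>l\<in>UNIV. det (\<chi> k. if k = l then A' $ l else setrow i (axis j 1) (jac G1 (?s 0)) $ k))
       = (\<Sum>l\<in>UNIV - {i}. det (\<chi> k. if k = l then A' $ l else setrow i (axis j 1) (jac G1 (?s 0)) $ k))"
      by (rule sum.mono_neutral_right)
         (auto intro!: det_zero_row(1)[of i] simp: row_def A'_def vec_eq_iff)
    also have "\<dots> = (\<Sum>l\<in>UNIV - {i}. row_deriv (jac G1 s) G2 s i j l)"
      by (rule sum.cong[OF refl], rule arg_cong[of _ _ det]) (auto simp: A'_def vec_eq_iff)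
    finally show ?thesis .
  qed
  have "((\<lambda>t. cof_field \<eta> G G1 w j (?s t)) has_field_derivative
     (bump_grad \<eta> (G (?s 0)) \<bullet> G1 j s) *
        (\<Sum>i\<in>UNIV. w (?s 0) $ i * cofac (jac G1 (?s 0)) i j) +
      (\<Sum>i\<in>UNIV. w1 j s $ i * cofac (jac G1 (?s 0)) i j +
        (\<Sum>l\<in>UNIV - {i}. row_deriv (jac G1 s) G2 s i j l) * w (?s 0) $ i)
       * bump \<eta> (G (?s 0))) (at 0)"
    unfolding cof_field_def
    by (intro DERIV_mult has_field_derivative_bump dG DERIV_sum has_field_derivative_cart_nth[OF dw] ddet)
  then show ?thesis unfolding cof_field_deriv_def by (simp add: mult.commute)
qed

text \<open>The product rule yields three sums. In the one with the gradient of the bump,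
  \<open>det_setrow_self\<close> leaves only the diagonal terms; the derivatives of \<open>w\<close>
  recombine into determinants with one replaced row; the second derivatives of \<open>G\<close>
  cancel by symmetry. The result is the derivative of
  \<open>bump \<eta> (G s) * det (jac G1 s)\<close> when \<open>G\<close> moves with velocity
  \<open>w\<close>.\<close>

lemma sum_cof_field_deriv:
  assumes G: "C2 G G1 G2"
  shows "(\<Sum>j\<in>UNIV. cof_field_deriv \<eta> G G1 G2 w w1 j s) =
     (bump_grad \<eta> (G s) \<bullet> w s) * det (jac G1 s) +
     bump \<eta> (G s) * (\<Sum>i\<in>UNIV. det (setrow i (jac w1 s $ i) (jac G1 s)))"
proof -
  define R where "R = jac G1 s"
  define D where "D = (\<lambda>i j. cofac R i j)"
  define d where "d = bump_grad \<eta> (G s)"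
  have "(\<Sum>j\<in>UNIV. (d \<bullet> G1 j s) * (\<Sum>i\<in>UNIV. w s $ i * D i j))
     = (\<Sum>j\<in>UNIV. \<Sum>k\<in>UNIV. \<Sum>i\<in>UNIV. w s $ i * (d $ k * (R $ k $ j * D i j)))"
    by (simp add: inner_vec_def sum_product R_def sum_distrib_left sum_distrib_right mult_ac)
  also have "\<dots> = (\<Sum>j\<in>UNIV. \<Sum>i\<in>UNIV. \<Sum>k\<in>UNIV. w s $ i * (d $ k * (R $ k $ j * D i j)))"
    by (intro sum.cong refl sum.swap)
  also have "\<dots> = (\<Sum>i\<in>UNIV. \<Sum>j\<in>UNIV. \<Sum>k\<in>UNIV. w s $ i * (d $ k * (R $ k $ j * D i j)))"
    by (rule sum.swap)
  also have "\<dots> = (\<Sum>i\<in>UNIV. \<Sum>k\<in>UNIV. \<Sum>j\<in>UNIV. w s $ i * (d $ k * (R $ k $ j * D i j)))"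
    by (intro sum.cong refl sum.swap)
  also have "\<dots> = (\<Sum>i\<in>UNIV. \<Sum>k\<in>UNIV. w s $ i * (d $ k * det (setrow i (R $ k) R)))"
    unfolding D_def by (simp only: det_setrow_expand[of _ "R $ _" R] sum_distrib_left)
  also have "\<dots> = (\<Sum>i\<in>UNIV. w s $ i * (d $ i * det R))"
    by (simp add: det_setrow_self if_distrib cong: if_cong)
  also have "\<dots> = (d \<bullet> w s) * det R"
    by (simp add: inner_vec_def sum_distrib_left sum_distrib_right mult_ac)
  finally have S1: "(\<Sum>j\<in>UNIV. (d \<bullet> G1 j s) * (\<Sum>i\<in>UNIV. w s $ i * D i j)) = (d \<bullet> w s) * det R" .
  have "(\<Sum>j\<in>UNIV. \<Sum>i\<in>UNIV. w1 j s $ i * D i j) = (\<Sum>i\<in>UNIV. \<Sum>j\<in>UNIV. jac w1 s $ i $ j * D i j)"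
    by (subst sum.swap) simp
  also have "\<dots> = (\<Sum>i\<in>UNIV. det (setrow i (jac w1 s $ i) R))"
    unfolding D_def by (simp only: det_setrow_expand[of _ "jac w1 s $ _" R])
  finally have S2: "(\<Sum>j\<in>UNIV. \<Sum>i\<in>UNIV. w1 j s $ i * D i j)
     = (\<Sum>i\<in>UNIV. det (setrow i (jac w1 s $ i) R))" .
  have inner0: "(\<Sum>j\<in>UNIV. row_deriv R G2 s i j l) = 0"
    if "l \<noteq> i" for i l
  proof -
    have "G2 p j s = G2 j p s" for j p using G unfolding C2_def by blast
    then have "(\<Sum>j\<in>UNIV. \<Sum>p\<in>UNIV. G2 p j s $ l * det (setrow l (axis p 1) (setrow i (axis j 1) R))) = 0"
      by (intro sum_setrow_symmetric[OF that, of "\<lambda>j p. G2 p j s $ l" R]) metis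
    then show ?thesis by (simp add: det_setrow_expand[of l "\<chi> p. G2 p _ s $ l"])
  qed
  have "(\<Sum>j\<in>UNIV. \<Sum>i\<in>UNIV. w s $ i * (\<Sum>l\<in>UNIV - {i}. row_deriv R G2 s i j l))
    = (\<Sum>i\<in>UNIV. w s $ i * (\<Sum>j\<in>UNIV. \<Sum>l\<in>UNIV - {i}. row_deriv R G2 s i j l))"
    by (subst sum.swap) (simp add: sum_distrib_left)
  also have "\<dots> = (\<Sum>i\<in>UNIV. w s $ i * (\<Sum>l\<in>UNIV - {i}. \<Sum>j\<in>UNIV. row_deriv R G2 s i j l))"
    by (intro sum.cong refl arg_cong2[of _ _ _ _ "(*)"] sum.swap)
  also have "\<dots> = 0" by (simp add: inner0)
  finally have S3: "(\<Sum>j\<in>UNIV. \<Sum>i\<in>UNIV. w s $ i * (\<Sum>l\<in>UNIV - {i}. row_deriv R G2 s i j l)) = 0" .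
  have "(\<Sum>j\<in>UNIV. cof_field_deriv \<eta> G G1 G2 w w1 j s) =
     (\<Sum>j\<in>UNIV. (d \<bullet> G1 j s) * (\<Sum>i\<in>UNIV. w s $ i * D i j)) + bump \<eta> (G s) *
      ((\<Sum>j\<in>UNIV. \<Sum>i\<in>UNIV. w1 j s $ i * D i j) + (\<Sum>j\<in>UNIV. \<Sum>i\<in>UNIV. w s $ i * (\<Sum>l\<in>UNIV - {i}. row_deriv R G2 s i j l)))"
    unfolding cof_field_deriv_def d_def D_def R_def
    by (simp add: sum.distrib flip: sum_distrib_left)
  then show ?thesis unfolding S1 S2 S3 by (simp add: d_def R_def)
qed

section \<open>Extension by zero and the divergence theorem\<close>

text \<open>Extension by zero turns integrals over an arbitrary bounded open \<open>U\<close> into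
  integrals of continuous functions over a box, where integrability and differentiation under the
  integral sign are at hand. The extension is glued from the closed sets \<open>closure U\<close>
  and \<open>- U\<close>.\<close>

lemma continuous_on_if_zero_frontier:
  fixes F :: "real \<Rightarrow> 'a::euclidean_space \<Rightarrow> real"
  assumes "open U" "closed T" "continuous_on (T \<times> UNIV) (\<lambda>(t, s). F t s)"
    and "\<And>t s. t \<in> T \<Longrightarrow> s \<in> frontier U \<Longrightarrow> F t s = 0"
  shows "continuous_on (T \<times> UNIV) (\<lambda>(t, s). if s \<in> U then F t s else 0)"
proof -
  have "continuous_on (T \<times> closure U \<union> T \<times> (- U)) (\<lambda>x. if snd x \<in> U then (\<lambda>(t, s). F t s) x else 0)"
  proof (rule continuous_on_cases)
    show "closed (T \<times> closure U)" "closed (T \<times> - U)"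
      using assms(1,2) by (auto intro: closed_Times)
    show "continuous_on (T \<times> closure U) (\<lambda>(t, s). F t s)"
      by (rule continuous_on_subset[OF assms(3)]) auto
    show "\<forall>x. x \<in> T \<times> closure U \<and> snd x \<notin> U \<or> x \<in> T \<times> - U \<and> snd x \<in> U \<longrightarrow> (\<lambda>(t, s). F t s) x = 0"
      using assms(1,4) by (auto simp: frontier_def interior_open)
  qed simp
  moreover have "T \<times> closure U \<union> T \<times> (- U) = T \<times> UNIV" using closure_subset[of U] by auto
  ultimately show ?thesis by (simp add: split_beta cong: if_cong)
qed

lemma continuous_on_if_zero_frontier':
  fixes F :: "'a::euclidean_space \<Rightarrow> real"
  assumes "open U" "continuous_on UNIV F" "\<And>s. s \<in> frontier U \<Longrightarrow> F s = 0"
  shows "continuous_on UNIV (\<lambda>s. if s \<in> U then F s else 0)"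
proof -
  have "continuous_on (UNIV \<times> UNIV) (\<lambda>(t::real, s). if s \<in> U then F s else 0)"
    by (rule continuous_on_if_zero_frontier)
       (use assms in \<open>auto simp: split_beta intro!: continuous_on_compose2[OF assms(2)] continuous_intros\<close>)
  from continuous_on_compose2[OF this, of UNIV "\<lambda>s. (0, s)"] show ?thesis
    by (simp add: continuous_intros)
qed

text \<open>The bump annihilates the cofactor field near the frontier, where
  \<open>norm (G s) > \<eta>\<close>. Hence component \<open>j\<close> of the field, extended by
  zero, has a continuous \<open>j\<close>-th partial derivative and bounded support, and that
  derivative integrates to zero.\<close>

lemma integral_cof_field_divergence_eq_0:
  fixes G :: "('k::finite) vfield"
  assumes U: "open U" "bounded U" and \<eta>: "0 \<le> \<eta>"
    and G: "C2 G G1 G2"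
    and w: "\<And>x. has_partials w w1 x"
    and w1: "\<And>j. continuous_on UNIV (w1 j)"
    and fr: "\<And>s. s \<in> frontier U \<Longrightarrow> \<eta> < norm (G s)"
  shows "integral U (\<lambda>s. (bump_grad \<eta> (G s) \<bullet> w s) * det (jac G1 s) +
     bump \<eta> (G s) * (\<Sum>i\<in>UNIV. det (setrow i (jac w1 s $ i) (jac G1 s)))) = 0"
proof -
  note contG = C2_continuous[OF G]
  have contw: "continuous_on UNIV w"
    using w by (meson continuous_at_imp_continuous_on has_derivative_continuous)
  have contV: "continuous_on UNIV (cof_field \<eta> G G1 w j)" for j
    unfolding cof_field_def
    by (intro continuous_intros contG contw)
  have contV': "continuous_on UNIV (cof_field_deriv \<eta> G G1 G2 w w1 j)" for j
    unfolding cof_field_deriv_def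
    by (intro continuous_intros contG contw w1)
  define V where "V = (\<lambda>j s. if s \<in> U then cof_field \<eta> G G1 w j s else 0)"
  define V' where "V' = (\<lambda>j s. if s \<in> U then cof_field_deriv \<eta> G G1 G2 w w1 j s else 0)"
  have z: "bump \<eta> (G s) = 0" "bump_grad \<eta> (G s) = 0" if "norm (G s) \<ge> \<eta>" for s
    using that \<eta> by (auto simp: bump_eq_0 bump_grad_eq_0)
  have cV: "continuous_on UNIV (V j)" for j unfolding V_def
    by (rule continuous_on_if_zero_frontier'[OF U(1) contV])
       (use fr z in \<open>auto simp: cof_field_def less_imp_le\<close>)
  have cV': "continuous_on UNIV (V' j)" for j unfolding V'_def
    by (rule continuous_on_if_zero_frontier'[OF U(1) contV'])
       (use fr z in \<open>auto simp: cof_field_deriv_def less_imp_le\<close>)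
  have "integral UNIV (V' j) = 0" for j
  proof (rule integral_partial_derivative_eq_0[OF cV cV'])
    show "bounded {s. V j s \<noteq> 0}"
      by (rule bounded_subset[OF U(2)]) (auto simp: V_def)
    fix s
    let ?s = "\<lambda>t. s + t *\<^sub>R axis j (1::real)"
    show "((\<lambda>t. V j (?s t)) has_field_derivative V' j s) (at 0)"
    proof (cases "s \<in> U")
      case True
      have "((\<lambda>t. cof_field \<eta> G G1 w j (?s t)) has_field_derivative V' j s) (at 0)"
        using cof_field_has_field_derivative[OF G w] True by (simp add: V'_def)
      moreover have "open (?s -` U)"
        by (intro open_vimage U continuous_intros)
      ultimately show ?thesis
        by (rule has_field_derivative_transform_within_open) (use True in \<open>auto simp: V_def\<close>)
    next
      case False
      \<comment> \<open>\<open>N\<close> is an open set containing every point outside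
        \<open>U\<close>: such a point is off the closure, or it is a frontier point, where
        \<open>G\<close> is large. The extended field is zero on all of \<open>N\<close>.\<close>
      define N where "N = {x. norm (G x) > \<eta>} \<union> - closure U"
      have "open N" unfolding N_def
        by (intro open_Un open_Collect_less continuous_intros contG) auto
      then have "open (?s -` N)"
        by (intro open_vimage continuous_intros)
      moreover have "s \<in> N"
        using fr[of s] False U(1) by (auto simp: N_def frontier_def interior_open)
      moreover have "V j x = 0" if "x \<in> N" for x
        using that z(1)[of x] closure_subset[of U] by (auto simp: N_def V_def cof_field_def)
      moreover have "((\<lambda>t. 0) has_field_derivative 0) (at (0::real))" by simp
      ultimately have "((\<lambda>t. V j (?s t)) has_field_derivative 0) (at 0)"
        by - (rule has_field_derivative_transform_within_open[of "\<lambda>_. 0" 0 0 "?s -` N"], auto)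
      then show ?thesis using False by (simp add: V'_def)
    qed
  qed
  moreover have "V' j integrable_on UNIV" for j
  proof -
    obtain B where B: "U \<subseteq> cbox (- B) B" using bounded_subset_cbox_symmetric[OF U(2)] by blast
    have "V' j integrable_on cbox (- B) B"
      by (intro integrable_continuous continuous_on_subset[OF cV']) auto
    then have "(\<lambda>s. if s \<in> cbox (- B) B then V' j s else 0) integrable_on UNIV"
      by (simp add: Henstock_Kurzweil_Integration.integrable_restrict_UNIV)
    moreover have "(\<lambda>s. if s \<in> cbox (- B) B then V' j s else 0) = V' j"
      using subsetD[OF B] by (intro ext) (simp add: V'_def)
    ultimately show ?thesis by simp
  qed
  ultimately have "integral UNIV (\<lambda>s. \<Sum>j\<in>UNIV. V' j s) = 0"
    by (simp add: integral_sum)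
  also have "(\<lambda>s. \<Sum>j\<in>UNIV. V' j s) = (\<lambda>s. if s \<in> U then (\<Sum>j\<in>UNIV. cof_field_deriv \<eta> G G1 G2 w w1 j s) else 0)"
    by (auto simp: V'_def)
  finally show ?thesis
    by (simp add: hk_integral_restrict_UNIV sum_cof_field_deriv[OF G])
qed

lemma bump_integral_homotopy:
  fixes f g :: "('k::finite) vfield"
  assumes U: "open U" "bounded U" and \<eta>: "0 \<le> \<eta>"
    and f: "C2 f f1 f2" and g: "C2 g g1 g2"
    and fr: "\<And>t s. 0 \<le> t \<Longrightarrow> t \<le> 1 \<Longrightarrow> s \<in> frontier U \<Longrightarrow> \<eta> < norm (f s + t *\<^sub>R (g s - f s))"
  shows "bump_integral \<eta> f f1 U = bump_integral \<eta> g g1 U"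
proof -
  define G where "G = (\<lambda>t s. f s + t *\<^sub>R (g s - f s))"
  define G1 where "G1 = (\<lambda>t j s. f1 j s + t *\<^sub>R (g1 j s - f1 j s))"
  define w where "w = (\<lambda>s. g s - f s)"
  define w1 where "w1 = (\<lambda>j s. g1 j s - f1 j s)"
  define u where "u = (\<lambda>t s. bump \<eta> (G t s) * det (jac (G1 t) s))"
  define u' where "u' = (\<lambda>t s. (bump_grad \<eta> (G t s) \<bullet> w s) * det (jac (G1 t) s) +
     bump \<eta> (G t s) * (\<Sum>i\<in>UNIV. det (setrow i (jac w1 s $ i) (jac (G1 t) s))))"
  note cont = C2_continuous[OF f] C2_continuous[OF g]
  have w: "has_partials w w1 x" for x
  proof -
    have "(w has_derivative (\<lambda>v. (\<Sum>j\<in>UNIV. v $ j *\<^sub>R g1 j x) - (\<Sum>j\<in>UNIV. v $ j *\<^sub>R f1 j x))) (at x)"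
      using f g unfolding C2_def w_def by (intro has_derivative_diff) auto
    then show ?thesis by (simp add: w1_def algebra_simps sum_subtractf)
  qed
  have w1: "continuous_on UNIV (w1 j)" for j
    unfolding w1_def by (intro continuous_intros cont)
  have der: "((\<lambda>t. u t s) has_field_derivative u' t s) (at t)" for t s
  proof -
    have dG: "((\<lambda>t. G t s) has_vector_derivative w s) (at t)"
      unfolding G_def w_def by (auto intro!: derivative_eq_intros)
    have dG1: "((\<lambda>t. G1 t j s) has_vector_derivative w1 j s) (at t)" for j
      unfolding G1_def w1_def by (auto intro!: derivative_eq_intros)
    have "((\<lambda>t. det (jac (G1 t) s)) has_field_derivative
      (\<Sum>l\<in>UNIV. det (\<chi> i. if i = l then jac w1 s $ l else jac (G1 t) s $ i))) (at t)"
      by (rule det_has_field_derivative) (simp add: has_field_derivative_cart_nth[OF dG1])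
    then have "((\<lambda>t. det (jac (G1 t) s)) has_field_derivative
      (\<Sum>i\<in>UNIV. det (setrow i (jac w1 s $ i) (jac (G1 t) s)))) (at t)"
      by (simp add: setrow_def)
    from DERIV_mult[OF has_field_derivative_bump[OF dG] this] show ?thesis
      unfolding u_def u'_def by (simp add: mult.commute)
  qed
  have c1: "continuous_on A (\<lambda>x. f (snd x))" "continuous_on A (\<lambda>x. g (snd x))" "continuous_on A (\<lambda>x. f1 j (snd x))"
       "continuous_on A (\<lambda>x. g1 j (snd x))" for A :: "(real \<times> (real^'k)) set" and j
    by (auto intro!: continuous_on_compose2[OF cont(1)[of UNIV]] continuous_on_compose2[OF cont(4)[of UNIV]]
        continuous_on_compose2[OF cont(2)[of UNIV]] continuous_on_compose2[OF cont(5)[of UNIV]] continuous_intros)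
  have contu: "continuous_on A (\<lambda>(t, s). u t s)" for A
    unfolding u_def split_beta G_def G1_def
    by (intro continuous_intros c1)
  have contu': "continuous_on A (\<lambda>(t, s). u' t s)" for A
    unfolding u'_def split_beta G_def G1_def w_def w1_def
    by (intro continuous_intros c1)
  have z: "bump \<eta> (G t s) = 0" "bump_grad \<eta> (G t s) = 0" if "0 \<le> t" "t \<le> 1" "s \<in> frontier U" for t s
    using fr[OF that] \<eta> by (auto simp: bump_eq_0 bump_grad_eq_0 G_def)
  obtain B where B: "U \<subseteq> cbox (- B) B" using bounded_subset_cbox_symmetric[OF U(2)] by blast
  have restr: "integral (cbox (- B) B) (\<lambda>s. if s \<in> U then h s else 0) = integral U h" for h :: "_ \<Rightarrow> real"
    using B by (simp add: integral_restrict_Int Int_absorb2)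
  have cu: "continuous_on ({0..1} \<times> UNIV) (\<lambda>(t, s). if s \<in> U then u t s else 0)"
    by (rule continuous_on_if_zero_frontier[OF U(1) _ contu]) (simp_all add: u_def z)
  have cu': "continuous_on ({0..1} \<times> UNIV) (\<lambda>(t, s). if s \<in> U then u' t s else 0)"
    by (rule continuous_on_if_zero_frontier[OF U(1) _ contu']) (simp_all add: u'_def z)
  have int0: "integral U (u' t) = 0" if "0 \<le> t" "t \<le> 1" for t
    unfolding u'_def
  proof (rule integral_cof_field_divergence_eq_0[OF U \<eta> _ w w1])
    show "C2 (G t) (G1 t) (\<lambda>j p x. f2 j p x + t *\<^sub>R (g2 j p x - f2 j p x))"
      unfolding G_def G1_def by (rule C2_linear_homotopy[OF f g])
  qed (use fr that in \<open>auto simp: G_def\<close>)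
  have D: "((\<lambda>t. integral U (u t)) has_field_derivative 0) (at t within {0..1})" if "t \<in> {0..1}" for t
  proof -
    have "((\<lambda>t. integral (cbox (- B) B) (\<lambda>s. if s \<in> U then u t s else 0)) has_field_derivative
        integral (cbox (- B) B) (\<lambda>s. if s \<in> U then u' t s else 0)) (at t within {0..1})"
    proof (rule leibniz_rule_field_derivative)
      fix t s assume "t \<in> {0..1::real}"
      show "((\<lambda>t. if s \<in> U then u t s else 0) has_field_derivative (if s \<in> U then u' t s else 0))
          (at t within {0..1})"
        using has_field_derivative_at_within[OF der] by simp
    next
      fix t assume t: "t \<in> {0..1::real}"
      have "continuous_on (cbox (- B) B) (\<lambda>s. (\<lambda>(t, s). if s \<in> U then u t s else 0) (t, s))"
        by (rule continuous_on_compose2[OF cu, of _ "\<lambda>s. (t, s)"])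
           (use t in \<open>auto intro!: continuous_on_Pair continuous_on_const continuous_on_id\<close>)
      then show "(\<lambda>s. if s \<in> U then u t s else 0) integrable_on cbox (- B) B"
        by (intro integrable_continuous) simp
    next
      show "continuous_on ({0..1} \<times> cbox (- B) B) (\<lambda>(t, s). if s \<in> U then u' t s else 0)"
        by (rule continuous_on_subset[OF cu']) auto
    qed (use that in \<open>simp_all\<close>)
    then show ?thesis using int0 that by (simp add: restr)
  qed
  have "\<exists>c. \<forall>t\<in>{0..1}. integral U (u t) = c"
    by (rule has_field_derivative_zero_constant) (use D in auto)
  then have "integral U (u 0) = integral U (u 1)" by fastforce
  then show ?thesis unfolding u_def G_def G1_def by simp
qed

section \<open>Linear changes of variables and regular values\<close>

text \<open>Sard's theorem and the change of variables formula are available only for well-ordered index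
  types; \<open>'k idx\<close> is a well-ordered copy of the finite type \<open>'k\<close>.\<close>

typedef ('k::finite) idx = "{..<CARD('k)}"
  by (rule exI[of _ 0]) simp

instance idx :: (finite) finite
proof
  have "finite (Rep_idx ` (UNIV :: 'a idx set))"
    by (rule finite_subset[of _ "{..<CARD('a)}"]) (use Rep_idx in auto)
  then show "finite (UNIV :: 'a idx set)"
    by (rule finite_imageD) (simp add: inj_on_def Rep_idx_inject)
qed

lemma card_idx: "CARD('k::finite idx) = CARD('k)"
  by (simp only: type_definition.card[OF type_definition_idx] card_lessThan)

instantiation idx :: (finite) wellorder
begin

definition less_eq_idx :: "'a idx \<Rightarrow> 'a idx \<Rightarrow> bool" where "less_eq_idx i j \<longleftrightarrow> Rep_idx i \<le> Rep_idx j"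
definition less_idx :: "'a idx \<Rightarrow> 'a idx \<Rightarrow> bool" where "less_idx i j \<longleftrightarrow> Rep_idx i < Rep_idx j"

instance
proof
  fix P :: "'a idx \<Rightarrow> bool" and a
  assume step: "\<And>x. (\<And>y. y < x \<Longrightarrow> P y) \<Longrightarrow> P x"
  show "P a"
  proof (induction "Rep_idx a" arbitrary: a rule: less_induct)
    case less
    show ?case by (rule step, rule less) (simp add: less_idx_def)
  qed
qed (unfold less_eq_idx_def less_idx_def Rep_idx_inject[symmetric], linarith+)

end

section \<open>Bijections between coordinates\<close>

text \<open>Conjugation with \<open>b\<close> is a sign-preserving bijection between the
  permutations of the two index types and matches the two expansions term by term.\<close>

lemma det_reindex:
  fixes A :: "real^'k^'k" and b :: "'j::finite \<Rightarrow> 'k::finite"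
  assumes b: "bij b"
  shows "det (\<chi> i j. A $ b i $ b j) = det A"
proof -
  have permutes_UNIV: "p permutes UNIV \<longleftrightarrow> bij p" for p :: "'c \<Rightarrow> 'c"
    by (auto intro: bij_imp_permutes permutes_bij)
  have ib: "bij (inv b)" by (rule bij_imp_bij_inv[OF b])
  have bi [simp]: "b (inv b x) = x" "inv b (b y) = y" for x y
    using b by (auto simp: bij_def surj_f_inv_f)
  show ?thesis
    unfolding det_def
  proof (rule sum.reindex_bij_witness[of _ "\<lambda>q. inv b \<circ> q \<circ> b" "\<lambda>p. b \<circ> p \<circ> inv b"])
    fix p assume "p \<in> {p. p permutes (UNIV::'j set)}"
    then have p: "p permutes UNIV" by simp
    show "inv b \<circ> (b \<circ> p \<circ> inv b) \<circ> b = p" by auto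
    show "b \<circ> p \<circ> inv b \<in> {p. p permutes UNIV}"
      using p b ib by (auto simp: permutes_UNIV intro!: bij_comp)
    have "map_permutation UNIV b p = b \<circ> p \<circ> inv b"
      using b by (auto simp: map_permutation_def restrict_id_def bij_is_surj)
    then have "sign (b \<circ> p \<circ> inv b) = sign p"
      using sign_map_permutation[of b UNIV p] p b by (simp add: bij_is_inj)
    moreover have "(\<Prod>k\<in>UNIV. A $ k $ (b \<circ> p \<circ> inv b) k) = (\<Prod>i\<in>UNIV. A $ b i $ b (p i))"
      by (rule sym, rule prod.reindex_bij_witness[of _ "inv b" b]) auto
    ultimately show "of_int (sign (b \<circ> p \<circ> inv b)) * (\<Prod>i\<in>UNIV. A $ i $ (b \<circ> p \<circ> inv b) i)
       = of_int (sign p) * (\<Prod>i\<in>UNIV. (\<chi> i j. A $ b i $ b j) $ i $ p i)"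
      by simp
  next
    fix q assume q: "q \<in> {p. p permutes (UNIV::'k set)}"
    show "b \<circ> (inv b \<circ> q \<circ> b) \<circ> inv b = q" by auto
    show "inv b \<circ> q \<circ> b \<in> {p. p permutes UNIV}"
      using q b ib by (auto simp: permutes_UNIV intro!: bij_comp)
  qed
qed

definition perm_vec :: "('j::finite \<Rightarrow> 'k::finite) \<Rightarrow> real^'k \<Rightarrow> real^'j" where
  "perm_vec b x = (\<chi> i. x $ b i)"

lemma perm_vec_nth [simp]: "perm_vec b x $ i = x $ b i"
  by (simp add: perm_vec_def)

lemma bounded_linear_perm_vec: "bounded_linear (perm_vec b)"
  unfolding linear_conv_bounded_linear[symmetric]
  by (rule linearI) (auto simp: vec_eq_iff)

lemma perm_vec_inv [simp]:
  "bij b \<Longrightarrow> perm_vec (inv b) (perm_vec b x) = x" "bij b \<Longrightarrow> perm_vec b (perm_vec (inv b) y) = y"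
  by (auto simp: vec_eq_iff bij_def surj_f_inv_f)

lemma inner_perm_vec: "bij b \<Longrightarrow> perm_vec b x \<bullet> perm_vec b y = x \<bullet> y"
  unfolding inner_vec_def by (simp add: sum.reindex_bij_betw[of b UNIV UNIV "\<lambda>k. x $ k * y $ k"])

lemma norm_perm_vec: "bij b \<Longrightarrow> norm (perm_vec b x) = norm x"
  by (simp add: norm_eq_sqrt_inner inner_perm_vec)

lemma bump_perm_vec: "bij b \<Longrightarrow> bump \<eta> (perm_vec b x) = bump \<eta> x"
  by (simp add: bump_def inner_perm_vec)

lemma image_perm_vec_cbox:
  assumes b: "bij b"
  shows "perm_vec b ` cbox u v = cbox (perm_vec b u) (perm_vec b v)"
proof (intro equalityI subsetI)
  fix y assume "y \<in> perm_vec b ` cbox u v"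
  then show "y \<in> cbox (perm_vec b u) (perm_vec b v)" by (auto simp: mem_box_cart)
next
  fix y assume y: "y \<in> cbox (perm_vec b u) (perm_vec b v)"
  have "perm_vec (inv b) y \<in> cbox u v"
    unfolding mem_box_cart
  proof
    fix k
    have "k = b (inv b k)" using b by (simp add: bij_is_surj surj_f_inv_f)
    then show "u $ k \<le> perm_vec (inv b) y $ k \<and> perm_vec (inv b) y $ k \<le> v $ k"
      using y unfolding mem_box_cart by (metis perm_vec_nth)
  qed
  then show "y \<in> perm_vec b ` cbox u v"
    by (rule image_eqI[rotated]) (simp add: b)
qed

lemma content_perm_vec_cbox:
  assumes b: "bij b"
  shows "measure lborel (perm_vec b ` cbox u v) = measure lborel (cbox u v)"
proof (cases "cbox u v = {}")
  case False
  then have "cbox (perm_vec b u) (perm_vec b v) \<noteq> {}"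
    by (simp add: image_perm_vec_cbox[OF b, symmetric])
  then have "measure lborel (cbox (perm_vec b u) (perm_vec b v)) = (\<Prod>i\<in>UNIV. v $ b i - u $ b i)"
    by (simp add: content_cbox_cart)
  also have "\<dots> = (\<Prod>i\<in>UNIV. v $ i - u $ i)"
    by (rule prod.reindex_bij_betw[OF b])
  also have "\<dots> = measure lborel (cbox u v)"
    using False by (simp add: content_cbox_cart)
  finally show ?thesis by (simp add: image_perm_vec_cbox[OF b])
qed simp

text \<open>A bijection of coordinates maps boxes to boxes of the same volume, so the substitution
  rule for such maps applies with factor 1.\<close>

lemma has_integral_perm_vec_cbox:
  fixes f :: "real^'k \<Rightarrow> real" and b :: "'k::finite \<Rightarrow> 'j::finite"
  assumes b: "bij b" and f: "(f has_integral i) (cbox u v)"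
  shows "((\<lambda>x. f (perm_vec b x)) has_integral i) (cbox (perm_vec (inv b) u) (perm_vec (inv b) v))"
proof -
  have ib: "bij (inv b)" by (rule bij_imp_bij_inv[OF b])
  have "((\<lambda>x. f (perm_vec b x)) has_integral (1 / 1) *\<^sub>R i) (perm_vec (inv b) ` cbox u v)"
  proof (rule has_integral_twiddle[where g = "perm_vec b" and h = "perm_vec (inv b)", OF _ _ _ _ _ _ _ f])
    show "\<exists>w z. perm_vec b ` cbox u v = cbox w z" for u v :: "real^'j"
      by (auto simp: image_perm_vec_cbox[OF b])
    show "\<exists>w z. perm_vec (inv b) ` cbox u v = cbox w z" for u v :: "real^'k"
      by (auto simp: image_perm_vec_cbox[OF ib])
    show "measure lborel (perm_vec b ` cbox u v) = 1 * measure lborel (cbox u v)" for u v :: "real^'j"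
      by (simp add: content_perm_vec_cbox[OF b])
  qed (simp_all add: b linear_continuous_at[OF bounded_linear_perm_vec])
  then show ?thesis by (simp add: image_perm_vec_cbox[OF ib])
qed

lemma integral_perm_vec:
  fixes f :: "real^'k \<Rightarrow> real" and b :: "'k::finite \<Rightarrow> 'j::finite"
  assumes b: "bij b" and f: "continuous_on UNIV f" and bdd: "bounded {x. f x \<noteq> 0}"
  shows "integral UNIV (\<lambda>x. f (perm_vec b x)) = integral UNIV f"
proof -
  obtain B where B: "{x. f x \<noteq> 0} \<subseteq> cbox (- B) B" using bounded_subset_cbox_symmetric[OF bdd] by blast
  have ib: "bij (inv b)" by (rule bij_imp_bij_inv[OF b])
  have "(f has_integral integral (cbox (- B) B) f) (cbox (- B) B)"
    by (intro integrable_integral integrable_continuous continuous_on_subset[OF f]) auto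
  from has_integral_perm_vec_cbox[OF b this]
  have "integral (cbox (perm_vec (inv b) (- B)) (perm_vec (inv b) B)) (\<lambda>x. f (perm_vec b x))
      = integral (cbox (- B) B) f"
    by (rule integral_unique)
  moreover have "integral (cbox (- B) B) f = integral UNIV f"
    by (rule integral_eq_superset) (use B in auto)
  moreover have "integral (cbox (perm_vec (inv b) (- B)) (perm_vec (inv b) B)) (\<lambda>x. f (perm_vec b x))
      = integral UNIV (\<lambda>x. f (perm_vec b x))"
  proof (rule integral_eq_superset)
    fix x assume x: "x \<in> UNIV - cbox (perm_vec (inv b) (- B)) (perm_vec (inv b) B)"
    have "perm_vec b x \<notin> cbox (- B) B"
    proof
      assume "perm_vec b x \<in> cbox (- B) B"
      then have "perm_vec (inv b) (perm_vec b x) \<in> perm_vec (inv b) ` cbox (- B) B" by blast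
      then show False using x by (simp add: image_perm_vec_cbox[OF ib] b)
    qed
    then show "f (perm_vec b x) = 0" using B by blast
  qed simp
  ultimately show ?thesis by simp
qed

lemma matrix_perm_vec_conj:
  assumes b: "bij b"
  shows "perm_vec b (A *v perm_vec (inv b) y) = (\<chi> i j. A $ b i $ b j) *v y"
proof -
  have "(\<Sum>j\<in>UNIV. A $ b i $ j * y $ inv b j) = (\<Sum>j\<in>UNIV. A $ b i $ b j * y $ j)" for i
    using sum.reindex_bij_betw[OF b, of "\<lambda>j. A $ b i $ j * y $ inv b j"] b
    by (simp add: bij_is_inj)
  then show ?thesis by (simp add: vec_eq_iff matrix_vector_mult_def)
qed

section \<open>The bump under an invertible linear map\<close>

lemma matrix_norm_lower_bound:
  fixes A :: "real^'k^'k"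
  assumes "det A \<noteq> 0"
  obtains c where "c > 0" "\<And>x. c * norm x \<le> norm (A *v x)"
proof -
  have "inj ((*v) A)"
    using assms det_nz_iff_inj[of "(*v) A"] by simp
  then obtain B where "B > 0" "\<And>x. B * norm x \<le> norm (A *v x)"
    using linear_inj_bounded_below_pos[of "(*v) A"] by (metis matrix_vector_mul_linear)
  then show ?thesis using that by blast
qed

lemma bounded_bump_linear:
  fixes A :: "real^'k^'k"
  assumes "det A \<noteq> 0" "0 \<le> \<eta>"
  shows "bounded {x. bump \<eta> (A *v x) \<noteq> 0}"
proof -
  obtain c where c: "c > 0" "\<And>x. c * norm x \<le> norm (A *v x)"
    using matrix_norm_lower_bound[OF assms(1)] by blast
  have "norm x \<le> \<eta> / c" if "bump \<eta> (A *v x) \<noteq> 0" for x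
  proof -
    have "norm (A *v x) < \<eta>" using that bump_eq_0[OF assms(2), of "A *v x"] by force
    then show ?thesis using c(1) c(2)[of x] by (simp add: field_simps)
  qed
  then show ?thesis by (auto simp: bounded_iff)
qed

lemma integral_bump_linear_wellorder:
  fixes A :: "real^'k::{finite,wellorder}^'k::_"
  assumes A: "det A \<noteq> 0" and \<eta>: "0 \<le> \<eta>"
  shows "\<bar>det A\<bar> * integral UNIV (\<lambda>x. bump \<eta> (A *v x)) = integral UNIV (bump \<eta> :: real^'k::_ \<Rightarrow> real)"
proof -
  \<comment> \<open>The linear change of variables concerns integrands with values in
    \<open>real^'n\<close>; the bump is therefore read as a map into \<open>real^1\<close>.\<close>
  define f where "f = (\<lambda>x::real^'k::_. bump \<eta> x *\<^sub>R (1::real^1))"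
  have abs: "(\<lambda>x. bump \<eta> (M *v x)) absolutely_integrable_on UNIV" if M: "det M \<noteq> 0" for M :: "real^'k::_^'k::_"
  proof -
    obtain B where B: "{x. bump \<eta> (M *v x) \<noteq> 0} \<subseteq> cbox (- B) B"
      using bounded_subset_cbox_symmetric[OF bounded_bump_linear[OF M \<eta>]] by blast
    have "(\<lambda>x. bump \<eta> (M *v x)) absolutely_integrable_on cbox (- B) B"
      by (intro absolutely_integrable_continuous continuous_on_bump)
         (simp add: linear_continuous_on linear_linear)
    then have "(\<lambda>x. if x \<in> cbox (- B) B then bump \<eta> (M *v x) else 0) absolutely_integrable_on UNIV"
      by (simp add: absolutely_integrable_restrict_UNIV)
    moreover have "(\<lambda>x. if x \<in> cbox (- B) B then bump \<eta> (M *v x) else 0) = (\<lambda>x. bump \<eta> (M *v x))"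
      using subsetD[OF B] by (intro ext) auto
    ultimately show ?thesis by simp
  qed
  have lin: "linear ((*v) A)" by simp
  have surj: "((*v) A) ` UNIV = UNIV"
    using A det_nz_iff_inj[OF lin] linear_injective_imp_surjective[OF lin] by simp
  have "f \<circ> (*v) A absolutely_integrable_on UNIV"
    using absolutely_integrable_linear[OF abs[OF A] bounded_linear_scaleR_left[of "1::real^1"]]
    by (simp add: f_def o_def)
  then have "integral (((*v) A) ` UNIV) f = \<bar>det (matrix ((*v) A))\<bar> *\<^sub>R integral UNIV (f \<circ> (*v) A)"
    by (intro integral_change_of_variables_linear[OF lin]) auto
  then have eq: "integral UNIV f = \<bar>det A\<bar> *\<^sub>R integral UNIV (\<lambda>x. bump \<eta> (A *v x) *\<^sub>R (1::real^1))"
    by (simp add: surj o_def f_def)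
  have i1: "(bump \<eta> :: real^'k::_ \<Rightarrow> real) integrable_on UNIV"
    using abs[of "mat 1"] by (simp add: absolutely_integrable_on_def)
  have i2: "(\<lambda>x. bump \<eta> (A *v x)) integrable_on UNIV"
    using abs[OF A] by (simp add: absolutely_integrable_on_def)
  have sc: "integral UNIV (\<lambda>x. h x *\<^sub>R (1::real^1)) = integral UNIV h *\<^sub>R 1"
    if "h integrable_on UNIV" for h :: "real^'k::_ \<Rightarrow> real"
    by (rule integral_unique, rule has_integral_scaleR_left, rule integrable_integral[OF that])
  show ?thesis
    using eq unfolding f_def sc[OF i1] sc[OF i2] by (simp add: vec_eq_iff)
qed

text \<open>A bijection of coordinates reduces the claim to the well-ordered index type. Multiplying
  the change of variables formula by \<open>sgn (det A)\<close> turns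
  \<open>\<bar>det A\<bar>\<close> into \<open>det A\<close>; this is the origin of the signs in the
  count of zeros.\<close>

lemma integral_bump_linear:
  fixes A :: "real^'k::finite^'k"
  assumes A: "det A \<noteq> 0" and \<eta>: "0 \<le> \<eta>"
  shows "integral UNIV (\<lambda>x. bump \<eta> (A *v x)) * det A = sgn (det A) * bump_mass TYPE('k) \<eta>"
proof -
  obtain b :: "'k idx \<Rightarrow> 'k" where b: "bij b"
    using finite_same_card_bij[of "UNIV :: 'k idx set" "UNIV :: 'k set"] by (auto simp: card_idx)
  have ib: "bij (inv b)" by (rule bij_imp_bij_inv[OF b])
  define A' where "A' = (\<chi> i j. A $ b i $ b j)"
  have detA': "det A' = det A" unfolding A'_def by (rule det_reindex[OF b])
  have "integral UNIV (\<lambda>y. bump \<eta> (A' *v y)) = integral UNIV (\<lambda>y. bump \<eta> (A *v perm_vec (inv b) y))"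
    by (simp add: A'_def matrix_perm_vec_conj[OF b, symmetric] bump_perm_vec b)
  also have "\<dots> = integral UNIV (\<lambda>x. bump \<eta> (A *v x))"
    by (rule integral_perm_vec[OF ib])
       (rule continuous_on_bump, simp add: linear_continuous_on linear_linear,
        rule bounded_bump_linear[OF A \<eta>])
  finally have 1: "integral UNIV (\<lambda>y. bump \<eta> (A' *v y)) = integral UNIV (\<lambda>x. bump \<eta> (A *v x))" .
  have "integral UNIV (\<lambda>y. bump \<eta> (perm_vec (inv b) y)) = bump_mass TYPE('k) \<eta>"
    by (rule integral_perm_vec[OF ib])
      (use bounded_bump_linear[of "mat 1" \<eta>] \<eta> in \<open>auto intro!: continuous_on_bump continuous_on_id\<close>)
  then have 2: "bump_mass TYPE('k idx) \<eta> = bump_mass TYPE('k) \<eta>"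
    by (simp add: bump_perm_vec[OF ib])
  have "\<bar>det A\<bar> * integral UNIV (\<lambda>x. bump \<eta> (A *v x)) = bump_mass TYPE('k) \<eta>"
    using integral_bump_linear_wellorder[of A' \<eta>] A \<eta> by (simp add: detA' 1 2)
  then have "sgn (det A) * (\<bar>det A\<bar> * integral UNIV (\<lambda>x. bump \<eta> (A *v x))) = sgn (det A) * bump_mass TYPE('k) \<eta>"
    by simp
  then show ?thesis by (simp add: mult.assoc[symmetric] sgn_mult_abs) (simp add: mult.commute)
qed

text \<open>Positivity permits cancelling the mass of the bump from the count of zeros.\<close>

lemma integral_bump_pos:
  assumes "0 < \<eta>"
  shows "bump_mass TYPE('k::finite) \<eta> > 0"
proof -
  let ?b = "bump \<eta> :: real^'k \<Rightarrow> real"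
  have "bounded {x. ?b x \<noteq> 0}" using bounded_bump_linear[of "mat 1" \<eta>] assms by simp
  \<comment> \<open>Adjoining \<open>1\<close> and \<open>- 1\<close> forces every component of
    \<open>B\<close> to be at least 1, so that \<open>0\<close> lies in the open box.\<close>
  then have "bounded (insert 1 (insert (- 1) {x. ?b x \<noteq> 0}))" by simp
  then obtain B where B: "insert 1 (insert (- 1) {x. ?b x \<noteq> 0}) \<subseteq> cbox (- B) B"
    using bounded_subset_cbox_symmetric by blast
  have cont: "continuous_on (cbox (- B) B) ?b" by (intro continuous_on_bump continuous_on_id)
  have eq: "integral (cbox (- B) B) ?b = integral UNIV ?b"
    by (rule integral_eq_superset) (use B in auto)
  have nonneg: "0 \<le> ?b x" for x by (simp add: bump_def)
  have int: "?b integrable_on cbox (- B) B" by (rule integrable_continuous[OF cont])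
  have "1 \<in> cbox (- B) B" using B by blast
  then have pos: "1 \<le> B $ i" for i by (simp add: mem_box_cart)
  have "0 \<in> box (- B) B"
    unfolding mem_box_cart using pos by (simp add: less_le_trans[OF zero_less_one])
  moreover have "?b 0 \<noteq> 0" using assms by (simp add: bump_def)
  moreover have False if z: "integral (cbox (- B) B) ?b = 0" "0 \<in> box (- B) B" "?b 0 \<noteq> 0"
  proof -
    have "(?b has_integral 0) (cbox (- B) B)" using integrable_integral[OF int] z(1) by simp
    from has_integral_0_cbox_imp_0[OF cont nonneg this] z(2,3) box_subset_cbox[of "- B" B]
    show False by blast
  qed
  ultimately have "integral (cbox (- B) B) ?b \<noteq> 0" by blast
  moreover have "0 \<le> integral (cbox (- B) B) ?b"
    by (rule Henstock_Kurzweil_Integration.integral_nonneg[OF int nonneg])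
  ultimately show ?thesis by (simp add: eq)
qed

section \<open>Regular values, symmetry of second derivatives, smoothness\<close>

text \<open>Sard's theorem, transported along a bijection of coordinates: the critical values form a
  negligible set, which cannot contain a ball around 0.\<close>

lemma exists_small_regular_shift:
  fixes f :: "('k::finite) vfield"
  assumes f: "\<And>x. (f has_derivative f' x) (at x)" and e: "e > 0"
  obtains c where "norm c < e" "\<And>x. f x = c \<Longrightarrow> det (matrix (f' x)) \<noteq> 0"
proof -
  obtain b :: "'k idx \<Rightarrow> 'k" where b: "bij b"
    using finite_same_card_bij[of "UNIV :: 'k idx set" "UNIV :: 'k set"] by (auto simp: card_idx)
  have ib: "bij (inv b)" by (rule bij_imp_bij_inv[OF b])
  define F where "F = (\<lambda>y. perm_vec b (f (perm_vec (inv b) y)))"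
  define F' where "F' = (\<lambda>y v. perm_vec b (f' (perm_vec (inv b) y) (perm_vec (inv b) v)))"
  define S where "S = {y. det (matrix (F' y)) = 0}"
  have F: "(F has_derivative F' y) (at y)" for y
    unfolding F_def F'_def
    by (rule bounded_linear.has_derivative[OF bounded_linear_perm_vec],
        rule has_derivative_compose[OF bounded_linear_imp_has_derivative[OF bounded_linear_perm_vec] f])
  have detF: "det (matrix (F' y)) = det (matrix (f' (perm_vec (inv b) y)))" for y
  proof -
    have "linear (f' (perm_vec (inv b) y))"
      using f has_derivative_linear by blast
    then have "F' y = (*v) (\<chi> i j. matrix (f' (perm_vec (inv b) y)) $ b i $ b j)"
      unfolding F'_def by (auto simp: matrix_perm_vec_conj[OF b, symmetric] matrix_works)
    then show ?thesis by (simp add: det_reindex[OF b])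
  qed
  have "negligible (F ` S)"
  proof (rule baby_Sard)
    show "rank (matrix (F' x)) < CARD('k idx)" if "x \<in> S" for x
      using that by (simp add: S_def det_eq_0_rank)
    show "(F has_derivative F' x) (at x within S)" for x
      by (rule has_derivative_at_withinI[OF F])
  qed simp
  moreover have "\<not> negligible (ball (0 :: real^'k idx) e)"
    using e by (intro open_not_negligible) auto
  ultimately obtain c where c: "c \<in> ball 0 e" "c \<notin> F ` S"
    using negligible_subset by blast
  show ?thesis
  proof (rule that)
    show "norm (perm_vec (inv b) c) < e" using c by (simp add: norm_perm_vec[OF ib])
    fix x assume "f x = perm_vec (inv b) c"
    then have "F (perm_vec b x) = c" by (simp add: F_def b)
    then have "perm_vec b x \<notin> S" using c by blast
    then show "det (matrix (f' x)) \<noteq> 0" by (simp add: S_def detF b)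
  qed
qed

text \<open>Schwarz's theorem by the second difference of \<open>f\<close> over the square of side
  \<open>h\<close>: applying the mean value theorem twice, in either order of the variables,
  expresses it as \<open>h * h\<close> times each of the mixed derivatives at some point of the
  square.\<close>

lemma mixed_partial_derivatives_eq:
  fixes f :: "real \<Rightarrow> real \<Rightarrow> real"
  assumes "\<And>s t. ((\<lambda>s. f s t) has_field_derivative ps s t) (at s)"
    and "\<And>s t. ((\<lambda>t. ps s t) has_field_derivative pt s t) (at t)"
    and "\<And>s t. ((\<lambda>t. f s t) has_field_derivative qt s t) (at t)"
    and "\<And>s t. ((\<lambda>s. qt s t) has_field_derivative qs s t) (at s)"
    and c1: "continuous_on UNIV (\<lambda>(s, t). pt s t)"
    and c2: "continuous_on UNIV (\<lambda>(s, t). qs s t)"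
  shows "pt 0 0 = qs 0 0"
proof (rule ccontr)
  assume ne: "pt 0 0 \<noteq> qs 0 0"
  define e where "e = \<bar>pt 0 0 - qs 0 0\<bar> / 2"
  have e: "e > 0" using ne by (simp add: e_def)
  obtain d1 where d1: "d1 > 0" "\<And>x. dist x (0, 0) < d1 \<Longrightarrow> dist (pt (fst x) (snd x)) (pt 0 0) < e"
    using c1 e unfolding continuous_on_iff by (fastforce simp: split_beta)
  obtain d2 where d2: "d2 > 0" "\<And>x. dist x (0, 0) < d2 \<Longrightarrow> dist (qs (fst x) (snd x)) (qs 0 0) < e"
    using c2 e unfolding continuous_on_iff by (fastforce simp: split_beta)
  \<comment> \<open>Points of the open square of side \<open>h\<close> have distance less than
    \<open>2 * h\<close> from the corner, hence the half.\<close>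
  define h where "h = min d1 d2 / 2"
  have h: "h > 0" "2 * h \<le> d1" "2 * h \<le> d2" using d1 d2 by (auto simp: h_def)
  have near: "dist (s, t) (0, 0 :: real) < 2 * h" if "0 < s" "s < h" "0 < t" "t < h" for s t
  proof -
    have "dist (s, t) (0, 0) \<le> \<bar>s\<bar> + \<bar>t\<bar>"
      using sqrt_sum_squares_le_sum_abs[of s t] by (simp add: dist_Pair_Pair)
    then show ?thesis using that by simp
  qed
  obtain a where a: "0 < a" "a < h"
    "(f h h - f h 0) - (f 0 h - f 0 0) = (h - 0) * (ps a h - ps a 0)"
    using MVT2[OF h(1), of "\<lambda>s. f s h - f s 0" "\<lambda>s. ps s h - ps s 0",
        OF DERIV_diff[OF assms(1) assms(1)]] by blast
  obtain b where b: "0 < b" "b < h" "ps a h - ps a 0 = (h - 0) * pt a b"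
    using MVT2[OF h(1), of "ps a" "pt a", OF assms(2)] by blast
  obtain b' where b': "0 < b'" "b' < h"
    "(f h h - f 0 h) - (f h 0 - f 0 0) = (h - 0) * (qt h b' - qt 0 b')"
    using MVT2[OF h(1), of "\<lambda>t. f h t - f 0 t" "\<lambda>t. qt h t - qt 0 t",
        OF DERIV_diff[OF assms(3) assms(3)]] by blast
  obtain a' where a': "0 < a'" "a' < h" "qt h b' - qt 0 b' = (h - 0) * qs a' b'"
    using MVT2[OF h(1), of "\<lambda>s. qt s b'" "\<lambda>s. qs s b'", OF assms(4)] by blast
  have "h * (h * pt a b) = h * (h * qs a' b')"
    using a(3)[unfolded b(3)] b'(3)[unfolded a'(3)] unfolding diff_0_right by linarith
  then have "pt a b = qs a' b'" using h by simp
  moreover have "dist (pt a b) (pt 0 0) < e" using d1(2)[of "(a, b)"] near[of a b] a b h by simp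
  moreover have "dist (qs a' b') (qs 0 0) < e" using d2(2)[of "(a', b')"] near[of a' b'] a' b' h by simp
  ultimately show False by (simp add: e_def dist_real_def abs_if split: if_splits)
qed

text \<open>Symmetry follows component by component from
  \<open>mixed_partial_derivatives_eq\<close>, applied to the plane through \<open>x\<close> in the
  directions of the two axes.\<close>

lemma C2I:
  fixes f :: "('k::finite) vfield"
  assumes f: "\<And>x. has_partials f f1 x"
    and f1: "\<And>j x. has_partials (f1 j) (f2 j) x"
    and f2: "\<And>j p. continuous_on UNIV (f2 j p)"
  shows "C2 f f1 f2"
proof -
  have "f2 j p x $ i = f2 p j x $ i" for j p x i
  proof -
    let ?x = "\<lambda>s t. x + s *\<^sub>R axis j 1 + t *\<^sub>R axis p (1::real)"
    have c: "continuous_on UNIV (\<lambda>(s, t). f2 a b (?x s t) $ i)" for a b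
      unfolding split_beta by (intro continuous_intros continuous_on_compose2[OF f2]) auto
    have "f2 j p (?x 0 0) $ i = f2 p j (?x 0 0) $ i"
    proof (rule mixed_partial_derivatives_eq[where f = "\<lambda>s t. f (?x s t) $ i"
          and ps = "\<lambda>s t. f1 j (?x s t) $ i" and qt = "\<lambda>s t. f1 p (?x s t) $ i"
          and pt = "\<lambda>s t. f2 j p (?x s t) $ i" and qs = "\<lambda>s t. f2 p j (?x s t) $ i"])
      fix s t
      show "((\<lambda>s. f (?x s t) $ i) has_field_derivative f1 j (?x s t) $ i) (at s)"
        using has_field_derivative_cart_nth[OF has_vector_derivative_along_axis_at[OF f, where x = "x + t *\<^sub>R axis p 1"]]
        by (simp add: algebra_simps)
      show "((\<lambda>s. f1 p (?x s t) $ i) has_field_derivative f2 p j (?x s t) $ i) (at s)"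
        using has_field_derivative_cart_nth[OF has_vector_derivative_along_axis_at[OF f1, where x = "x + t *\<^sub>R axis p 1"]]
        by (simp add: algebra_simps)
      show "((\<lambda>t. f (?x s t) $ i) has_field_derivative f1 p (?x s t) $ i) (at t)"
        by (rule has_field_derivative_cart_nth[OF has_vector_derivative_along_axis_at[OF f]])
      show "((\<lambda>t. f1 j (?x s t) $ i) has_field_derivative f2 j p (?x s t) $ i) (at t)"
        by (rule has_field_derivative_cart_nth[OF has_vector_derivative_along_axis_at[OF f1]])
    qed (rule c)+
    then show ?thesis by simp
  qed
  then have "f2 j p x = f2 p j x" for j p x by (simp add: vec_eq_iff)
  with f f1 f2 show ?thesis unfolding C2_def by blast
qed

lemma linear_axis_expansion:
  fixes L :: "real^'k::finite \<Rightarrow> 'b::real_normed_vector"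
  assumes "linear L"
  shows "L v = (\<Sum>j\<in>UNIV. v $ j *\<^sub>R L (axis j 1))"
proof -
  have "L v = L (\<Sum>j\<in>UNIV. v $ j *\<^sub>R axis j 1)"
    using basis_expansion[of v] by (simp add: scalar_mult_eq_scaleR)
  then show ?thesis by (simp add: linear_sum[OF assms] linear_cmul[OF assms])
qed

lemma smooth_imp_C2:
  fixes f :: "('k::finite) vfield"
  assumes "smooth f"
  obtains f1 f2 where "C2 f f1 f2" "\<And>x. jac f1 x = jacobian f (at x)"
proof -
  have "Ck (Suc (Suc 0)) f" using assms by (simp add: smooth_def)
  then have d: "\<And>x. f differentiable (at x)"
    and d1: "\<And>v x. (\<lambda>x. frechet_derivative f (at x) v) differentiable (at x)"
    and c2: "\<And>v w. continuous_on UNIV (\<lambda>x. frechet_derivative (\<lambda>x. frechet_derivative f (at x) v) (at x) w)"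
    by auto
  have exp: "(h has_derivative (\<lambda>v. \<Sum>j\<in>UNIV. v $ j *\<^sub>R frechet_derivative h (at x) (axis j 1))) (at x)"
    if "h differentiable (at x)" for h :: "'k vfield" and x
  proof -
    have "(h has_derivative frechet_derivative h (at x)) (at x)"
      using that frechet_derivative_works by blast
    then show ?thesis
      by (rule has_derivative_eq_rhs) (rule ext, rule linear_axis_expansion[OF linear_frechet_derivative[OF that]])
  qed
  define f1 where "f1 = (\<lambda>j x. frechet_derivative f (at x) (axis j 1))"
  define f2 where "f2 = (\<lambda>j p x. frechet_derivative (f1 j) (at x) (axis p 1))"
  have "C2 f f1 f2"
  proof (rule C2I)
    show "has_partials f f1 x" for x
      unfolding f1_def by (rule exp[OF d])
    show "has_partials (f1 j) (f2 j) x" for j x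
      unfolding f2_def by (rule exp) (simp add: f1_def d1)
    show "continuous_on UNIV (f2 j p)" for j p
      unfolding f2_def f1_def by (rule c2)
  qed
  moreover have "jac f1 x = jacobian f (at x)" for x
    by (simp add: jac_def f1_def jacobian_def matrix_def)
  ultimately show ?thesis using that by blast
qed

text \<open>Recording that every directional derivative is again polynomial makes the statement
  repeatable, so that \<open>polynomial_function_smooth\<close> can climb through all
  \<open>Ck\<close>.\<close>

lemma real_polynomial_function_has_derivative:
  fixes f :: "'a::euclidean_space \<Rightarrow> real"
  assumes "real_polynomial_function f"
  shows "\<exists>F. (\<forall>x. (f has_derivative F x) (at x)) \<and> (\<forall>v. real_polynomial_function (\<lambda>x. F x v))"
  using assms
proof (induction rule: real_polynomial_function.induct)
  case (linear f)
  then show ?case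
    by (intro exI[of _ "\<lambda>x. f"]) (auto intro: bounded_linear_imp_has_derivative real_polynomial_function.intros)
next
  case (const c)
  then show ?case
    by (intro exI[of _ "\<lambda>x v. 0"]) (auto intro: real_polynomial_function.intros)
next
  case (add f g)
  then obtain F G where "\<And>x. (f has_derivative F x) (at x)" "\<And>v. real_polynomial_function (\<lambda>x. F x v)"
    "\<And>x. (g has_derivative G x) (at x)" "\<And>v. real_polynomial_function (\<lambda>x. G x v)" by blast
  then show ?case
    by (intro exI[of _ "\<lambda>x v. F x v + G x v"]) (auto intro: has_derivative_add real_polynomial_function.intros)
next
  case (mult f g)
  then obtain F G where "\<And>x. (f has_derivative F x) (at x)" "\<And>v. real_polynomial_function (\<lambda>x. F x v)"
    "\<And>x. (g has_derivative G x) (at x)" "\<And>v. real_polynomial_function (\<lambda>x. G x v)" by blast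
  then show ?case using mult.hyps
    by (intro exI[of _ "\<lambda>x v. f x * G x v + F x v * g x"] conjI allI has_derivative_mult
          real_polynomial_function.intros(3,4))
qed

lemma polynomial_function_has_derivative:
  fixes f :: "'a::euclidean_space \<Rightarrow> 'b::euclidean_space"
  assumes "polynomial_function f"
  obtains F where "\<And>x. (f has_derivative F x) (at x)" "\<And>v. polynomial_function (\<lambda>x. F x v)"
proof -
  have "\<forall>b\<in>Basis. \<exists>F. (\<forall>x. ((\<lambda>x. f x \<bullet> b) has_derivative F x) (at x)) \<and> (\<forall>v. real_polynomial_function (\<lambda>x. F x v))"
    using assms real_polynomial_function_has_derivative unfolding polynomial_function_iff_Basis_inner by blast
  then obtain F where F: "\<And>b x. b \<in> Basis \<Longrightarrow> ((\<lambda>x. f x \<bullet> b) has_derivative F b x) (at x)"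
    "\<And>b v. b \<in> Basis \<Longrightarrow> real_polynomial_function (\<lambda>x. F b x v)" by metis
  have "(f has_derivative (\<lambda>v. \<Sum>b\<in>Basis. F b x v *\<^sub>R b)) (at x)" for x
  proof -
    have "((\<lambda>x. \<Sum>b\<in>Basis. (f x \<bullet> b) *\<^sub>R b) has_derivative (\<lambda>v. \<Sum>b\<in>Basis. F b x v *\<^sub>R b)) (at x)"
      by (intro has_derivative_sum has_derivative_scaleR_left F)
    then show ?thesis by (simp add: euclidean_representation)
  qed
  moreover have "polynomial_function (\<lambda>x. \<Sum>b\<in>Basis. F b x v *\<^sub>R b)" for v
    unfolding polynomial_function_iff_Basis_inner
    using F(2) by (auto simp: inner_sum_left inner_Basis if_distrib cong: if_cong)
  ultimately show ?thesis using that[of "\<lambda>x v. \<Sum>b\<in>Basis. F b x v *\<^sub>R b"] by blast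
qed

lemma polynomial_function_smooth:
  fixes f :: "'a::euclidean_space \<Rightarrow> 'b::euclidean_space"
  assumes "polynomial_function f"
  shows "smooth f"
proof -
  have "Ck k f" for k using assms
  proof (induction k arbitrary: f)
    case 0
    then show ?case by (simp add: continuous_on_polymonial_function)
  next
    case (Suc k)
    obtain F where F: "\<And>x. (f has_derivative F x) (at x)" "\<And>v. polynomial_function (\<lambda>x. F x v)"
      using polynomial_function_has_derivative[OF Suc.prems] by blast
    have "frechet_derivative f (at x) = F x" for x
      using frechet_derivative_at[OF F(1)] by simp
    then show ?case using F Suc.IH by (auto simp: differentiable_def)
  qed
  then show ?thesis by (simp add: smooth_def)
qed

section \<open>The degree integral as a signed count of zeros\<close>

lemma C2_matrix: "C2 (\<lambda>s. A *v (s - z)) (\<lambda>j s. column j A) (\<lambda>j p s. 0)"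
proof (rule C2I)
  fix x
  have "((\<lambda>s. A *v (s - z)) has_derivative (\<lambda>v. A *v (v - 0))) (at x)"
    by (rule bounded_linear.has_derivative[OF matrix_vector_mul_bounded_linear])
       (auto intro!: derivative_eq_intros)
  moreover have "A *v v = (\<Sum>j\<in>UNIV. v $ j *\<^sub>R column j A)" for v
    by (simp add: matrix_mult_sum scalar_mult_eq_scaleR)
  ultimately show "((\<lambda>s. A *v (s - z)) has_derivative (\<lambda>v. \<Sum>j\<in>UNIV. v $ j *\<^sub>R column j A)) (at x)"
    by simp
qed auto

lemma jac_column: "jac (\<lambda>j s. column j A) x = A"
  by (simp add: vec_eq_iff column_def)

text \<open>The formula is required for all sufficiently small \<open>\<eta>\<close>: with filters
  at 0 the finitely many smallness conditions on \<open>\<eta>\<close>, and later on the radius,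
  combine without explicit minima.\<close>

abbreviation local_bump_formula ::
  "('k::finite) vfield \<Rightarrow> ('k \<Rightarrow> 'k vfield) \<Rightarrow> real^'k \<Rightarrow> real \<Rightarrow> bool" where
  "local_bump_formula g g1 z r \<equiv> \<forall>\<^sub>F \<eta> in at_right 0. bump_integral \<eta> g g1 (ball z r)
     = sgn (det (jac g1 z)) * bump_mass TYPE('k) \<eta>"

text \<open>The linear homotopy from \<open>g\<close> to its linearisation at \<open>z\<close> has
  no zeros on a small sphere: the linear part is at least \<open>c * norm (s - z)\<close> and the
  remainder at most half of that. So the bump integral over the ball is that of an invertible linear
  map.\<close>

lemma bump_integral_near_regular_zero:
  fixes g :: "('k::finite) vfield"
  assumes g: "C2 g g1 g2" and z: "g z = 0" and reg: "det (jac g1 z) \<noteq> 0"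
  shows "\<forall>\<^sub>F r in at_right 0. (\<forall>s\<in>cball z r - {z}. g s \<noteq> 0) \<and> local_bump_formula g g1 z r"
proof -
  define A where "A = jac g1 z"
  obtain c where c: "c > 0" "\<And>x. c * norm x \<le> norm (A *v x)"
    using matrix_norm_lower_bound[of A] reg unfolding A_def by blast
  have eq: "(\<Sum>j\<in>UNIV. v $ j *\<^sub>R g1 j z) = A *v v" for v
    by (simp add: A_def vec_eq_iff matrix_vector_mult_def mult.commute)
  have "(g has_derivative (\<lambda>v. \<Sum>j\<in>UNIV. v $ j *\<^sub>R g1 j z)) (at z)"
    using g unfolding C2_def by blast
  then have "(g has_derivative (\<lambda>v. A *v v)) (at z)"
    unfolding eq .
  then obtain d where d: "d > 0"
    "\<And>s. norm (s - z) < d \<Longrightarrow> norm (g s - A *v (s - z)) \<le> c / 2 * norm (s - z)"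
    using c(1) z unfolding has_derivative_at_alt by (metis diff_zero half_gt_zero_iff)
  have lower: "c / 2 * norm (s - z) \<le> norm (g s + t *\<^sub>R (A *v (s - z) - g s))"
    if "norm (s - z) < d" "0 \<le> t" "t \<le> 1" for s t
  proof -
    have "g s + t *\<^sub>R (A *v (s - z) - g s) = A *v (s - z) + (1 - t) *\<^sub>R (g s - A *v (s - z))"
      by (simp add: algebra_simps)
    moreover have "norm ((1 - t) *\<^sub>R (g s - A *v (s - z))) \<le> c / 2 * norm (s - z)"
    proof -
      have "norm ((1 - t) *\<^sub>R (g s - A *v (s - z))) \<le> 1 * norm (g s - A *v (s - z))"
        unfolding norm_scaleR using that by (intro mult_right_mono) auto
      then show ?thesis using d(2)[OF that(1)] by simp
    qed
    ultimately show ?thesis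
      using c(2)[of "s - z"] norm_diff_ineq[of "A *v (s - z)" "(1 - t) *\<^sub>R (g s - A *v (s - z))"]
      by simp
  qed
  have "\<forall>\<^sub>F r in at_right 0. 0 < r \<and> r < d"
    using d(1) by (auto simp: eventually_at_right_field)
  then show ?thesis
  proof (rule eventually_mono, elim conjE, intro conjI ballI)
    fix r :: real and s :: "real^'k" assume r: "0 < r" "r < d"
    assume "s \<in> cball z r - {z}"
    then have "norm (s - z) < d" "0 < norm (s - z)" using r by (auto simp: dist_norm norm_minus_commute)
    then have "0 < c / 2 * norm (s - z)" "c / 2 * norm (s - z) \<le> norm (g s)"
      using lower[of s 0] c(1) by simp_all
    then show "g s \<noteq> 0" by auto
  next
    fix r :: real assume r: "0 < r" "r < d"
    have "\<forall>\<^sub>F \<eta> in at_right 0. 0 < \<eta> \<and> \<eta> < c / 2 * r"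
      unfolding eventually_at_right_field using c(1) r by (intro exI[of _ "c / 2 * r"]) simp
    then show "local_bump_formula g g1 z r"
    proof (rule eventually_mono, elim conjE)
      fix \<eta> assume \<eta>: "0 < \<eta>" "\<eta> < c / 2 * r"
      have "bump_integral \<eta> g g1 (ball z r)
         = integral (ball z r) (\<lambda>s. bump \<eta> (A *v (s - z)) * det (jac (\<lambda>j s. column j A) s))"
      proof (rule bump_integral_homotopy[OF open_ball bounded_ball _ g C2_matrix])
        fix t s assume t: "0 \<le> t" "t \<le> (1::real)" and "s \<in> frontier (ball z r)"
        then have "norm (s - z) = r" using r by (simp add: frontier_ball dist_norm norm_minus_commute)
        then show "\<eta> < norm (g s + t *\<^sub>R (A *v (s - z) - g s))"
          using lower[of s t] t r \<eta> by simp
      qed (use \<eta> in simp)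
      also have "\<dots> = integral UNIV (\<lambda>s. bump \<eta> (A *v (s - z)) * det A)"
        unfolding jac_column
      proof (rule integral_eq_superset)
        fix s assume "s \<in> UNIV - ball z r"
        then have "r \<le> norm (s - z)" by (simp add: dist_norm norm_minus_commute)
        then have "c * r \<le> norm (A *v (s - z))"
          using c(2)[of "s - z"] c(1) by (meson less_imp_le mult_left_mono order_trans)
        moreover have "c / 2 * r \<le> c * r" using c(1) r by simp
        ultimately have "\<eta> \<le> norm (A *v (s - z))" using \<eta> by linarith
        with \<eta> have "bump \<eta> (A *v (s - z)) = 0" by (intro bump_eq_0) auto
        then show "bump \<eta> (A *v (s - z)) * det A = 0" by (simp only: mult_zero_left)
      qed simp
      also have "\<dots> = integral UNIV (\<lambda>s. bump \<eta> (A *v (s - z))) * det A"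
        by simp
      also have "integral UNIV (\<lambda>s. bump \<eta> (A *v (s - z))) = integral UNIV (\<lambda>s. bump \<eta> (A *v s))"
        by (rule integral_UNIV_shift[of "\<lambda>s. bump \<eta> (A *v s)"])
           (rule bounded_bump_linear, use reg \<eta> in \<open>auto simp: A_def\<close>)
      also have "\<dots> * det A = sgn (det A) * bump_mass TYPE('k) \<eta>"
        by (rule integral_bump_linear) (use reg \<eta> in \<open>auto simp: A_def\<close>)
      finally show "bump_integral \<eta> g g1 (ball z r)
        = sgn (det (jac g1 z)) * bump_mass TYPE('k) \<eta>" by (simp add: A_def)
    qed
  qed
qed

text \<open>Regular zeros are isolated, and with none on the frontier they form a compact set, so
  there are finitely many. Off small disjoint balls around them \<open>norm (g s)\<close> has a
  lower bound \<open>m > 0\<close>, and for \<open>\<eta> < m\<close> the integral lives on these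
  balls.\<close>

lemma bump_integral_regular_zeros:
  fixes g :: "('k::finite) vfield"
  assumes U: "open U" "bounded U" and g: "C2 g g1 g2"
    and fr: "\<And>s. s \<in> frontier U \<Longrightarrow> g s \<noteq> 0"
    and reg: "\<And>s. s \<in> U \<Longrightarrow> g s = 0 \<Longrightarrow> det (jac g1 s) \<noteq> 0"
  shows "\<forall>\<^sub>F \<eta> in at_right 0. bump_integral \<eta> g g1 U
     = (\<Sum>s | s \<in> U \<and> g s = 0. sgn (det (jac g1 s))) * bump_mass TYPE('k) \<eta>"
proof -
  define Z where "Z = {s \<in> U. g s = 0}"
  note contg = C2_continuous[OF g]
  have near: "\<forall>\<^sub>F r in at_right 0. (\<forall>s\<in>cball z r - {z}. g s \<noteq> 0) \<and> local_bump_formula g g1 z r" if "z \<in> Z" for z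
    by (rule bump_integral_near_regular_zero[OF g]) (use that reg in \<open>auto simp: Z_def\<close>)
  have Z_eq: "Z = closure U \<inter> {s. g s = 0}"
    using fr U(1) closure_subset[of U] by (auto simp: Z_def frontier_def interior_open)
  have "closed {s. g s = 0}" by (intro closed_Collect_eq contg continuous_on_const)
  then have compZ: "compact Z"
    unfolding Z_eq using U(2) by (intro compact_Int_closed) auto
  have "finite (Z \<inter> Z)"
  proof (rule finite_not_islimpt_in_compact[OF compZ])
    fix z assume "z \<in> Z"
    from eventually_happens[OF eventually_conj[OF near[OF this] eventually_at_right_less]]
    obtain r where r: "r > 0" "\<forall>s\<in>cball z r - {z}. g s \<noteq> 0" by auto
    show "\<not> z islimpt Z"
    proof
      assume "z islimpt Z"
      then obtain s where "s \<in> Z" "s \<noteq> z" "dist s z < r"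
        using r(1) unfolding islimpt_approachable by blast
      then show False using r(2) by (auto simp: Z_def dist_commute)
    qed
  qed
  then have finZ: "finite Z" by simp
  have ev_sub: "\<forall>\<^sub>F r in at_right 0. cball z r \<subseteq> U" if z: "z \<in> Z" for z
  proof -
    obtain e where "e > 0" "cball z e \<subseteq> U"
      using z U(1) by (auto simp: Z_def open_contains_cball)
    then show ?thesis unfolding eventually_at_right_field
      by (intro exI[of _ e]) (auto dest!: subsetD)
  qed
  have ev_sep: "\<forall>\<^sub>F r in at_right 0. \<forall>z'\<in>Z - {z}. 2 * r < dist z z'" for z
  proof (rule eventually_ball_finite)
    show "\<forall>z'\<in>Z - {z}. \<forall>\<^sub>F r in at_right 0. 2 * r < dist z z'"
    proof
      fix z' assume "z' \<in> Z - {z}"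
      then have "0 < dist z z' / 2" by auto
      then show "\<forall>\<^sub>F r in at_right 0. 2 * r < dist z z'"
        unfolding eventually_at_right_field by (intro exI[of _ "dist z z' / 2"]) auto
    qed
  qed (use finZ in auto)
  have ev_int: "\<forall>\<^sub>F r in at_right 0. local_bump_formula g g1 z r" if "z \<in> Z" for z
    using near[OF that] by (rule eventually_mono) (rule conjunct2)
  have "\<forall>z\<in>Z. \<forall>\<^sub>F r in at_right 0. cball z r \<subseteq> U \<and> (\<forall>z'\<in>Z - {z}. 2 * r < dist z z') \<and> local_bump_formula g g1 z r"
    by (intro ballI eventually_conj[OF ev_sub eventually_conj[OF ev_sep ev_int]])
  from eventually_conj[OF eventually_at_right_less eventually_ball_finite[OF finZ this]]
  have "\<forall>\<^sub>F r in at_right 0. 0 < r \<and> (\<forall>z\<in>Z. cball z r \<subseteq> U \<and> (\<forall>z'\<in>Z - {z}. 2 * r < dist z z') \<and> local_bump_formula g g1 z r)" .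
  from eventually_happens[OF this] obtain r where r: "0 < r"
    and sub: "\<And>z. z \<in> Z \<Longrightarrow> cball z r \<subseteq> U"
    and sep: "\<And>z z'. z \<in> Z \<Longrightarrow> z' \<in> Z \<Longrightarrow> z' \<noteq> z \<Longrightarrow> 2 * r < dist z z'"
    and int: "\<forall>z\<in>Z. local_bump_formula g g1 z r" by auto
  define K where "K = closure U - (\<Union>z\<in>Z. ball z r)"
  have "compact K" unfolding K_def using U(2) by (intro compact_diff open_UN) auto
  have gK: "g s \<noteq> 0" if "s \<in> K" for s
  proof
    assume "g s = 0"
    then have "s \<in> Z" using that by (auto simp: K_def Z_eq)
    then show False using that r by (auto simp: K_def)
  qed
  have "\<exists>m>0. \<forall>s\<in>K. m \<le> norm (g s)"
  proof (cases "K = {}")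
    case False
    from continuous_attains_inf[OF \<open>compact K\<close> this continuous_on_norm[OF contg(1)]]
    obtain s0 where "s0 \<in> K" "\<And>s. s \<in> K \<Longrightarrow> norm (g s0) \<le> norm (g s)" by blast
    then show ?thesis using gK[of s0] by (intro exI[of _ "norm (g s0)"]) auto
  qed (auto intro: exI[of _ 1])
  then obtain m where m: "m > 0" "\<And>s. s \<in> K \<Longrightarrow> m \<le> norm (g s)" by blast
  have ev_m: "\<forall>\<^sub>F \<eta> in at_right 0. \<eta> < m \<and> 0 < \<eta>"
    unfolding eventually_at_right_field using m(1) by (intro exI[of _ m]) simp
  have "\<forall>\<^sub>F \<eta> in at_right 0. (\<eta> < m \<and> 0 < \<eta>) \<and>
     (\<forall>z\<in>Z. bump_integral \<eta> g g1 (ball z r)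
        = sgn (det (jac g1 z)) * bump_mass TYPE('k) \<eta>)"
    by (rule eventually_conj[OF ev_m eventually_ball_finite[OF finZ int]])
  then show ?thesis
  proof (rule eventually_mono, elim conjE)
    fix \<eta> assume \<eta>: "\<eta> < m" "0 < \<eta>" and
      I: "\<forall>z\<in>Z. bump_integral \<eta> g g1 (ball z r)
        = sgn (det (jac g1 z)) * bump_mass TYPE('k) \<eta>"
    let ?F = "\<lambda>s. bump \<eta> (g s) * det (jac g1 s)"
    have cF: "continuous_on S ?F" for S by (intro continuous_intros contg)
    have "integral (\<Union>z\<in>Z. ball z r) ?F = integral U ?F"
    proof (rule integral_eq_superset)
      show "(\<Union>z\<in>Z. ball z r) \<subseteq> U" using sub ball_subset_cball by blast
      fix s assume "s \<in> U - (\<Union>z\<in>Z. ball z r)"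
      then have "s \<in> K" using closure_subset by (auto simp: K_def)
      then show "?F s = 0" using m(2)[of s] \<eta> by (simp add: bump_eq_0)
    qed
    moreover have "(?F has_integral (\<Sum>z\<in>Z. integral (ball z r) ?F)) (\<Union>z\<in>Z. ball z r)"
    proof (rule has_integral_UN[OF finZ])
      fix z assume "z \<in> Z"
      obtain B where B: "ball z r \<subseteq> cbox (- B) B" using bounded_subset_cbox_symmetric[OF bounded_ball] by blast
      have "?F absolutely_integrable_on ball z r"
        by (rule set_integrable_subset[OF absolutely_integrable_continuous[OF cF] _ B]) simp
      then show "(?F has_integral integral (ball z r) ?F) (ball z r)"
        by (simp add: absolutely_integrable_on_def integrable_integral)
    next
      show "pairwise (\<lambda>i i'. negligible (ball i r \<inter> ball i' r)) Z"
      proof (rule pairwiseI)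
        fix z z' assume "z \<in> Z" "z' \<in> Z" "z \<noteq> z'"
        then have "2 * r < dist z z'" using sep by auto
        then have "ball z r \<inter> ball z' r = {}"
          by (intro disjoint_ballI) simp
        then show "negligible (ball z r \<inter> ball z' r)" by simp
      qed
    qed
    ultimately have "integral U ?F = (\<Sum>z\<in>Z. integral (ball z r) ?F)"
      by (simp add: integral_unique)
    then show "integral U ?F = (\<Sum>s | s \<in> U \<and> g s = 0. sgn (det (jac g1 s))) * bump_mass TYPE('k) \<eta>"
      using I by (simp add: Z_def sum_distrib_right)
  qed
qed

section \<open>Vanishing of the Brouwer degree\<close>

text \<open>Half of the tolerance goes to a Weierstrass approximation, the other half to subtracting
  a small regular value from it.\<close>

lemma exists_smooth_regular_approximation:
  fixes f :: "('k::finite) vfield"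
  assumes "compact K" "continuous_on K f" "0 < e"
  obtains p where "smooth p" "\<And>s. s \<in> K \<Longrightarrow> norm (p s - f s) < e" "regular_value_on p UNIV 0"
proof -
  obtain q where q: "polynomial_function q" "\<And>s. s \<in> K \<Longrightarrow> norm (f s - q s) < e / 2"
    using Stone_Weierstrass_polynomial_function[OF assms(1,2), of "e / 2"] assms(3) by auto
  obtain Q where Q: "\<And>x. (q has_derivative Q x) (at x)"
    using polynomial_function_has_derivative[OF q(1)] by blast
  obtain c where c: "norm c < e / 2" "\<And>x. q x = c \<Longrightarrow> det (matrix (Q x)) \<noteq> 0"
    using exists_small_regular_shift[OF Q, of "e / 2"] assms(3) by auto
  define p where "p = (\<lambda>s. q s - c)"
  have dp: "(p has_derivative Q x) (at x)" for x
    unfolding p_def using has_derivative_diff[OF Q has_derivative_const[of c]] by simp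
  show ?thesis
  proof (rule that)
    show "smooth p" unfolding p_def
      by (intro polynomial_function_smooth polynomial_function_diff q polynomial_function_const)
    show "norm (p s - f s) < e" if "s \<in> K" for s
    proof -
      have "p s - f s = - (f s - q s) - c" by (simp add: p_def)
      then have "norm (p s - f s) \<le> norm (f s - q s) + norm c"
        by (metis norm_minus_cancel norm_triangle_ineq4)
      then show ?thesis using q(2)[OF that] c(1) by simp
    qed
    have "jacobian p (at x) = matrix (Q x)" for x
      unfolding jacobian_def using frechet_derivative_at[OF dp] by simp
    then show "regular_value_on p UNIV 0"
      unfolding regular_value_on_def using c(2) by (auto simp: p_def)
  qed
qed

text \<open>Uniqueness in the definite description comes from a single map: a regular approximation
  within both \<open>e\<close> and \<open>\<epsilon>\<close> has count 0 by assumption and count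
  \<open>d\<close> by the choice of \<open>d\<close>.\<close>

lemma brouwer_degree_eq_0:
  fixes f :: "('k::finite) vfield"
  assumes "bounded U" "continuous_on (closure U) f" "0 < e"
    and zero: "\<And>g. smooth g \<Longrightarrow> (\<And>s. s \<in> closure U \<Longrightarrow> dist (g s) (f s) < e) \<Longrightarrow> regular_value_on g U 0 \<Longrightarrow>
       (\<Sum>x | x \<in> U \<and> g x = 0. sgn (det (jacobian g (at x)))) = 0"
  shows "brouwer_degree f U 0 = 0"
  unfolding brouwer_degree_def
proof (rule the_equality)
  let ?adm = "\<lambda>\<epsilon> g. smooth g \<and> (\<forall>x\<in>closure U. dist (g x) (f x) < \<epsilon>) \<and> regular_value_on g U 0"
  let ?count = "\<lambda>g. \<Sum>x | x \<in> U \<and> g x = 0. sgn (det (jacobian g (at x)))"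
  show "\<exists>\<epsilon>>0. \<forall>g. ?adm \<epsilon> g \<longrightarrow> real_of_int 0 = ?count g"
    using zero \<open>0 < e\<close> by (intro exI[of _ e]) simp
  fix d :: int
  assume "\<exists>\<epsilon>>0. \<forall>g. ?adm \<epsilon> g \<longrightarrow> real_of_int d = ?count g"
  then obtain \<epsilon> where \<epsilon>: "\<epsilon> > 0" "\<And>g. ?adm \<epsilon> g \<Longrightarrow> real_of_int d = ?count g" by blast
  obtain p where p: "smooth p" "\<And>s. s \<in> closure U \<Longrightarrow> norm (p s - f s) < min e \<epsilon>" "regular_value_on p UNIV 0"
    using exists_smooth_regular_approximation[of "closure U" f "min e \<epsilon>"] assms \<epsilon>(1) by auto
  have "regular_value_on p U 0" using p(3) by (simp add: regular_value_on_def)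
  moreover have "dist (p s) (f s) < e" "dist (p s) (f s) < \<epsilon>" if "s \<in> closure U" for s
    using p(2)[OF that] by (auto simp: dist_norm)
  ultimately have "?count p = 0" "real_of_int d = ?count p"
    using p(1) by (intro zero \<epsilon>(2) conjI ballI; blast)+
  then show "d = 0" by simp
qed

text \<open>Vanishing of the bump integral is carried in small steps from \<open>l = 1\<close>,
  where the slice contains no zero of \<open>F\<close>, back to \<open>l = 0\<close>. The slices of
  \<open>Q\<close> change with \<open>l\<close>, but on the symmetric difference of two nearby
  slices the integrand is zero.\<close>

lemma brouwer_degree_homotopy_eq_0:
  fixes F :: "real \<Rightarrow> real^'k::finite \<Rightarrow> real^'k" and Q :: "(real \<times> (real^'k)) set"
  assumes contF: "continuous_on ({0..1} \<times> UNIV) (\<lambda>(l, s). F l s)"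
    and Q: "openin (top_of_set ({0..1} \<times> UNIV)) Q" "bounded Q"
    and fr: "\<And>l s. (l, s) \<in> closure Q \<Longrightarrow> (l, s) \<notin> Q \<Longrightarrow> F l s \<noteq> 0"
    and one: "\<And>s. (1, s) \<in> Q \<Longrightarrow> F 1 s \<noteq> 0"
  shows "brouwer_degree (F 0) {s. (0, s) \<in> Q} 0 = 0"
proof -
  obtain W where W: "open W" "Q = W \<inter> ({0..1} \<times> UNIV)"
    using Q(1) unfolding openin_open by (metis inf_commute)
  have clQ: "closure Q \<subseteq> {0..1} \<times> UNIV"
    by (rule closure_minimal) (auto simp: W(2) intro!: closed_Times)
  have compQ: "compact (closure Q)" using Q(2) by simp
  \<comment> \<open>\<open>K\<close> consists of the boundary of \<open>Q\<close> relative to the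
    strip and of the end at \<open>l = 1\<close>. All later thresholds are fractions of the lower
    bound \<open>e\<close> of the norm of \<open>F\<close> on \<open>K\<close>.\<close>
  define K where "K = (closure Q - W) \<union> (closure Q \<inter> ({1} \<times> UNIV))"
  have compK: "compact K" unfolding K_def
    by (intro compact_Un compact_diff compact_Int_closed compQ W(1) closed_Times) auto
  have Fne: "F l s \<noteq> 0" if "(l, s) \<in> K" for l s
    using that fr[of l s] one[of s] clQ unfolding K_def W(2) by auto
  have K_sub: "K \<subseteq> {0..1} \<times> UNIV" using clQ by (auto simp: K_def)
  have "\<exists>e>0. \<forall>x\<in>K. e \<le> norm (F (fst x) (snd x))"
  proof (cases "K = {}")
    case False
    have "continuous_on K (\<lambda>x. norm (F (fst x) (snd x)))"
      using continuous_on_subset[OF contF K_sub] by (intro continuous_on_norm) (simp add: split_beta)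
    from continuous_attains_inf[OF compK False this]
    obtain x0 where "x0 \<in> K" "\<And>x. x \<in> K \<Longrightarrow> norm (F (fst x0) (snd x0)) \<le> norm (F (fst x) (snd x))" by blast
    then show ?thesis using Fne[of "fst x0" "snd x0"] by (intro exI[of _ "norm (F (fst x0) (snd x0))"]) auto
  qed (auto intro: exI[of _ 1])
  then obtain e where e: "e > 0" "\<And>l s. (l, s) \<in> K \<Longrightarrow> e \<le> norm (F l s)" by force
  obtain B where B: "\<And>x. x \<in> closure Q \<Longrightarrow> norm x \<le> B"
    using compact_imp_bounded[OF compQ] unfolding bounded_iff by blast
  define C where "C = cball (0 :: real^'k) B"
  have CQ: "s \<in> C" if "(l, s) \<in> closure Q" for l s
    using B[OF that] norm_snd_le[of s l] by (simp add: C_def)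
  have "uniformly_continuous_on ({0..1} \<times> C) (\<lambda>(l, s). F l s)"
    by (intro compact_uniformly_continuous continuous_on_subset[OF contF] compact_Times) (auto simp: C_def)
  then obtain \<delta> where \<delta>: "\<delta> > 0" "\<And>x y. x \<in> {0..1} \<times> C \<Longrightarrow> y \<in> {0..1} \<times> C \<Longrightarrow> dist y x < \<delta> \<Longrightarrow>
      dist (F (fst y) (snd y)) (F (fst x) (snd x)) < e / 4"
    unfolding uniformly_continuous_on_def using e(1)
    by (metis (no_types, lifting) case_prod_beta' zero_less_divide_iff zero_less_numeral)
  have uc: "norm (F l s - F m s) < e / 4" if "l \<in> {0..1}" "m \<in> {0..1}" "s \<in> C" "\<bar>l - m\<bar> < \<delta>" for l m s
    using \<delta>(2)[of "(m, s)" "(l, s)"] that by (simp add: dist_Pair_Pair dist_norm)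
  define sl where "sl = (\<lambda>l. {s. (l, s) \<in> Q})"
  have op: "open (sl l)" if "l \<in> {0..1}" for l
  proof -
    have "sl l = (\<lambda>s. (l, s)) -` W" using that by (auto simp: sl_def W(2))
    then show ?thesis using W(1) by (auto intro!: open_vimage continuous_intros)
  qed
  have clsl: "(l, s) \<in> closure Q" if "s \<in> closure (sl l)" for l s
  proof -
    have "closed ((\<lambda>s. (l, s)) -` closure Q)" by (intro closed_vimage continuous_intros) simp
    moreover have "sl l \<subseteq> (\<lambda>s. (l, s)) -` closure Q" using closure_subset by (auto simp: sl_def)
    ultimately have "closure (sl l) \<subseteq> (\<lambda>s. (l, s)) -` closure Q" by (rule closure_minimal[rotated])
    then show ?thesis using that by auto
  qed
  have slC: "closure (sl l) \<subseteq> C" for l using clsl CQ by blast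
  have bd: "bounded (sl l)" for l
    by (rule bounded_subset[of C]) (use slC closure_subset in \<open>auto simp: C_def\<close>)
  have frsl: "(l, s) \<in> K" if "l \<in> {0..1}" "s \<in> frontier (sl l)" for l s
    using that op[of l] clsl[of s l] by (auto simp: frontier_def interior_open K_def sl_def W(2))
  \<comment> \<open>By connectedness: if the segment avoided \<open>K\<close>, its parameters
    \<open>v\<close> with \<open>(v, s) \<in> Q\<close> would form a set both open and closed in
    it.\<close>
  have cross: "\<exists>v\<in>closed_segment l m. (v, s) \<in> K"
    if "l \<in> {0..1}" "m \<in> {0..1}" "(l, s) \<in> Q" "(m, s) \<notin> Q" for l m s
  proof (rule ccontr)
    assume no: "\<not> (\<exists>v\<in>closed_segment l m. (v, s) \<in> K)"
    let ?S = "closed_segment l m"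
    have S01: "?S \<subseteq> {0..1}" using that by (intro closed_segment_subset) auto
    define A where "A = {v \<in> ?S. (v, s) \<in> Q}"
    have "A = ?S \<inter> (\<lambda>v. (v, s)) -` W" using S01 by (auto simp: A_def W(2))
    moreover have "open ((\<lambda>v. (v, s)) -` W)" by (intro open_vimage W continuous_intros)
    ultimately have "openin (top_of_set ?S) A" by (auto simp: openin_open)
    moreover have "A = ?S \<inter> (\<lambda>v. (v, s)) -` closure Q"
      using no S01 closure_subset[of Q] by (auto simp: A_def K_def W(2))
    moreover have "closed ((\<lambda>v. (v, s)) -` closure Q)" by (intro closed_vimage continuous_intros) simp
    ultimately have "A = {} \<or> A = ?S"
      using connected_clopen[of ?S] by (auto simp: closedin_closed)
    then show False using that by (auto simp: A_def)
  qed
  \<comment> \<open>Where \<open>norm (F l s) \<ge> e\<close>, a map within \<open>e / 2\<close> of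
    \<open>F l\<close> has norm above \<open>e / 2\<close>, so a bump of radius at most
    \<open>e / 4\<close> vanishes on its values.\<close>
  define P where "P = (\<lambda>l. \<forall>f f1 f2 \<eta>. C2 f f1 f2 \<longrightarrow> (\<forall>s\<in>closure (sl l). norm (f s - F l s) < e / 2) \<longrightarrow>
     0 < \<eta> \<longrightarrow> \<eta> \<le> e / 4 \<longrightarrow> bump_integral \<eta> f f1 (sl l) = 0)"
  have P1: "P 1"
    unfolding P_def
  proof (intro allI impI)
    fix f :: "'k vfield" and f1 f2 and \<eta> :: real
    assume "C2 f f1 f2" and cl: "\<forall>s\<in>closure (sl 1). norm (f s - F 1 s) < e / 2" and \<eta>: "0 < \<eta>" "\<eta> \<le> e / 4"
    have "bump \<eta> (f s) * det (jac f1 s) = 0" if "s \<in> sl 1" for s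
    proof -
      have "s \<in> closure (sl 1)" using that closure_subset by blast
      moreover have "(1, s) \<in> K" using clsl[OF calculation] by (simp add: K_def)
      ultimately have "e \<le> norm (F 1 s)" "norm (f s - F 1 s) < e / 2" using e(2) cl by auto
      moreover have "norm (F 1 s) \<le> norm (f s) + norm (f s - F 1 s)"
        using norm_triangle_ineq4[of "f s" "f s - F 1 s"] by simp
      ultimately have "\<eta> \<le> norm (f s)" using \<eta> by linarith
      then show ?thesis using \<eta> by (simp add: bump_eq_0)
    qed
    then have "bump_integral \<eta> f f1 (sl 1) = integral (sl 1) (\<lambda>s. 0)"
      by (intro hk_integral_cong)
    then show "bump_integral \<eta> f f1 (sl 1) = 0" by simp
  qed
  have step: "P m" if l: "l \<in> {0..1}" and m: "m \<in> {0..1}" and lm: "\<bar>l - m\<bar> < \<delta>" and Pl: "P l" for l m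
    unfolding P_def
  proof (intro allI impI)
    fix f :: "'k vfield" and f1 f2 and \<eta> :: real
    assume f: "C2 f f1 f2" and cl: "\<forall>s\<in>closure (sl m). norm (f s - F m s) < e / 2" and \<eta>: "0 < \<eta>" "\<eta> \<le> e / 4"
    have "continuous_on C (\<lambda>s. (\<lambda>(l, s). F l s) (l, s))"
      by (rule continuous_on_compose2[OF contF]) (use l in \<open>auto intro!: continuous_intros\<close>)
    then have "continuous_on C (F l)" by simp
    \<comment> \<open>One map serves both parameters: on \<open>C\<close> it is within
      \<open>e / 4\<close> of \<open>F l\<close>, hence within \<open>e / 2\<close> of
      \<open>F m\<close>.\<close>
    then obtain p where p: "polynomial_function p" "\<And>s. s \<in> C \<Longrightarrow> norm (F l s - p s) < e / 4"
      using Stone_Weierstrass_polynomial_function[of C "F l" "e / 4"] e(1) by (auto simp: C_def)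
    obtain p1 p2 where p12: "C2 p p1 p2"
      using smooth_imp_C2[OF polynomial_function_smooth[OF p(1)]] by blast
    let ?I = "\<lambda>s. bump \<eta> (p s) * det (jac p1 s)"
    have "\<forall>s\<in>closure (sl l). norm (p s - F l s) < e / 2"
    proof
      fix s assume "s \<in> closure (sl l)"
      then have "norm (F l s - p s) < e / 4" using p(2) slC by blast
      then show "norm (p s - F l s) < e / 2" using e(1) by (simp add: norm_minus_commute)
    qed
    then have "integral (sl l) ?I = 0"
      using Pl[unfolded P_def, rule_format, OF p12 _ \<eta>] by blast
    \<comment> \<open>This covers the points that lie in only one of the two slices: by
      \<open>cross\<close> they meet \<open>K\<close> at some \<open>v\<close> between
      \<open>l\<close> and \<open>m\<close>. Two errors of \<open>e / 4\<close> still leave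
      \<open>norm (p s) \<ge> e / 2\<close>.\<close>
    moreover have vanish: "?I s = 0" if s: "s \<in> C" and v: "v \<in> closed_segment l m" "(v, s) \<in> K" for s v
    proof -
      have n01: "v \<in> {0..1}" using v(2) K_sub by auto
      have "\<bar>v - l\<bar> \<le> \<bar>l - m\<bar>"
        using segment_bound(1)[OF v(1)] by (simp add: dist_norm norm_minus_commute abs_minus_commute)
      then have "norm (F v s - F l s) < e / 4" using uc[OF n01 l s] lm by linarith
      moreover have "e \<le> norm (F v s)" using e(2)[OF v(2)] .
      moreover have "norm (F l s - p s) < e / 4" by (rule p(2)[OF s])
      moreover have "norm (F v s) \<le> norm (p s) + norm (F v s - F l s) + norm (F l s - p s)"
        using norm_triangle_ineq[of "p s" "(F v s - F l s) + (F l s - p s)"]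
          norm_triangle_ineq[of "F v s - F l s" "F l s - p s"] by simp
      ultimately have "\<eta> \<le> norm (p s)" using \<eta> by linarith
      then show ?thesis using \<eta> by (simp add: bump_eq_0)
    qed
    moreover have "integral (sl m) ?I = integral (sl l) ?I"
    proof -
      have inC: "s \<in> C" if "s \<in> sl l \<or> s \<in> sl m" for s using that slC closure_subset by blast
      have "integral (sl l \<inter> sl m) ?I = integral (sl m) ?I"
      proof (rule integral_eq_superset)
        fix s assume s: "s \<in> sl m - sl l \<inter> sl m"
        then obtain v where "v \<in> closed_segment m l" "(v, s) \<in> K"
          using cross[OF m l, of s] by (auto simp: sl_def)
        then show "?I s = 0" using vanish[OF inC] s by (simp add: closed_segment_commute)
      qed simp
      moreover have "integral (sl l \<inter> sl m) ?I = integral (sl l) ?I"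
      proof (rule integral_eq_superset)
        fix s assume s: "s \<in> sl l - sl l \<inter> sl m"
        then obtain v where "v \<in> closed_segment l m" "(v, s) \<in> K"
          using cross[OF l m, of s] by (auto simp: sl_def)
        then show "?I s = 0" using vanish[OF inC] s by simp
      qed simp
      ultimately show ?thesis by simp
    qed
    moreover have "bump_integral \<eta> f f1 (sl m) = integral (sl m) ?I"
    proof (rule bump_integral_homotopy[OF op[OF m] bd _ f p12])
      fix t s assume t: "0 \<le> t" "t \<le> (1::real)" and s: "s \<in> frontier (sl m)"
      have scl: "s \<in> closure (sl m)" using s by (simp add: frontier_def)
      have "norm (f s - F m s) < e / 2" using cl scl by blast
      moreover have "norm (p s - F m s) < e / 2"
      proof -
        have "norm (F l s - p s) < e / 4" "norm (F l s - F m s) < e / 4"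
          using p(2) uc[OF l m _ lm] slC scl by blast+
        moreover have "norm (p s - F m s) \<le> norm (F l s - p s) + norm (F l s - F m s)"
          using norm_triangle_ineq4[of "F l s - F m s" "F l s - p s"] by (simp add: norm_minus_commute)
        ultimately show ?thesis by linarith
      qed
      ultimately have "f s \<in> ball (F m s) (e / 2)" "p s \<in> ball (F m s) (e / 2)"
        by (auto simp: dist_norm norm_minus_commute)
      then have "(1 - t) *\<^sub>R f s + t *\<^sub>R p s \<in> ball (F m s) (e / 2)"
        using t by (intro convexD_alt[OF convex_ball]) auto
      moreover have "(1 - t) *\<^sub>R f s + t *\<^sub>R p s = f s + t *\<^sub>R (p s - f s)"
        by (simp add: algebra_simps)
      ultimately have "norm (F m s - (f s + t *\<^sub>R (p s - f s))) < e / 2"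
        by (simp add: dist_norm)
      moreover have "e \<le> norm (F m s)" using e(2) frsl[OF m s] by blast
      moreover have "norm (F m s) \<le> norm (f s + t *\<^sub>R (p s - f s)) + norm (F m s - (f s + t *\<^sub>R (p s - f s)))"
        by (rule norm_triangle_sub)
      ultimately show "\<eta> < norm (f s + t *\<^sub>R (p s - f s))" using \<eta> by linarith
    qed (use \<eta> in simp)
    ultimately show "bump_integral \<eta> f f1 (sl m) = 0" by simp
  qed
  \<comment> \<open>The parameter runs from 1 down to 0 in \<open>Suc N\<close> equal steps, each
    shorter than \<open>\<delta>\<close>.\<close>
  obtain N where N: "inverse (real (Suc N)) < \<delta>" using reals_Archimedean[OF \<delta>(1)] by blast
  have "k \<le> Suc N \<Longrightarrow> P (1 - real k / real (Suc N))" for k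
  proof (induction k)
    case (Suc k)
    define a b where "a = real k / real (Suc N)" and "b = real (Suc k) / real (Suc N)"
    have Pa: "P (1 - a)" unfolding a_def using Suc by simp
    have "b - a = inverse (real (Suc N))" unfolding a_def b_def by (simp add: field_simps)
    moreover have "0 < inverse (real (Suc N))" by simp
    ultimately have "\<bar>(1 - a) - (1 - b)\<bar> < \<delta>" using N by linarith
    moreover have "1 - a \<in> {0..1}" "1 - b \<in> {0..1}"
      unfolding a_def b_def using Suc.prems by auto
    ultimately have "P (1 - b)" by (intro step[OF _ _ _ Pa])
    then show ?case by (simp only: b_def)
  qed (use P1 in simp)
  from this[of "Suc N"] have P0: "P 0" by simp
  have cont0: "continuous_on S (F 0)" for S
  proof -
    have "continuous_on S (\<lambda>s. (\<lambda>(l, s). F l s) (0, s))"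
      by (rule continuous_on_compose2[OF contF]) (auto intro!: continuous_intros)
    then show ?thesis by simp
  qed
  have "brouwer_degree (F 0) (sl 0) 0 = 0"
  proof (rule brouwer_degree_eq_0[OF bd cont0, of "e / 2"])
    fix g assume g: "smooth g" and cl: "\<And>s. s \<in> closure (sl 0) \<Longrightarrow> dist (g s) (F 0 s) < e / 2"
      and reg: "regular_value_on g (sl 0) 0"
    obtain g1 g2 where g12: "C2 g g1 g2" "\<And>x. jac g1 x = jacobian g (at x)"
      using smooth_imp_C2[OF g] by blast
    have "g s \<noteq> 0" if "s \<in> frontier (sl 0)" for s
    proof
      assume "g s = 0"
      moreover have "s \<in> closure (sl 0)" using that by (simp add: frontier_def)
      ultimately have "norm (F 0 s) < e / 2" using cl[of s] by simp
      then show False using e(2)[OF frsl[OF _ that]] e(1) by simp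
    qed
    then have "\<forall>\<^sub>F \<eta> in at_right 0. bump_integral \<eta> g g1 (sl 0)
     = (\<Sum>s | s \<in> sl 0 \<and> g s = 0. sgn (det (jac g1 s))) * bump_mass TYPE('k) \<eta>"
      using reg by (intro bump_integral_regular_zeros[OF op bd g12(1)]) (auto simp: regular_value_on_def g12(2))
    moreover have "\<forall>\<^sub>F \<eta> in at_right 0. 0 < \<eta> \<and> \<eta> \<le> e / 4"
      unfolding eventually_at_right_field using e(1) by (intro exI[of _ "e / 4"]) simp
    ultimately have "\<forall>\<^sub>F \<eta> in at_right 0. (bump_integral \<eta> g g1 (sl 0)
     = (\<Sum>s | s \<in> sl 0 \<and> g s = 0. sgn (det (jac g1 s))) * bump_mass TYPE('k) \<eta>) \<and> 0 < \<eta> \<and> \<eta> \<le> e / 4"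
      by (rule eventually_conj)
    from eventually_happens[OF this] obtain \<eta> where \<eta>: "0 < \<eta>" "\<eta> \<le> e / 4"
      "bump_integral \<eta> g g1 (sl 0)
       = (\<Sum>s | s \<in> sl 0 \<and> g s = 0. sgn (det (jac g1 s))) * bump_mass TYPE('k) \<eta>" by auto
    have "\<forall>s\<in>closure (sl 0). norm (g s - F 0 s) < e / 2" using cl by (simp add: dist_norm)
    then have "bump_integral \<eta> g g1 (sl 0) = 0"
      using P0[unfolded P_def, rule_format, OF g12(1) _ \<eta>(1,2)] by blast
    then show "(\<Sum>x | x \<in> sl 0 \<and> g x = 0. sgn (det (jacobian g (at x)))) = 0"
      using \<eta>(3) integral_bump_pos[OF \<eta>(1), where 'k='k] by (simp add: g12(2))
  qed (use e in simp)
  then show ?thesis by (simp add: sl_def)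
qed

section \<open>Indefinite Lebesgue integrals\<close>

lemma right_derivative_indefinite_integral_ae:
  fixes f :: "real \<Rightarrow> 'a::euclidean_space"
  assumes "\<And>a b. f integrable_on {a..b}"
  obtains N where "negligible N"
    "\<And>x e. x \<notin> N \<Longrightarrow> 0 < e \<Longrightarrow>
       \<exists>d>0. \<forall>h. 0 < h \<and> h < d \<longrightarrow> norm (integral {x..x + h} f - h *\<^sub>R f x) \<le> e * h"
proof -
  obtain N where N: "negligible N"
    "\<And>x e. \<lbrakk>x \<notin> N; 0 < e\<rbrakk> \<Longrightarrow> \<exists>d>0. \<forall>h. 0 < h \<and> h < d \<longrightarrow>
        norm (integral (cbox x (x + h *\<^sub>R One)) f /\<^sub>R h ^ DIM(real) - f x) < e"
    using integrable_ccontinuous_explicit[of f] assms by (metis box_real(2))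
  show ?thesis
  proof (rule that[OF N(1)])
    fix x e :: real assume "x \<notin> N" "0 < e"
    from N(2)[OF this] obtain d where d: "d > 0"
      "\<And>h. 0 < h \<Longrightarrow> h < d \<Longrightarrow> norm (integral {x..x + h} f /\<^sub>R h - f x) < e" by auto
    have "norm (integral {x..x + h} f - h *\<^sub>R f x) \<le> e * h" if h: "0 < h" "h < d" for h
    proof -
      have "integral {x..x + h} f - h *\<^sub>R f x = h *\<^sub>R (integral {x..x + h} f /\<^sub>R h - f x)"
        using h by (simp add: algebra_simps)
      then have "norm (integral {x..x + h} f - h *\<^sub>R f x) = h * norm (integral {x..x + h} f /\<^sub>R h - f x)"
        using h by simp
      then show ?thesis using d(2)[OF h] h by (simp add: mult.commute)
    qed
    then show "\<exists>d>0. \<forall>h. 0 < h \<and> h < d \<longrightarrow> norm (integral {x..x + h} f - h *\<^sub>R f x) \<le> e * h"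
      using d(1) by blast
  qed
qed

text \<open>\<open>right_derivative_indefinite_integral_ae\<close> controls increments to the right.
  Applied to the function reflected at 0 it controls those to the left, and off both exceptional
  sets the two derivatives are \<open>f t\<close>.\<close>

lemma indefinite_integral_has_vector_derivative_ae:
  fixes f :: "real \<Rightarrow> 'a::euclidean_space"
  assumes "f integrable_on {a..b}"
  obtains N where "negligible N"
    "\<And>t. t \<in> {a..b} - N \<Longrightarrow> ((\<lambda>t. integral {a..t} f) has_vector_derivative f t) (at t within {a..b})"
proof -
  define F where "F = (\<lambda>t. if t \<in> {a..b} then f t else 0)"
  have "F integrable_on UNIV"
    unfolding F_def Henstock_Kurzweil_Integration.integrable_restrict_UNIV by (rule assms)
  then have Fint: "F integrable_on {c..d}" for c d
    using integrable_on_subcbox[of F UNIV c d] by simp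
  obtain N1 where N1: "negligible N1"
    "\<And>x e. x \<notin> N1 \<Longrightarrow> 0 < e \<Longrightarrow>
       \<exists>d>0. \<forall>h. 0 < h \<and> h < d \<longrightarrow> norm (integral {x..x + h} F - h *\<^sub>R F x) \<le> e * h"
    using right_derivative_indefinite_integral_ae[of F] Fint by blast
  have "(\<lambda>t. F (- t)) integrable_on {c..d}" for c d
    using Fint[of "- d" "- c"] Henstock_Kurzweil_Integration.integrable_reflect_real[where f = F and a = "- d" and b = "- c"] by simp
  then obtain N2 where N2: "negligible N2"
    "\<And>x e. x \<notin> N2 \<Longrightarrow> 0 < e \<Longrightarrow>
       \<exists>d>0. \<forall>h. 0 < h \<and> h < d \<longrightarrow> norm (integral {x..x + h} (\<lambda>t. F (- t)) - h *\<^sub>R F (- x)) \<le> e * h"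
    using right_derivative_indefinite_integral_ae[of "\<lambda>t. F (- t)"] by blast
  have "negligible (uminus ` N2)"
    by (rule negligible_differentiable_image_negligible[OF _ N2(1)]) (auto intro!: derivative_intros)
  then have negl: "negligible (N1 \<union> uminus ` N2)" using N1(1) by (rule negligible_Un[rotated])
  have "((\<lambda>t. integral {a..t} f) has_vector_derivative f t) (at t within {a..b})"
    if t: "t \<in> {a..b} - (N1 \<union> uminus ` N2)" for t
    unfolding has_vector_derivative_def has_derivative_within_alt
  proof (intro conjI allI impI)
    show "bounded_linear (\<lambda>h. h *\<^sub>R f t)" by (rule bounded_linear_scaleR_left)
    fix e :: real assume e: "0 < e"
    have t1: "t \<notin> N1" and t2: "- t \<notin> N2" using t by (auto simp: image_iff)
    obtain d1 where d1: "d1 > 0" "\<And>h. 0 < h \<Longrightarrow> h < d1 \<Longrightarrow> norm (integral {t..t + h} F - h *\<^sub>R F t) \<le> e * h"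
      using N1(2)[OF t1 e] by blast
    obtain d2 where d2: "d2 > 0" "\<And>h. 0 < h \<Longrightarrow> h < d2 \<Longrightarrow>
        norm (integral {- t..- t + h} (\<lambda>t. F (- t)) - h *\<^sub>R F t) \<le> e * h"
      using N2(2)[OF t2 e] by auto
    have Ff: "integral {c..d} F = integral {c..d} f" if "a \<le> c" "d \<le> b" for c d
      by (rule hk_integral_cong) (use that in \<open>auto simp: F_def\<close>)
    have Ft: "F t = f t" using t by (simp add: F_def)
    have fint: "f integrable_on {a..d}" if "d \<le> b" for d
      by (rule integrable_on_subinterval[OF assms]) (use that in auto)
    have "norm (integral {a..y} f - integral {a..t} f - (y - t) *\<^sub>R f t) \<le> e * norm (y - t)"
      if y: "y \<in> {a..b}" "norm (y - t) < min d1 d2" for y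
    proof (cases y t rule: linorder_cases)
      case less
      have "integral {- t..- t + (t - y)} (\<lambda>t. F (- t)) = integral {y..t} F"
        using Henstock_Kurzweil_Integration.integral_reflect_real[where f = F and a = y and b = t] by simp
      also have "\<dots> = integral {a..t} f - integral {a..y} f"
        using hk_integral_combine[where a = a and c = y and b = t and f = f] fint[of t] y t less by (simp add: Ff algebra_simps)
      finally have "norm (integral {a..t} f - integral {a..y} f - (t - y) *\<^sub>R f t) \<le> e * (t - y)"
        using d2(2)[of "t - y"] y less Ft by simp
      moreover have "integral {a..y} f - integral {a..t} f - (y - t) *\<^sub>R f t
         = - (integral {a..t} f - integral {a..y} f - (t - y) *\<^sub>R f t)"
        by (simp add: algebra_simps)
      ultimately show ?thesis using less by (simp only: norm_minus_cancel) simp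
    next
      case equal
      then show ?thesis by simp
    next
      case greater
      have "integral {t..t + (y - t)} F = integral {a..y} f - integral {a..t} f"
        using hk_integral_combine[where a = a and c = t and b = y and f = f] fint[of y] y t greater by (simp add: Ff algebra_simps)
      then show ?thesis using d1(2)[of "y - t"] y greater Ft by simp
    qed
    then show "\<exists>d>0. \<forall>y\<in>{a..b}. norm (y - t) < d \<longrightarrow>
        norm (integral {a..y} f - integral {a..t} f - (y - t) *\<^sub>R f t) \<le> e * norm (y - t)"
      using d1(1) d2(1) by (intro exI[of _ "min d1 d2"]) auto
  qed
  then show ?thesis using that negl by blast
qed

lemma sum_integrals_disjoint_le:
  fixes r :: "real \<Rightarrow> real"
  assumes r: "r integrable_on {a..b}" "\<And>t. t \<in> {a..b} \<Longrightarrow> 0 \<le> r t"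
    and D: "finite D" "\<forall>(c, d)\<in>D. c \<le> d \<and> {c..d} \<subseteq> {a..b}" "disjoint_family_on (\<lambda>(c, d). {c<..<d}) D"
  shows "(\<Sum>(c, d)\<in>D. integral {c..d} r) \<le> integral {a..b} r"
proof -
  have int: "r integrable_on {c..d}" if "(c, d) \<in> D" for c d
    by (rule integrable_on_subinterval[OF r(1)]) (use D(2) that in auto)
  have "(r has_integral (\<Sum>p\<in>D. integral {fst p..snd p} r)) (\<Union>p\<in>D. {fst p<..<snd p})"
  proof (rule has_integral_UN[OF D(1)])
    fix p assume "p \<in> D"
    then show "(r has_integral integral {fst p..snd p} r) {fst p<..<snd p}"
      using integrable_integral[OF int[of "fst p" "snd p"]]
      by (simp add: has_integral_Icc_iff_Ioo)
  next
    show "pairwise (\<lambda>p q. negligible ({fst p<..<snd p} \<inter> {fst q<..<snd q})) D"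
      using D(3) by (auto simp: pairwise_def disjoint_family_on_def split_beta)
  qed
  moreover have "integral (\<Union>p\<in>D. {fst p<..<snd p}) r \<le> integral {a..b} r"
  proof (rule integral_subset_le)
    show "(\<Union>p\<in>D. {fst p<..<snd p}) \<subseteq> {a..b}" using D(2) by fastforce
  qed (use r calculation in auto)
  ultimately show ?thesis by (simp add: split_beta integral_unique)
qed

text \<open>Truncation of \<open>r\<close> at a large \<open>n\<close>: the excess over
  \<open>n\<close> has integral below \<open>e / 2\<close>, and the truncated part is controlled by
  \<open>n\<close> times the total length of the intervals.\<close>

lemma absolutely_continuous_on_of_integral_bound:
  fixes F :: "real \<Rightarrow> 'a::real_normed_vector" and r :: "real \<Rightarrow> real"
  assumes r: "r absolutely_integrable_on {a..b}" "\<And>t. t \<in> {a..b} \<Longrightarrow> 0 \<le> r t"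
    and F: "\<And>c d. a \<le> c \<Longrightarrow> c \<le> d \<Longrightarrow> d \<le> b \<Longrightarrow> norm (F d - F c) \<le> integral {c..d} r"
  shows "absolutely_continuous_on {a..b} F"
  unfolding absolutely_continuous_on_def
proof (intro allI impI)
  fix e :: real assume e: "0 < e"
  have ri: "r integrable_on {a..b}" using r(1) by (simp add: absolutely_integrable_on_def)
  have mi: "(\<lambda>t. min (r t) (real n)) integrable_on {a..b}" for n
  proof -
    have "(\<lambda>t. min (r t) (real n)) absolutely_integrable_on {a..b}"
      by (rule absolutely_integrable_min_1[OF r(1)]) (simp add: absolutely_integrable_on_def integrable_const_ivl)
    then show ?thesis by (simp add: absolutely_integrable_on_def)
  qed
  have "(\<lambda>n. integral {a..b} (\<lambda>t. min (r t) (real n))) \<longlonglongrightarrow> integral {a..b} r"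
  proof (rule dominated_convergence(2)[OF mi ri])
    show "norm (min (r t) (real n)) \<le> r t" if "t \<in> {a..b}" for t n
      using r(2)[OF that] by simp
    show "(\<lambda>n. min (r t) (real n)) \<longlonglongrightarrow> r t" if "t \<in> {a..b}" for t
    proof (rule tendsto_eventually)
      obtain n0 where "r t \<le> real n0" using real_arch_simple by blast
      then show "\<forall>\<^sub>F n in sequentially. min (r t) (real n) = r t"
        by (intro eventually_sequentiallyI[of n0]) auto
    qed
  qed
  then obtain n where "dist (integral {a..b} (\<lambda>t. min (r t) (real n))) (integral {a..b} r) < e / 2"
    using e by (metis (no_types, lifting) half_gt_zero LIMSEQ_iff_nz lim_sequentially order_refl)
  then have n: "integral {a..b} (\<lambda>t. r t - min (r t) (real n)) < e / 2"
    using hk_integral_diff[OF ri mi, of n]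
    unfolding dist_real_def by linarith
  show "\<exists>m>0. \<forall>D. finite D \<and> (\<forall>(c, d)\<in>D. c \<le> d \<and> {c..d} \<subseteq> {a..b}) \<and>
      disjoint_family_on (\<lambda>(a, b). {a<..<b}) D \<and> (\<Sum>(c, d)\<in>D. d - c) < m \<longrightarrow>
      (\<Sum>(c, d)\<in>D. norm (F d - F c)) < e"
  \<comment> \<open>With this bound on the total length the truncated part contributes at most
    \<open>e / 2\<close>; the summand 1 keeps the quotient meaningful for
    \<open>n = 0\<close>.\<close>
  proof (intro exI[of _ "e / (2 * (real n + 1))"] conjI allI impI; (elim conjE)?)
    show "0 < e / (2 * (real n + 1))" using e by simp
    fix D assume D: "finite D" "\<forall>(c, d)\<in>D. c \<le> d \<and> {c..d} \<subseteq> {a..b}"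
      "disjoint_family_on (\<lambda>(a, b). {a<..<b}) D" and small: "(\<Sum>(c, d)\<in>D. d - c) < e / (2 * (real n + 1))"
    let ?q = "\<lambda>t. r t - min (r t) (real n)"
    have qi: "?q integrable_on {a..b}" by (intro Henstock_Kurzweil_Integration.integrable_diff ri mi)
    have each: "norm (F d - F c) \<le> real n * (d - c) + integral {c..d} ?q" if "(c, d) \<in> D" for c d
    proof -
      have cd: "a \<le> c" "c \<le> d" "d \<le> b" using D(2) that by auto
      have sub: "f integrable_on {c..d}" if "f integrable_on {a..b}" for f :: "real \<Rightarrow> real"
        by (rule integrable_on_subinterval[OF that]) (use cd in auto)
      have "integral {c..d} r = integral {c..d} (\<lambda>t. min (r t) (real n)) + integral {c..d} ?q"
        using hk_integral_diff[OF sub[OF ri] sub[OF mi]] by simp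
      moreover have "integral {c..d} (\<lambda>t. min (r t) (real n)) \<le> integral {c..d} (\<lambda>t. real n)"
        by (intro integral_le sub mi) auto
      ultimately show ?thesis using F[OF cd] cd by (simp add: mult.commute)
    qed
    have "(\<Sum>(c, d)\<in>D. norm (F d - F c)) \<le> (\<Sum>(c, d)\<in>D. real n * (d - c) + integral {c..d} ?q)"
      using each by (intro sum_mono) auto
    also have "\<dots> = real n * (\<Sum>(c, d)\<in>D. d - c) + (\<Sum>(c, d)\<in>D. integral {c..d} ?q)"
      by (simp add: split_beta sum.distrib sum_distrib_left)
    also have "(\<Sum>(c, d)\<in>D. integral {c..d} ?q) \<le> integral {a..b} ?q"
      by (rule sum_integrals_disjoint_le[OF qi _ D]) simp
    also have "real n * (\<Sum>(c, d)\<in>D. d - c) \<le> real n * (e / (2 * (real n + 1)))"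
      using small by (intro mult_left_mono) auto
    also have "\<dots> \<le> e / 2" using e by (simp add: field_simps)
    finally show "(\<Sum>(c, d)\<in>D. norm (F d - F c)) < e" using n by simp
  qed
qed

section \<open>Tonelli approximations\<close>

abbreviation measurable_upto :: "real \<Rightarrow> (real \<Rightarrow> 'a::topological_space) \<Rightarrow> bool" where
  "measurable_upto T y \<equiv> y \<in> borel_measurable (lebesgue_on {0..T})"

abbreviation field_integral :: "(real \<Rightarrow> 'a \<Rightarrow> 'b::real_normed_vector) \<Rightarrow> (real \<Rightarrow> 'a) \<Rightarrow> real \<Rightarrow> 'b" where
  "field_integral N x t \<equiv> integral {0..t} (\<lambda>u. N u (x u))"

section \<open>Globally dominated Caratheodory fields\<close>

text \<open>Continuity and the bound hold at every \<open>t\<close> and the bound is uniform in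
  \<open>s\<close>. \<open>truncated_cyclic_field\<close> arranges this by truncating and by
  changing the field on a null set, so that all limits below reduce to dominated
  convergence.\<close>

locale caratheodory_field =
  fixes T :: real and N :: "real \<Rightarrow> 'a::euclidean_space \<Rightarrow> 'a" and \<rho> :: "real \<Rightarrow> real"
  assumes T: "T > 0"
    and meas: "\<And>s. measurable_upto T (\<lambda>t. N t s)"
    and cont: "\<And>t. t \<in> {0..T} \<Longrightarrow> continuous_on UNIV (N t)"
    and bound: "\<And>t s. t \<in> {0..T} \<Longrightarrow> norm (N t s) \<le> \<rho> t"
    and \<rho>_int: "\<rho> integrable_on {0..T}"
begin

text \<open>A simple function takes finitely many values, so along it the claim follows from the
  measurability of \<open>N t s\<close> in \<open>t\<close> for fixed \<open>s\<close>. Continuity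
  of \<open>N t\<close> then passes it to limits of simple functions.\<close>

lemma measurable_composition:
  assumes y: "measurable_upto T y"
  shows "measurable_upto T (\<lambda>t. N t (y t))"
proof -
  obtain w where w: "\<And>i. simple_function (lebesgue_on {0..T}) (w i)"
    "\<And>x. x \<in> space (lebesgue_on {0..T}) \<Longrightarrow> (\<lambda>i. w i x) \<longlonglongrightarrow> y x"
    using borel_measurable_implies_sequence_metric[OF y, of 0] by blast
  have "measurable_upto T (\<lambda>t. N t (w i t))" for i
  proof (rule measurable_compose_countable'[where g = "w i" and I = "w i ` space (lebesgue_on {0..T})"])
    show "w i \<in> measurable (lebesgue_on {0..T}) (count_space (w i ` space (lebesgue_on {0..T})))"
      using w(1)[of i] by (subst measurable_count_space_eq_countable) (auto simp: simple_function_def countable_finite)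
    show "countable (w i ` space (lebesgue_on {0..T}))"
      using w(1)[of i] by (simp add: simple_function_def countable_finite)
  qed (rule meas)
  then show ?thesis
  proof (rule borel_measurable_LIMSEQ_metric)
    fix t assume t: "t \<in> space (lebesgue_on {0..T})"
    then have "isCont (N t) (y t)" using cont[of t] by (simp add: continuous_on_eq_continuous_at)
    then show "(\<lambda>i. N t (w i t)) \<longlonglongrightarrow> N t (y t)"
      by (rule isCont_tendsto_compose[OF _ w(2)[OF t]])
  qed
qed

lemma absolutely_integrable_composition:
  assumes y: "measurable_upto T y" and t: "0 \<le> c" "d \<le> T"
  shows "(\<lambda>u. N u (y u)) absolutely_integrable_on {c..d}"
proof -
  have "(\<lambda>u. N u (y u)) absolutely_integrable_on {0..T}"
    by (rule measurable_bounded_by_integrable_imp_absolutely_integrable[OF measurable_composition[OF y] _ \<rho>_int bound]) auto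
  then show ?thesis by (rule set_integrable_subset) (use t in auto)
qed

lemma integrable_composition:
  assumes y: "measurable_upto T y" and t: "0 \<le> c" "d \<le> T"
  shows "(\<lambda>u. N u (y u)) integrable_on {c..d}"
  using absolutely_integrable_composition[OF assms] by (simp add: absolutely_integrable_on_def)

lemma \<rho>_integrable: "0 \<le> c \<Longrightarrow> d \<le> T \<Longrightarrow> \<rho> integrable_on {c..d}"
  by (rule integrable_on_subinterval[OF \<rho>_int]) auto

lemma \<rho>_nonneg: "t \<in> {0..T} \<Longrightarrow> 0 \<le> \<rho> t"
  using bound[of t 0] norm_ge_zero order_trans by blast

lemma norm_integral_composition_le:
  assumes y: "measurable_upto T y" and t: "0 \<le> c" "d \<le> T"
  shows "norm (integral {c..d} (\<lambda>u. N u (y u))) \<le> integral {c..d} \<rho>"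
  by (rule integral_norm_bound_integral[OF integrable_composition[OF assms] \<rho>_integrable[OF t]])
     (use t bound in auto)

lemma integral_norm_diff_tendsto_0:
  assumes y: "\<And>k. measurable_upto T (y k)" "measurable_upto T z"
    and lim: "\<And>u. u \<in> {0..T} \<Longrightarrow> (\<lambda>k. y k u) \<longlonglongrightarrow> z u"
  shows "(\<lambda>k. integral {0..T} (\<lambda>u. norm (N u (y k u) - N u (z u)))) \<longlonglongrightarrow> 0"
proof -
  have "(\<lambda>k. integral {0..T} (\<lambda>u. norm (N u (y k u) - N u (z u)))) \<longlonglongrightarrow> integral {0..T} (\<lambda>u. 0::real)"
  proof (rule dominated_convergence(2))
    show "(\<lambda>u. norm (N u (y k u) - N u (z u))) integrable_on {0..T}" for k
      using set_integral_diff(1)[OF absolutely_integrable_composition[OF y(1)] absolutely_integrable_composition[OF y(2)], of 0 T k]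
      by (auto simp: absolutely_integrable_on_def)
    show "(\<lambda>u. 2 * \<rho> u) integrable_on {0..T}"
      using integrable_cmul[OF \<rho>_int, of 2] by simp
    show "norm (norm (N u (y k u) - N u (z u))) \<le> 2 * \<rho> u" if "u \<in> {0..T}" for k u
      using norm_triangle_ineq4[of "N u (y k u)" "N u (z u)"] bound[OF that, of "y k u"] bound[OF that, of "z u"]
      by simp
    show "(\<lambda>k. norm (N u (y k u) - N u (z u))) \<longlonglongrightarrow> 0" if "u \<in> {0..T}" for u
    proof -
      have "isCont (N u) (z u)" using cont[OF that] by (simp add: continuous_on_eq_continuous_at)
      then have "(\<lambda>k. N u (y k u)) \<longlonglongrightarrow> N u (z u)"
        by (rule isCont_tendsto_compose[OF _ lim[OF that]])
      then show ?thesis by (simp add: LIM_zero tendsto_norm_zero)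
    qed
  qed
  then show ?thesis by simp
qed

text \<open>The bound does not depend on \<open>t\<close>, so pointwise convergence of the
  integrands becomes convergence of the integrals uniformly in \<open>t\<close>.\<close>

lemma norm_integral_diff_le:
  assumes y: "measurable_upto T y" "measurable_upto T z"
    and t: "t \<in> {0..T}"
  shows "norm (field_integral N y t - field_integral N z t)
     \<le> integral {0..T} (\<lambda>u. norm (N u (y u) - N u (z u)))"
proof -
  have t': "0 \<le> (0::real)" "t \<le> T" using t by auto
  have ab: "(\<lambda>u. N u (y u) - N u (z u)) absolutely_integrable_on {0..d}" if "d \<le> T" for d
    using absolutely_integrable_composition[OF y(1), of 0 d] absolutely_integrable_composition[OF y(2), of 0 d] that
    by (intro set_integral_diff(1)) auto
  have "field_integral N y t - field_integral N z t = integral {0..t} (\<lambda>u. N u (y u) - N u (z u))"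
    by (rule sym, rule hk_integral_diff)
       (use integrable_composition[OF y(1) t'] integrable_composition[OF y(2) t'] in auto)
  also have "norm \<dots> \<le> integral {0..t} (\<lambda>u. norm (N u (y u) - N u (z u)))"
    using ab[OF t'(2)] by (intro integral_norm_bound_integral) (auto simp: absolutely_integrable_on_def)
  also have "\<dots> \<le> integral {0..T} (\<lambda>u. norm (N u (y u) - N u (z u)))"
    using ab[OF t'(2)] ab[of T] t by (intro integral_subset_le) (auto simp: absolutely_integrable_on_def)
  finally show ?thesis .
qed

lemma integral_composition_tendsto:
  assumes y: "\<And>k. measurable_upto T (y k)" "measurable_upto T z"
    and lim: "\<And>u. u \<in> {0..T} \<Longrightarrow> (\<lambda>k. y k u) \<longlonglongrightarrow> z u" and t: "t \<in> {0..T}"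
  shows "(\<lambda>k. integral {0..t} (\<lambda>u. N u (y k u))) \<longlonglongrightarrow> field_integral N z t"
proof (rule LIM_zero_cancel, rule Lim_null_comparison)
  show "\<forall>\<^sub>F k in sequentially. norm (integral {0..t} (\<lambda>u. N u (y k u)) - field_integral N z t)
      \<le> integral {0..T} (\<lambda>u. norm (N u (y k u) - N u (z u)))"
    by (intro always_eventually allI norm_integral_diff_le y t)
qed (rule integral_norm_diff_tendsto_0[OF y lim])

end

lemma continuous_on_imp_lebesgue_measurable:
  fixes y :: "real \<Rightarrow> 'a::euclidean_space"
  assumes "continuous_on {0..T} y"
  shows "measurable_upto T y"
  using assms by (intro continuous_imp_measurable_on_sets_lebesgue) auto

section \<open>The delayed equation and its dependence on parameters\<close>

text \<open>\<open>S l\<close> abstracts the scaling along the path and is applied to integrals of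
  the unscaled field. \<open>S_le\<close> keeps the bounds by \<open>\<rho>\<close> uniform in
  \<open>l\<close>, and \<open>S_lip\<close> gives continuity in \<open>l\<close>.\<close>

locale tonelli_scheme = caratheodory_field T N \<rho>
  for T :: real and N :: "real \<Rightarrow> 'a::euclidean_space \<Rightarrow> 'a" and \<rho> :: "real \<Rightarrow> real" +
  fixes S :: "real \<Rightarrow> 'a \<Rightarrow> 'a" and L :: real
  assumes L: "0 \<le> L" and lin: "\<And>l. linear (S l)"
    and S_le: "\<And>l v. l \<in> {0..1} \<Longrightarrow> norm (S l v) \<le> norm v"
    and S_lip: "\<And>l m v. l \<in> {0..1} \<Longrightarrow> m \<in> {0..1} \<Longrightarrow> norm (S l v - S m v) \<le> L * \<bar>l - m\<bar> * norm v"
begin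

text \<open>Picard iteration for the delayed integral equation. The maximum freezes the argument at
  time 0 as long as \<open>u \<le> \<delta>\<close>; there every iterate has the value
  \<open>s\<close>.\<close>

primrec iter :: "real \<Rightarrow> nat \<Rightarrow> real \<Rightarrow> 'a \<Rightarrow> real \<Rightarrow> 'a" where
  "iter \<delta> 0 l s t = s"
| "iter \<delta> (Suc i) l s t = s + S l (integral {0..t} (\<lambda>u. N u (iter \<delta> i l s (max 0 (u - \<delta>)))))"

lemma continuous_on_delay:
  fixes y :: "real \<Rightarrow> 'a"
  assumes "continuous_on {0..T} y" "0 \<le> \<delta>"
  shows "continuous_on {0..T} (\<lambda>u. y (max 0 (u - \<delta>)))"
  by (rule continuous_on_compose2[OF assms(1)]) (use assms(2) T in \<open>auto intro!: continuous_intros\<close>)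

lemma measurable_delay:
  fixes y :: "real \<Rightarrow> 'a"
  assumes "continuous_on {0..T} y" "0 \<le> \<delta>"
  shows "measurable_upto T (\<lambda>u. y (max 0 (u - \<delta>)))"
  by (rule continuous_on_imp_lebesgue_measurable[OF continuous_on_delay[OF assms]])

lemma continuous_on_S: "continuous_on A (S l)"
  by (rule linear_continuous_on) (simp add: lin linear_linear)

lemma continuous_on_iter: "0 \<le> \<delta> \<Longrightarrow> continuous_on {0..T} (iter \<delta> i l s)"
proof (induction i)
  case (Suc i)
  have "continuous_on {0..T} (\<lambda>t. integral {0..t} (\<lambda>u. N u (iter \<delta> i l s (max 0 (u - \<delta>)))))"
    by (intro indefinite_integral_continuous_1 integrable_composition measurable_delay Suc) auto
  then have "continuous_on {0..T} (\<lambda>t. s + S l (integral {0..t} (\<lambda>u. N u (iter \<delta> i l s (max 0 (u - \<delta>))))))"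
    by (intro continuous_on_add continuous_on_const continuous_on_compose2[OF continuous_on_S]) auto
  then show ?case by simp
qed simp

lemma measurable_iter: "0 \<le> \<delta> \<Longrightarrow> measurable_upto T (\<lambda>u. iter \<delta> i l s (max 0 (u - \<delta>)))"
  by (intro measurable_delay continuous_on_iter)

text \<open>The delayed equation determines the solution successively on intervals of length \<open>\<delta>\<close>, so that
  the iteration becomes stationary.\<close>

lemma iter_fixed:
  assumes "0 < \<delta>"
  shows "t \<in> {0..T} \<Longrightarrow> t \<le> real i * \<delta> \<Longrightarrow> iter \<delta> (Suc i) l s t = iter \<delta> i l s t"
proof (induction i arbitrary: t)
  case 0
  then show ?case by (simp add: linear_0[OF lin])
next
  case (Suc i)
  have "integral {0..t} (\<lambda>u. N u (iter \<delta> (Suc i) l s (max 0 (u - \<delta>))))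
      = integral {0..t} (\<lambda>u. N u (iter \<delta> i l s (max 0 (u - \<delta>))))"
  proof (rule hk_integral_cong)
    fix u assume u: "u \<in> {0..t}"
    have "iter \<delta> (Suc i) l s (max 0 (u - \<delta>)) = iter \<delta> i l s (max 0 (u - \<delta>))"
      by (rule Suc.IH) (use u Suc.prems assms in \<open>auto simp: algebra_simps\<close>)
    then show "N u (iter \<delta> (Suc i) l s (max 0 (u - \<delta>))) = N u (iter \<delta> i l s (max 0 (u - \<delta>)))" by simp
  qed
  then show ?case by (simp only: iter.simps(2))
qed

text \<open>Continuity of \<open>N t\<close> comes without a rate, so the statement only asserts
  some null sequence \<open>b\<close>. In the induction, uniform convergence of one iterate gives
  pointwise convergence of the integrands of the next, and dominated convergence over all of
  \<open>[0, T]\<close> returns a bound independent of \<open>t\<close>.\<close>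

lemma iter_uniform_limit:
  assumes \<delta>: "0 \<le> \<delta>" and l: "\<And>k. l k \<in> {0..1}" "l' \<in> {0..1}" "l \<longlonglongrightarrow> l'" and s: "s \<longlonglongrightarrow> s'"
  shows "\<exists>b. b \<longlonglongrightarrow> 0 \<and> (\<forall>k. \<forall>t\<in>{0..T}. norm (iter \<delta> i (l k) (s k) t - iter \<delta> i l' s' t) \<le> b k)"
proof (induction i)
  case 0
  show ?case using LIM_zero[OF s] by (intro exI[of _ "\<lambda>k. norm (s k - s')"]) (auto intro: tendsto_norm_zero)
next
  case (Suc i)
  then obtain b where b: "b \<longlonglongrightarrow> 0" "\<And>k t. t \<in> {0..T} \<Longrightarrow> norm (iter \<delta> i (l k) (s k) t - iter \<delta> i l' s' t) \<le> b k"
    by blast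
  let ?y = "\<lambda>k u. iter \<delta> i (l k) (s k) (max 0 (u - \<delta>))" and ?z = "\<lambda>u. iter \<delta> i l' s' (max 0 (u - \<delta>))"
  define c where "c = (\<lambda>k. integral {0..T} (\<lambda>u. norm (N u (?y k u) - N u (?z u))))"
  have "(\<lambda>k. ?y k u) \<longlonglongrightarrow> ?z u" if "u \<in> {0..T}" for u
  proof (rule LIM_zero_cancel, rule Lim_null_comparison[OF _ b(1)])
    show "\<forall>\<^sub>F k in sequentially. norm (?y k u - ?z u) \<le> b k"
      using that \<delta> T by (intro always_eventually allI b(2)) auto
  qed
  then have c: "c \<longlonglongrightarrow> 0"
    unfolding c_def by (intro integral_norm_diff_tendsto_0 measurable_iter \<delta>)
  define d where "d = (\<lambda>k. norm (s k - s') + c k + L * \<bar>l k - l'\<bar> * integral {0..T} \<rho>)"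
  have "d \<longlonglongrightarrow> 0 + 0 + L * \<bar>0\<bar> * integral {0..T} \<rho>"
    unfolding d_def by (intro tendsto_intros c tendsto_norm_zero LIM_zero s l)
  moreover have "norm (iter \<delta> (Suc i) (l k) (s k) t - iter \<delta> (Suc i) l' s' t) \<le> d k" if t: "t \<in> {0..T}" for k t
  proof -
    let ?v = "integral {0..t} (\<lambda>u. N u (?y k u))" and ?w = "integral {0..t} (\<lambda>u. N u (?z u))"
    have "norm (?v - ?w) \<le> c k"
      unfolding c_def by (intro norm_integral_diff_le measurable_iter \<delta> t)
    then have 1: "norm (S (l k) (?v - ?w)) \<le> c k" using S_le[OF l(1)] order_trans by blast
    have w: "norm ?w \<le> integral {0..T} \<rho>"
    proof -
      have "norm ?w \<le> integral {0..t} \<rho>"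
        by (rule norm_integral_composition_le[OF measurable_iter[OF \<delta>]]) (use t in auto)
      also have "\<dots> \<le> integral {0..T} \<rho>"
        using t \<rho>_nonneg by (intro integral_subset_le \<rho>_integrable) auto
      finally show ?thesis .
    qed
    have 2: "norm (S (l k) ?w - S l' ?w) \<le> L * \<bar>l k - l'\<bar> * integral {0..T} \<rho>"
      using order_trans[OF S_lip[OF l(1) l(2)] mult_left_mono[OF w]] L by simp
    have "iter \<delta> (Suc i) (l k) (s k) t - iter \<delta> (Suc i) l' s' t
       = (s k - s') + S (l k) (?v - ?w) + (S (l k) ?w - S l' ?w)"
      by (simp add: linear_diff[OF lin])
    then have "norm (iter \<delta> (Suc i) (l k) (s k) t - iter \<delta> (Suc i) l' s' t)
       \<le> norm (s k - s') + norm (S (l k) (?v - ?w)) + norm (S (l k) ?w - S l' ?w)"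
      by (simp only:) (intro norm_triangle_le[OF add_mono] norm_triangle_ineq order_refl)
    then show ?thesis using 1 2 by (simp add: d_def)
  qed
  ultimately show ?case by (intro exI[of _ d]) simp
qed

end

section \<open>Shrinking delays and passage to the limit\<close>

context tonelli_scheme
begin

definition delay :: "nat \<Rightarrow> real" where "delay k = T / real (Suc k)"

text \<open>\<open>Suc k\<close> steps of length \<open>delay k\<close> cover \<open>[0, T]\<close>
  exactly, so this iterate is already a fixed point there.\<close>

definition sol :: "nat \<Rightarrow> real \<Rightarrow> 'a \<Rightarrow> real \<Rightarrow> 'a" where
  "sol k l s = iter (delay k) (Suc k) l s"

text \<open>Up to the factor \<open>1 / T\<close> this is the map whose degree is studied. By
  \<open>sol_eq\<close> the displacement \<open>sol k l s T - s\<close> is the image of this vector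
  under \<open>S l\<close>.\<close>

definition defect :: "nat \<Rightarrow> real \<Rightarrow> 'a \<Rightarrow> 'a" where
  "defect k l s = integral {0..T} (\<lambda>u. N u (sol k l s (max 0 (u - delay k))))"

lemma delay_pos: "0 < delay k"
  using T by (simp add: delay_def)

lemma delay_nonneg: "0 \<le> delay k"
  using delay_pos[of k] by simp

lemma delay_tendsto_0: "delay \<longlonglongrightarrow> 0"
proof -
  have "(\<lambda>k. T * inverse (real (Suc k))) \<longlonglongrightarrow> T * 0"
    by (intro tendsto_mult tendsto_const LIMSEQ_inverse_real_of_nat)
  then show ?thesis by (simp add: delay_def[abs_def] divide_inverse)
qed

lemma sol_eq:
  assumes "t \<in> {0..T}"
  shows "sol k l s t = s + S l (integral {0..t} (\<lambda>u. N u (sol k l s (max 0 (u - delay k)))))"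
proof -
  have "real (Suc k) * delay k = T" by (simp add: delay_def)
  then have "iter (delay k) (Suc (Suc k)) l s t = iter (delay k) (Suc k) l s t"
    using assms by (intro iter_fixed delay_pos) auto
  then show ?thesis unfolding sol_def by (simp only: iter.simps(2)[of _ "Suc k"])
qed

lemma sol_0: "sol k l s 0 = s"
  using sol_eq[of 0] T by (simp add: linear_0[OF lin])

lemma continuous_on_sol: "continuous_on {0..T} (sol k l s)"
  unfolding sol_def by (rule continuous_on_iter[OF delay_nonneg])

lemma measurable_sol: "measurable_upto T (\<lambda>u. sol k l s (max 0 (u - delay k)))"
  unfolding sol_def by (rule measurable_iter[OF delay_nonneg])

lemma sol_uniform_limit:
  assumes "\<And>n. l n \<in> {0..1}" "l' \<in> {0..1}" "l \<longlonglongrightarrow> l'" "s \<longlonglongrightarrow> s'"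
  shows "\<exists>b. b \<longlonglongrightarrow> 0 \<and> (\<forall>n. \<forall>t\<in>{0..T}. norm (sol k (l n) (s n) t - sol k l' s' t) \<le> b n)"
  unfolding sol_def by (rule iter_uniform_limit[OF delay_nonneg assms])

lemma sol_uniformly_continuous_dependence:
  assumes l': "l' \<in> {0..1}" and e: "0 < e"
  shows "\<exists>d>0. \<forall>l\<in>{0..1}. \<forall>s. dist (l, s) (l', s') < d \<longrightarrow>
     (\<forall>t\<in>{0..T}. norm (sol k l s t - sol k l' s' t) \<le> e)"
proof (rule ccontr)
  assume "\<not> ?thesis"
  then have "\<forall>n. \<exists>p. fst p \<in> {0..1} \<and> dist p (l', s') < inverse (real (Suc n)) \<and>
      \<not> (\<forall>t\<in>{0..T}. norm (sol k (fst p) (snd p) t - sol k l' s' t) \<le> e)"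
    by (metis fst_conv snd_conv inverse_positive_iff_positive of_nat_0_less_iff zero_less_Suc)
  then obtain p where p: "\<And>n. fst (p n) \<in> {0..1}" "\<And>n. dist (p n) (l', s') < inverse (real (Suc n))"
    "\<And>n. \<not> (\<forall>t\<in>{0..T}. norm (sol k (fst (p n)) (snd (p n)) t - sol k l' s' t) \<le> e)"
    by metis
  have "(\<lambda>n. dist (p n) (l', s')) \<longlonglongrightarrow> 0"
  proof (rule Lim_null_comparison[OF always_eventually LIMSEQ_inverse_real_of_nat], rule allI)
    show "norm (dist (p n) (l', s')) \<le> inverse (real (Suc n))" for n
      using less_imp_le[OF p(2)[of n]] by (simp only: real_norm_def abs_of_nonneg zero_le_dist)
  qed
  then have lim: "p \<longlonglongrightarrow> (l', s')" by (rule iffD2[OF tendsto_dist_iff])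
  obtain b where b: "b \<longlonglongrightarrow> 0" "\<And>n t. t \<in> {0..T} \<Longrightarrow> norm (sol k (fst (p n)) (snd (p n)) t - sol k l' s' t) \<le> b n"
    using sol_uniform_limit[of "\<lambda>n. fst (p n)" l' "\<lambda>n. snd (p n)" s' k] p(1) l' tendsto_fst[OF lim] tendsto_snd[OF lim]
    by auto
  obtain n where "b n < e"
    using order_tendstoD(2)[OF b(1) e] by (metis eventually_sequentially order_refl)
  then have "norm (sol k (fst (p n)) (snd (p n)) t - sol k l' s' t) \<le> e" if "t \<in> {0..T}" for t
    using b(2)[OF that, of n] by linarith
  then show False using p(3)[of n] by blast
qed

lemma continuous_on_defect: "continuous_on ({0..1} \<times> UNIV) (\<lambda>(l, s). defect k l s)"
  unfolding continuous_on_sequentially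
proof (intro allI ballI impI, elim conjE)
  fix p :: "nat \<Rightarrow> real \<times> 'a" and q
  assume q: "q \<in> {0..1} \<times> UNIV" and p: "\<forall>n. p n \<in> {0..1} \<times> UNIV" and lim: "p \<longlonglongrightarrow> q"
  obtain b where b: "b \<longlonglongrightarrow> 0" "\<And>n t. t \<in> {0..T} \<Longrightarrow> norm (sol k (fst (p n)) (snd (p n)) t - sol k (fst q) (snd q) t) \<le> b n"
    using sol_uniform_limit[of "\<lambda>n. fst (p n)" "fst q" "\<lambda>n. snd (p n)" "snd q" k] p q tendsto_fst[OF lim] tendsto_snd[OF lim]
    by (auto simp: mem_Times_iff)
  have "(\<lambda>n. defect k (fst (p n)) (snd (p n))) \<longlonglongrightarrow> defect k (fst q) (snd q)"
    unfolding defect_def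
  proof (rule integral_composition_tendsto[OF measurable_sol measurable_sol])
    fix u assume u: "u \<in> {0..T}"
    show "(\<lambda>n. sol k (fst (p n)) (snd (p n)) (max 0 (u - delay k))) \<longlonglongrightarrow> sol k (fst q) (snd q) (max 0 (u - delay k))"
      by (rule LIM_zero_cancel, rule Lim_null_comparison[OF _ b(1)], rule always_eventually, rule allI, rule b(2))
         (use u T delay_nonneg[of k] in auto)
  qed (use T in simp)
  then show "((\<lambda>(l, s). defect k l s) \<circ> p) \<longlonglongrightarrow> (case q of (l, s) \<Rightarrow> defect k l s)"
    by (simp add: o_def split_beta)
qed

lemma norm_sol_diff_le:
  assumes l: "l \<in> {0..1}" and t: "0 \<le> t" "t \<le> t'" "t' \<le> T"
  shows "norm (sol k l s t' - sol k l s t) \<le> integral {t..t'} \<rho>"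
proof -
  let ?f = "\<lambda>u. N u (sol k l s (max 0 (u - delay k)))"
  have "integral {0..t} ?f + integral {t..t'} ?f = integral {0..t'} ?f"
    using t by (intro hk_integral_combine integrable_composition measurable_sol) auto
  then have eq: "integral {0..t'} ?f - integral {0..t} ?f = integral {t..t'} ?f" by (simp add: algebra_simps)
  have "sol k l s t' - sol k l s t = S l (integral {0..t'} ?f - integral {0..t} ?f)"
    using sol_eq[of t k l s] sol_eq[of t' k l s] t by (simp add: linear_diff[OF lin])
  then have "norm (sol k l s t' - sol k l s t) \<le> norm (integral {t..t'} ?f)"
    using S_le[OF l] eq by simp
  also have "\<dots> \<le> integral {t..t'} \<rho>"
    by (rule norm_integral_composition_le[OF measurable_sol]) (use t in auto)
  finally show ?thesis .
qed

text \<open>The indefinite integral of \<open>\<rho>\<close> gives one modulus of continuity for all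
  \<open>k\<close>, \<open>l\<close> and \<open>s\<close>: the equicontinuity for
  Arzela-Ascoli.\<close>

lemma norm_sol_diff_le':
  assumes l: "l \<in> {0..1}" and t: "t \<in> {0..T}" "t' \<in> {0..T}"
  shows "norm (sol k l s t' - sol k l s t) \<le> \<bar>integral {0..t'} \<rho> - integral {0..t} \<rho>\<bar>"
proof -
  have *: "norm (sol k l s b - sol k l s a) \<le> \<bar>integral {0..b} \<rho> - integral {0..a} \<rho>\<bar>"
    if "a \<le> b" "0 \<le> a" "b \<le> T" for a b
  proof -
    have "integral {0..a} \<rho> + integral {a..b} \<rho> = integral {0..b} \<rho>"
      using that by (intro hk_integral_combine \<rho>_integrable) auto
    then show ?thesis using norm_sol_diff_le[OF l that(2,1,3), of k s] by simp
  qed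
  show ?thesis
    using *[of t t'] *[of t' t] t by (cases "t \<le> t'") (auto simp: norm_minus_commute abs_minus_commute)
qed

text \<open>Two successive subsequences are taken, one for the parameters by compactness of
  \<open>[0, 1]\<close> and one for the trajectories. As the delays vanish, the limit satisfies the
  undelayed equation and inherits the vanishing integral over the period.\<close>

lemma tonelli_limit:
  assumes l: "\<And>k. l k \<in> {0..1}" and s: "\<And>k. norm (s k) \<le> R" and G0: "\<And>k. defect k (l k) (s k) = 0"
  obtains r l' x where "strict_mono (r :: nat \<Rightarrow> nat)" "l' \<in> {0..1}" "(\<lambda>k. l (r k)) \<longlonglongrightarrow> l'"
    "continuous_on {0..T} x"
    "\<And>e. 0 < e \<Longrightarrow> \<exists>K. \<forall>k\<ge>K. \<forall>t\<in>{0..T}. norm (sol (r k) (l (r k)) (s (r k)) t - x t) < e"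
    "\<And>t. t \<in> {0..T} \<Longrightarrow> x t = x 0 + S l' (field_integral N x t)"
    "field_integral N x T = 0"
proof -
  obtain l' r1 where r1: "l' \<in> {0..1}" "strict_mono (r1 :: nat \<Rightarrow> nat)" "(l \<circ> r1) \<longlonglongrightarrow> l'"
    using compact_Icc[of "0::real" 1] l unfolding compact_def by blast
  define F where "F = (\<lambda>k. sol (r1 k) (l (r1 k)) (s (r1 k)))"
  have P: "continuous_on {0..T} (\<lambda>t. integral {0..t} \<rho>)"
    by (rule indefinite_integral_continuous_1[OF \<rho>_int])
  obtain x r2 where x: "continuous_on {0..T} x" "strict_mono (r2 :: nat \<Rightarrow> nat)"
    "\<And>e. 0 < e \<Longrightarrow> \<exists>K. \<forall>n t. n \<ge> K \<and> t \<in> {0..T} \<longrightarrow> norm (F (r2 n) t - x t) < e"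
  proof (rule Arzela_Ascoli[of "{0..T}" F "R + integral {0..T} \<rho>"])
    fix n t assume t: "t \<in> {0..T}"
    have "norm (F n t - F n 0) \<le> integral {0..t} \<rho>"
      unfolding F_def by (rule norm_sol_diff_le[OF l]) (use t in auto)
    also have "\<dots> \<le> integral {0..T} \<rho>"
      using t \<rho>_nonneg by (intro integral_subset_le \<rho>_integrable) auto
    finally show "norm (F n t) \<le> R + integral {0..T} \<rho>"
      using norm_triangle_sub[of "F n t" "F n 0"] s[of "r1 n"] by (simp add: F_def sol_0)
  next
    fix t e assume t: "t \<in> {0..T}" and e: "0 < (e::real)"
    obtain d where d: "d > 0" "\<And>y. y \<in> {0..T} \<Longrightarrow> dist y t < d \<Longrightarrow> dist (integral {0..y} \<rho>) (integral {0..t} \<rho>) < e"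
      using P t e unfolding continuous_on_iff by meson
    have "norm (F n t - F n y) < e" if "y \<in> {0..T}" "norm (t - y) < d" for n y
      using norm_sol_diff_le'[OF l[of "r1 n"] that(1) t, of "r1 n" "s (r1 n)"] d(2)[of y] that
      by (simp add: F_def dist_real_def abs_minus_commute)
    then show "\<exists>d. 0 < d \<and> (\<forall>n y. y \<in> {0..T} \<and> norm (t - y) < d \<longrightarrow> norm (F n t - F n y) < e)"
      using d(1) by blast
  qed (auto intro: that)
  define r where "r = r1 \<circ> r2"
  have r: "strict_mono r" unfolding r_def by (rule strict_mono_o[OF r1(2) x(2)])
  have lr: "(\<lambda>k. l (r k)) \<longlonglongrightarrow> l'"
    using LIMSEQ_subseq_LIMSEQ[OF r1(3) x(2)] by (simp add: r_def o_def)
  define Y where "Y = (\<lambda>k. sol (r k) (l (r k)) (s (r k)))"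
  have unif: "\<exists>K. \<forall>k\<ge>K. \<forall>t\<in>{0..T}. norm (Y k t - x t) < e" if "0 < e" for e
  proof -
    obtain K where "\<forall>n t. n \<ge> K \<and> t \<in> {0..T} \<longrightarrow> norm (F (r2 n) t - x t) < e"
      using x(3)[OF \<open>0 < e\<close>] by blast
    then show ?thesis unfolding F_def Y_def r_def o_def by (intro exI[of _ K]) blast
  qed
  have ptw: "(\<lambda>k. Y k t) \<longlonglongrightarrow> x t" if "t \<in> {0..T}" for t
    unfolding lim_sequentially dist_norm using unif that by blast
  \<comment> \<open>The point of evaluation moves with \<open>k\<close>: uniform convergence
    controls \<open>Y k - x\<close> there, and continuity of \<open>x\<close> controls the
    rest.\<close>
  have delayed: "(\<lambda>k. Y k (max 0 (u - delay (r k)))) \<longlonglongrightarrow> x u" if u: "u \<in> {0..T}" for u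
  proof -
    let ?q = "\<lambda>k. max 0 (u - delay (r k))"
    have q01: "?q k \<in> {0..T}" for k using u T delay_nonneg[of "r k"] by auto
    have "(\<lambda>k. delay (r k)) \<longlonglongrightarrow> 0"
      using LIMSEQ_subseq_LIMSEQ[OF delay_tendsto_0 r] by (simp add: o_def)
    then have "?q \<longlonglongrightarrow> max 0 (u - 0)" by (intro tendsto_intros)
    then have q: "?q \<longlonglongrightarrow> u" using u by simp
    have 1: "(\<lambda>k. x (?q k)) \<longlonglongrightarrow> x u"
      by (rule continuous_on_tendsto_compose[OF x(1) q u]) (use q01 in simp)
    have 2: "(\<lambda>k. Y k (?q k) - x (?q k)) \<longlonglongrightarrow> 0"
      unfolding lim_sequentially dist_norm diff_0_right
    proof (intro allI impI)
      fix e :: real assume "0 < e"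
      from unif[OF this] obtain K where "\<forall>k\<ge>K. \<forall>t\<in>{0..T}. norm (Y k t - x t) < e" by blast
      then show "\<exists>K. \<forall>k\<ge>K. norm (Y k (?q k) - x (?q k)) < e" using q01 by blast
    qed
    show ?thesis using tendsto_add[OF 2 1] by simp
  qed
  have mx: "measurable_upto T x"
    by (rule continuous_on_imp_lebesgue_measurable[OF x(1)])
  have mY: "measurable_upto T (\<lambda>u. Y k (max 0 (u - delay (r k))))" for k
    unfolding Y_def by (rule measurable_sol)
  have I: "(\<lambda>k. integral {0..t} (\<lambda>u. N u (Y k (max 0 (u - delay (r k)))))) \<longlonglongrightarrow> field_integral N x t"
    if "t \<in> {0..T}" for t
    by (rule integral_composition_tendsto[OF mY mx delayed that])
  have "x t = x 0 + S l' (field_integral N x t)" if t: "t \<in> {0..T}" for t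
  proof -
    let ?v = "\<lambda>k. integral {0..t} (\<lambda>u. N u (Y k (max 0 (u - delay (r k)))))"
    let ?w = "field_integral N x t"
    have "(\<lambda>k. S (l (r k)) (?v k - ?w)) \<longlonglongrightarrow> 0"
      by (rule Lim_null_comparison[OF _ tendsto_norm_zero[OF LIM_zero[OF I[OF t]]]])
         (intro always_eventually allI S_le l)
    moreover have "(\<lambda>k. S (l (r k)) ?w - S l' ?w) \<longlonglongrightarrow> 0"
    proof (rule Lim_null_comparison)
      show "\<forall>\<^sub>F k in sequentially. norm (S (l (r k)) ?w - S l' ?w) \<le> L * \<bar>l (r k) - l'\<bar> * norm ?w"
        by (intro always_eventually allI S_lip l r1(1))
      have "(\<lambda>k. L * \<bar>l (r k) - l'\<bar> * norm ?w) \<longlonglongrightarrow> L * \<bar>l' - l'\<bar> * norm ?w"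
        by (intro tendsto_intros lr)
      then show "(\<lambda>k. L * \<bar>l (r k) - l'\<bar> * norm ?w) \<longlonglongrightarrow> 0" by simp
    qed
    ultimately have "(\<lambda>k. S (l (r k)) (?v k - ?w) + (S (l (r k)) ?w - S l' ?w)) \<longlonglongrightarrow> 0 + 0"
      by (rule tendsto_add)
    then have "(\<lambda>k. S (l (r k)) (?v k) - S l' ?w) \<longlonglongrightarrow> 0"
      by (simp add: linear_diff[OF lin])
    then have Sv: "(\<lambda>k. S (l (r k)) (?v k)) \<longlonglongrightarrow> S l' ?w" by (rule LIM_zero_cancel)
    have "Y k t = Y k 0 + S (l (r k)) (?v k)" for k
      unfolding Y_def sol_0 by (rule sol_eq[OF t])
    moreover have "(\<lambda>k. Y k 0 + S (l (r k)) (?v k)) \<longlonglongrightarrow> x 0 + S l' ?w"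
      by (rule tendsto_add[OF ptw Sv]) (use T in simp)
    ultimately have "(\<lambda>k. Y k t) \<longlonglongrightarrow> x 0 + S l' ?w" by simp
    then show ?thesis using LIMSEQ_unique ptw[OF t] by blast
  qed
  moreover have "field_integral N x T = 0"
  proof -
    have "integral {0..T} (\<lambda>u. N u (Y k (max 0 (u - delay (r k))))) = 0" for k
      using G0[of "r k"] by (simp add: defect_def Y_def)
    then show ?thesis using I[of T] T LIMSEQ_unique[OF tendsto_const] by fastforce
  qed
  ultimately show ?thesis
    by (intro that[OF r r1(1) lr x(1)] unif[unfolded Y_def])
qed

end

section \<open>Cyclic systems\<close>

lemma mspace_C_space:
  assumes "0 < T"
  shows "f \<in> mspace (C_space T) \<longleftrightarrow> f \<in> extensional {0..T} \<and> continuous_on {0..T} f"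
proof -
  have "compactin (top_of_set {0..T}) (topspace (top_of_set {0..T}))"
    by (simp add: compactin_subtopology)
  from compactin_mspace_cfunspace[OF this, of euclidean_metric] show ?thesis
    by (auto simp: C_space_def mtopology_of_euclidean)
qed

lemma mdist_C_space_le:
  assumes "0 < T" "f \<in> mspace (C_space T)" "g \<in> mspace (C_space T)"
  shows "mdist (C_space T) f g \<le> a \<longleftrightarrow> (\<forall>t\<in>{0..T}. dist (f t) (g t) \<le> a)"
  using cfunspace_mdist_le[of f "top_of_set {0..T}" euclidean_metric g a] assms
  by (simp add: C_space_def)

lemma openin_C_spaceD:
  assumes "0 < T" "openin (mtopology_of (C_space T)) \<Omega>" "x \<in> \<Omega>"
  obtains e where "0 < e" "\<And>y. y \<in> mspace (C_space T) \<Longrightarrow> (\<forall>t\<in>{0..T}. dist (x t) (y t) \<le> e) \<Longrightarrow> y \<in> \<Omega>"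
proof -
  interpret M: Metric_space "mspace (C_space T)" "mdist (C_space T) :: (real \<Rightarrow> 'a) \<Rightarrow> _" by simp
  obtain r where r: "r > 0" "M.mball x r \<subseteq> \<Omega>" "\<Omega> \<subseteq> mspace (C_space T)"
    using assms(2,3) unfolding mtopology_of_def M.openin_mtopology by blast
  show ?thesis
  proof (rule that)
    \<comment> \<open>A pointwise bound by \<open>r / 2\<close> gives a sup-distance of at most
      \<open>r / 2\<close>, which restores the strict inequality of the ball.\<close>
    show "0 < r / 2" using r by simp
    fix y assume y: "y \<in> mspace (C_space T)" "\<forall>t\<in>{0..T}. dist (x t) (y t) \<le> r / 2"
    then have "mdist (C_space T) x y \<le> r / 2"
      using mdist_C_space_le[OF assms(1)] r(3) assms(3) by blast
    then have "mdist (C_space T) x y < r" using r(1) by simp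
    then have "y \<in> M.mball x r" using r(3) y(1) assms(3) by (auto simp: M.in_mball)
    then show "y \<in> \<Omega>" using r(2) by blast
  qed
qed

lemma closure_of_C_space:
  assumes "0 < T" "\<Omega> \<subseteq> mspace (C_space T)"
  shows "x \<in> mtopology_of (C_space T) closure_of \<Omega> \<longleftrightarrow>
     x \<in> mspace (C_space T) \<and> (\<forall>e>0. \<exists>y\<in>\<Omega>. \<forall>t\<in>{0..T}. dist (x t) (y t) \<le> e)"
proof -
  interpret M: Metric_space "mspace (C_space T)" "mdist (C_space T) :: (real \<Rightarrow> 'a) \<Rightarrow> _" by simp
  have "(\<forall>r>0. \<exists>y\<in>\<Omega>. y \<in> M.mball x r) \<longleftrightarrow> (\<forall>e>0. \<exists>y\<in>\<Omega>. \<forall>t\<in>{0..T}. dist (x t) (y t) \<le> e)"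
    if x: "x \<in> mspace (C_space T)"
  proof (intro iffI allI impI)
    fix e :: real assume "\<forall>r>0. \<exists>y\<in>\<Omega>. y \<in> M.mball x r" "0 < e"
    then obtain y where "y \<in> \<Omega>" "mdist (C_space T) x y \<le> e" by fastforce
    then show "\<exists>y\<in>\<Omega>. \<forall>t\<in>{0..T}. dist (x t) (y t) \<le> e"
      using mdist_C_space_le[OF assms(1) x] assms(2) by blast
  next
    fix r :: real assume H: "\<forall>e>0. \<exists>y\<in>\<Omega>. \<forall>t\<in>{0..T}. dist (x t) (y t) \<le> e" and r: "0 < r"
    obtain y where y: "y \<in> \<Omega>" "\<forall>t\<in>{0..T}. dist (x t) (y t) \<le> r / 2"
      using H r by (meson half_gt_zero)
    then have "mdist (C_space T) x y \<le> r / 2"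
      using mdist_C_space_le[OF assms(1) x] assms(2) by blast
    then show "\<exists>y\<in>\<Omega>. y \<in> M.mball x r" using y r x assms(2) by (intro bexI[of _ y]) auto
  qed
  then show ?thesis unfolding mtopology_of_def M.metric_closure_of by auto
qed

lemma frontier_of_openin_C_space:
  "openin (mtopology_of (C_space T)) \<Omega> \<Longrightarrow>
     mtopology_of (C_space T) frontier_of \<Omega> = mtopology_of (C_space T) closure_of \<Omega> - \<Omega>"
  by (simp add: frontier_of_def interior_of_openin)

lemma bounded_C_space:
  fixes \<Omega> :: "(real \<Rightarrow> 'a::euclidean_space) set"
  assumes "0 < T" "Metric_space.mbounded (mspace (C_space T)) (mdist (C_space T)) \<Omega>"
  obtains R where "0 < R" "\<And>x t. x \<in> \<Omega> \<Longrightarrow> t \<in> {0..T} \<Longrightarrow> norm (x t) \<le> R"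
proof -
  interpret M: Metric_space "mspace (C_space T)" "mdist (C_space T) :: (real \<Rightarrow> 'a) \<Rightarrow> _" by simp
  obtain c B where B: "\<Omega> \<subseteq> M.mcball c B" using assms(2) unfolding M.mbounded_def by blast
  show ?thesis
  proof (cases "\<Omega> = {}")
    case False
    then have c: "c \<in> mspace (C_space T)" using B by auto
    then have "compact (c ` {0..T})"
      using mspace_C_space[OF assms(1)] by (intro compact_continuous_image) auto
    then obtain K where K: "\<And>t. t \<in> {0..T} \<Longrightarrow> norm (c t) \<le> K"
      using compact_imp_bounded bounded_iff by (metis imageI)
    show ?thesis
    proof (rule that[of "max 1 (K + B)"])
      fix x t assume x: "x \<in> \<Omega>" and t: "t \<in> {0..T}"
      then have "x \<in> mspace (C_space T)" "mdist (C_space T) c x \<le> B" using B by auto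
      then have "dist (c t) (x t) \<le> B" using mdist_C_space_le[OF assms(1) c] t by blast
      then have "norm (x t) \<le> norm (c t) + B"
        using norm_triangle_sub[of "x t" "c t"] by (simp add: dist_norm norm_minus_commute)
      then show "norm (x t) \<le> max 1 (K + B)" using K[OF t] by simp
    qed simp
  qed (auto intro: that[of 1])
qed

lemma AE_lebesgue_on_iff_negligible:
  assumes "S \<in> sets lebesgue"
  shows "(AE x in lebesgue_on S. P x) \<longleftrightarrow> (\<exists>Z. negligible Z \<and> (\<forall>x\<in>S - Z. P x))"
proof -
  have "(AE x in lebesgue_on S. P x) \<longleftrightarrow> (AE x in lebesgue. x \<in> S \<longrightarrow> P x)"
    using assms by (simp add: AE_restrict_space_iff)
  also have "\<dots> \<longleftrightarrow> (\<exists>Z. negligible Z \<and> (\<forall>x\<in>S - Z. P x))"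
    unfolding eventually_ae_filter negligible_iff_null_sets by auto
  finally show ?thesis .
qed

section \<open>Blocks of coordinates and the scaling path\<close>

lemma block_nth: "block v i $ j = v $ (i, j)"
  by (simp add: block_def)

lemma vec_eq_iff_block: "v = w \<longleftrightarrow> (\<forall>i. block v i = block w i)"
  by (auto simp: vec_eq_iff block_nth)

lemma block_of_blocks [simp]: "block (of_blocks u) i = u i"
  by (simp add: vec_eq_iff block_nth of_blocks_def)

lemma block_cyclic_field:
  "block (cyclic_field g w s) i = (if i = Max UNIV then w else g i (block s (next_index i)))"
  by (simp add: cyclic_field_def)

lemma norm_block_le: "norm (block v i) \<le> norm v"
proof -
  have "(norm (block v i))\<^sup>2 = (\<Sum>j\<in>UNIV. (v $ (i, j))\<^sup>2)"
    unfolding power2_norm_eq_inner by (simp add: inner_vec_def block_nth power2_eq_square)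
  also have "\<dots> = (\<Sum>p\<in>Pair i ` UNIV. (v $ p)\<^sup>2)"
    by (subst sum.reindex) (auto simp: inj_on_def)
  also have "\<dots> \<le> (\<Sum>p\<in>UNIV. (v $ p)\<^sup>2)"
    by (rule sum_mono2) auto
  also have "\<dots> = (norm v)\<^sup>2"
    unfolding power2_norm_eq_inner by (simp add: inner_vec_def power2_eq_square)
  finally show ?thesis by (rule power2_le_imp_le) simp
qed

lemma bounded_linear_block: "bounded_linear (\<lambda>v. block v i)"
  by (rule bounded_linear_intro[where K = 1]) (simp_all add: vec_eq_iff block_nth norm_block_le)

lemma less_Max_UNIV_iff: "i < Max UNIV \<longleftrightarrow> i \<noteq> Max (UNIV :: 'n::{finite,linorder} set)"
  by (simp add: order.strict_iff_order)

lemma less_next_index: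
  fixes i :: "'n::{finite,linorder}"
  assumes "i \<noteq> Max UNIV"
  shows "i < next_index i"
proof -
  have "i < Max UNIV" using assms by (simp add: less_Max_UNIV_iff)
  then have "Min {j. i < j} \<in> {j. i < j}" by (intro Min_in) auto
  then show ?thesis by (simp add: next_index_def)
qed

text \<open>Equation \<open>i\<close> involves block \<open>i + 1\<close>, so facts about solutions
  propagate from the last block to the first; the number of larger indices is the measure.\<close>

lemma index_induct_from_Max [case_names Max step]:
  fixes i :: "'n::{finite,linorder}"
  assumes "P (Max UNIV)" "\<And>i. i \<noteq> Max UNIV \<Longrightarrow> P (next_index i) \<Longrightarrow> P i"
  shows "P i"
proof (induction "card {j. i < j}" arbitrary: i rule: less_induct)
  case less
  show ?case
  proof (cases "i = Max UNIV")
    case False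
    then have "{j. next_index i < j} \<subset> {j. i < j}"
      using less_next_index[OF False] by (auto dest: order.strict_trans)
    then have "card {j. next_index i < j} < card {j. i < j}" by (intro psubset_card_mono) auto
    then show ?thesis using less assms(2)[OF False] by blast
  qed (use assms(1) in simp)
qed

text \<open>The path \<open>l \<mapsto> (min 1 (2 l), max 0 (2 l - 1))\<close> first switches on the equations for the blocks
  \<open>i < n\<close> and then the equation for the block \<open>n\<close>.\<close>

definition scale_blocks :: "real \<Rightarrow> real^('n::{finite,linorder} \<times> 'm::finite) \<Rightarrow> real^('n \<times> 'm)" where
  "scale_blocks l v =
     (\<chi> p. (if fst p = Max UNIV then max 0 (2 * l - 1) else min 1 (2 * l)) * v $ p)"

lemma block_scale_blocks:
  "block (scale_blocks l v) i = (if i = Max UNIV then max 0 (2 * l - 1) else min 1 (2 * l)) *\<^sub>R block v i"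
  by (simp add: vec_eq_iff block_nth scale_blocks_def)

lemma linear_scale_blocks: "linear (scale_blocks l)"
  by (rule linearI) (simp_all add: vec_eq_iff scale_blocks_def algebra_simps)

lemma norm_scale_blocks_le:
  fixes v :: "real^('n::{finite,linorder} \<times> 'm::finite)"
  assumes "l \<in> {0..1}"
  shows "norm (scale_blocks l v) \<le> norm v"
proof (rule norm_le_componentwise_cart)
  fix p :: "'n \<times> 'm"
  have "\<bar>if fst p = Max UNIV then max 0 (2 * l - 1) else min 1 (2 * l)\<bar> \<le> 1"
    using assms by auto
  then have "\<bar>if fst p = Max UNIV then max 0 (2 * l - 1) else min 1 (2 * l)\<bar> * \<bar>v $ p\<bar> \<le> 1 * \<bar>v $ p\<bar>"
    by (rule mult_right_mono) simp
  then show "norm (scale_blocks l v $ p) \<le> norm (v $ p)"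
    by (simp only: scale_blocks_def vec_lambda_beta real_norm_def abs_mult mult_1)
qed

text \<open>The factor 2 is the largest slope of the two components of the path.\<close>

lemma norm_scale_blocks_diff_le:
  fixes v :: "real^('n::{finite,linorder} \<times> 'm::finite)"
  shows "norm (scale_blocks l v - scale_blocks m v) \<le> 2 * \<bar>l - m\<bar> * norm v"
proof -
  have "norm (scale_blocks l v - scale_blocks m v) \<le> norm ((2 * \<bar>l - m\<bar>) *\<^sub>R v)"
  proof (rule norm_le_componentwise_cart)
    fix p :: "'n \<times> 'm"
    let ?c = "\<lambda>l. if fst p = Max UNIV then max 0 (2 * l - 1) else min 1 (2 * l :: real)"
    have "\<bar>max 0 (2 * l - 1) - max 0 (2 * m - 1)\<bar> \<le> 2 * \<bar>l - m\<bar>"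
      unfolding max_def abs_if by (simp split: if_split)
    moreover have "\<bar>min 1 (2 * l) - min 1 (2 * m)\<bar> \<le> 2 * \<bar>l - m\<bar>"
      unfolding min_def abs_if by (simp split: if_split)
    ultimately have "\<bar>?c l - ?c m\<bar> \<le> 2 * \<bar>l - m\<bar>" by simp
    then have "\<bar>?c l - ?c m\<bar> * \<bar>v $ p\<bar> \<le> 2 * \<bar>l - m\<bar> * \<bar>v $ p\<bar>"
      by (rule mult_right_mono) simp
    moreover have "(scale_blocks l v - scale_blocks m v) $ p = (?c l - ?c m) * v $ p"
      by (simp only: scale_blocks_def vector_minus_component vec_lambda_beta left_diff_distrib)
    ultimately show "norm ((scale_blocks l v - scale_blocks m v) $ p) \<le> norm (((2 * \<bar>l - m\<bar>) *\<^sub>R v) $ p)"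
      by (simp add: abs_mult)
  qed
  then show ?thesis by simp
qed

lemma tonelli_scheme_scale_blocks:
  assumes "caratheodory_field T N \<rho>"
  shows "tonelli_scheme T N \<rho> scale_blocks 2"
  by (intro tonelli_scheme.intro tonelli_scheme_axioms.intro assms linear_scale_blocks
      norm_scale_blocks_le norm_scale_blocks_diff_le) simp

section \<open>Truncation, and what the limit equation implies\<close>

text \<open>Composition with the projection onto the ball of radius \<open>R\<close> gives one
  integrable bound for all \<open>s\<close>, and setting the field to zero on a null set
  \<open>Z\<close> turns "almost every" into "every". Neither change affects integrals along
  functions with values in the ball.\<close>

lemma truncated_cyclic_field:
  fixes g :: "'n::{finite,linorder} \<Rightarrow> real^'m::finite \<Rightarrow> real^'m"
    and h :: "real \<Rightarrow> real^('n \<times> 'm) \<Rightarrow> real^'m"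
  assumes T: "T > 0" and g: "\<And>i. i < Max UNIV \<Longrightarrow> continuous_on UNIV (g i)"
    and h: "L1_Caratheodory T h" and R: "R > 0"
  obtains N \<rho> Z where "caratheodory_field T N \<rho>" "negligible Z"
    "\<And>t s. t \<in> {0..T} - Z \<Longrightarrow> norm s \<le> R \<Longrightarrow> N t s = cyclic_field g (h t s) s"
    "\<And>s. norm s \<le> R \<Longrightarrow> (1 / T) *\<^sub>R integral {0..T} (\<lambda>u. N u s) = g_hat T g h s"
proof -
  \<comment> \<open>The field splits into the time-independent part \<open>C\<close> and the image
    of \<open>h\<close> under the bounded linear map \<open>emb\<close>, so measurability, bounds
    and integrals of \<open>h\<close> carry over.\<close>
  define emb :: "real^'m \<Rightarrow> real^('n \<times> 'm)" where "emb = (\<lambda>w. of_blocks (\<lambda>i. if i = Max UNIV then w else 0))"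
  define C where "C = cyclic_field g (0::real^'m)"
  define r where "r = closest_point (cball (0 :: real^('n \<times> 'm)) R)"
  have cyc: "cyclic_field g w s = C s + emb w" for w s
    by (simp add: C_def emb_def cyclic_field_def of_blocks_def vec_eq_iff)
  have blemb: "bounded_linear emb"
    unfolding linear_conv_bounded_linear[symmetric]
    by (rule linearI) (auto simp: emb_def of_blocks_def vec_eq_iff)
  obtain k where k: "k > 0" "\<And>w. norm (emb w) \<le> norm w * k"
    using bounded_linear.pos_bounded[OF blemb] by blast
  have contC: "continuous_on UNIV C"
  proof -
    have "continuous_on UNIV (\<lambda>s. (if i = Max UNIV then 0 else g i (block s (next_index i))) $ j)" for i j
    proof (cases "i = Max UNIV")
      case False
      then have "continuous_on UNIV (\<lambda>s. g i (block s (next_index i)))"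
        by (intro continuous_on_compose2[OF g] linear_continuous_on bounded_linear_block)
           (auto simp: less_Max_UNIV_iff)
      then show ?thesis using False by (auto intro!: continuous_intros)
    qed simp
    then show ?thesis
      unfolding C_def cyclic_field_def[abs_def] of_blocks_def by (intro continuous_on_vec_lambda)
  qed
  have contr: "continuous_on A r" for A
    unfolding r_def using R by (intro continuous_on_closest_point) auto
  have r_in: "norm (r s) \<le> R" for s
    using closest_point_in_set[of "cball 0 R" s] R by (simp add: r_def)
  have r_id: "r s = s" if "norm s \<le> R" for s
    using that by (simp add: r_def closest_point_self)
  have "compact (C ` cball 0 R)"
    by (intro compact_continuous_image continuous_on_subset[OF contC]) auto
  then obtain c where c: "\<And>s. norm s \<le> R \<Longrightarrow> norm (C s) \<le> c"
    using compact_imp_bounded bounded_iff by (metis imageI mem_cball_0)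
  have meas: "measurable_upto T (\<lambda>t. h t s)" for s
    using h by (simp add: L1_Caratheodory_def)
  obtain \<rho>0 where \<rho>0: "integrable (lebesgue_on {0..T}) \<rho>0"
    "AE t in lebesgue_on {0..T}. \<forall>s. norm s \<le> R \<longrightarrow> norm (h t s) \<le> \<rho>0 t"
    using h R unfolding L1_Caratheodory_def by blast
  have "AE t in lebesgue_on {0..T}. continuous_on UNIV (h t)"
    using h by (simp add: L1_Caratheodory_def)
  with \<rho>0(2) have "AE t in lebesgue_on {0..T}. continuous_on UNIV (h t) \<and> (\<forall>s. norm s \<le> R \<longrightarrow> norm (h t s) \<le> \<rho>0 t)"
    by eventually_elim simp
  then obtain Z where Z: "negligible Z"
    "\<And>t. t \<in> {0..T} - Z \<Longrightarrow> continuous_on UNIV (h t)"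
    "\<And>t s. t \<in> {0..T} - Z \<Longrightarrow> norm s \<le> R \<Longrightarrow> norm (h t s) \<le> \<rho>0 t"
    by (subst (asm) AE_lebesgue_on_iff_negligible) auto
  define N where "N = (\<lambda>t s. if t \<in> Z then 0 else cyclic_field g (h t (r s)) (r s))"
  define \<rho> where "\<rho> = (\<lambda>t. c + \<bar>\<rho>0 t\<bar> * k)"
  have c0: "0 \<le> c" using c[of 0] R norm_ge_zero order_trans by (metis less_imp_le norm_zero)
  have \<rho>0_HK: "\<rho>0 absolutely_integrable_on {0..T}"
    using \<rho>0(1) by (simp add: integrable_restrict_space set_integrable_def)
  have "caratheodory_field T N \<rho>"
  proof
    show "measurable_upto T (\<lambda>t. N t s)" for s
    proof -
      have "measurable_upto T (\<lambda>t. emb (h t (r s)))"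
        by (rule measurable_compose[OF meas])
           (intro borel_measurable_continuous_onI linear_continuous_on blemb)
      moreover have "Z \<in> sets lebesgue" using Z(1) by (simp add: negligible_imp_sets)
      then have "{t \<in> space (lebesgue_on {0..T}). t \<in> Z} \<in> sets (lebesgue_on {0..T})"
        by (auto simp: sets_restrict_space space_restrict_space)
      ultimately show ?thesis
        unfolding N_def cyc by (intro measurable_If borel_measurable_add borel_measurable_const) auto
    qed
    show "continuous_on UNIV (N t)" if "t \<in> {0..T}" for t
    proof (cases "t \<in> Z")
      case False
      have "continuous_on UNIV (\<lambda>s. C (r s) + emb (h t (r s)))"
        by (intro continuous_on_add continuous_on_compose2[OF contC contr] continuous_on_compose2[OF Z(2) contr]
             continuous_on_compose2[OF linear_continuous_on[OF blemb]]) (use that False in auto)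
      then show ?thesis using False by (simp add: N_def cyc[abs_def])
    qed (simp add: N_def[abs_def])
    show "norm (N t s) \<le> \<rho> t" if "t \<in> {0..T}" for t s
    proof (cases "t \<in> Z")
      case False
      have "norm (C (r s) + emb (h t (r s))) \<le> norm (C (r s)) + norm (h t (r s)) * k"
        using k(2)[of "h t (r s)"] norm_triangle_ineq[of "C (r s)" "emb (h t (r s))"] by simp
      also have "norm (h t (r s)) * k \<le> \<bar>\<rho>0 t\<bar> * k"
        using Z(3)[OF _ r_in, of t s] that False k(1) by (intro mult_right_mono) auto
      finally show ?thesis using c[OF r_in, of s] False by (simp add: N_def cyc \<rho>_def)
    qed (use c0 k(1) in \<open>simp add: N_def \<rho>_def\<close>)
    show "\<rho> integrable_on {0..T}"
    proof -
      have "(\<lambda>t. \<bar>\<rho>0 t\<bar>) integrable_on {0..T}"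
        using \<rho>0_HK by (simp add: absolutely_integrable_on_def)
      then have "(\<lambda>t. \<bar>\<rho>0 t\<bar> * k) integrable_on {0..T}"
        by (rule integrable_on_mult_left)
      then show ?thesis unfolding \<rho>_def by (intro Henstock_Kurzweil_Integration.integrable_add integrable_const_ivl)
    qed
  qed (rule T)
  moreover have "N t s = cyclic_field g (h t s) s" if "t \<in> {0..T} - Z" "norm s \<le> R" for t s
    using that by (simp add: N_def r_id)
  moreover have "(1 / T) *\<^sub>R integral {0..T} (\<lambda>u. N u s) = g_hat T g h s" if s: "norm s \<le> R" for s
  proof -
    have int: "integrable (lebesgue_on {0..T}) (\<lambda>t. h t s)"
    proof (rule Bochner_Integration.integrable_bound[OF \<rho>0(1) meas])
      show "AE t in lebesgue_on {0..T}. norm (h t s) \<le> norm (\<rho>0 t)"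
        using \<rho>0(2) by eventually_elim (use s in force)
    qed
    define I where "I = (LINT t|lebesgue_on {0..T}. h t s)"
    have "((\<lambda>t. h t s) has_integral I) {0..T}"
      unfolding I_def by (rule has_integral_integral_lebesgue_on[OF int]) simp
    then have "((\<lambda>t. emb (h t s)) has_integral emb I) {0..T}"
      using has_integral_linear[OF _ blemb] by (simp add: o_def)
    moreover have "((\<lambda>t. C s) has_integral (T *\<^sub>R C s)) {0..T}"
      using has_integral_const_real[of "C s" 0 T] T by simp
    ultimately have "((\<lambda>t. C s + emb (h t s)) has_integral (T *\<^sub>R C s + emb I)) {0..T}"
      by (rule has_integral_add[rotated])
    then have "((\<lambda>t. N t s) has_integral (T *\<^sub>R C s + emb I)) {0..T}"
      by (rule has_integral_spike[OF Z(1), rotated]) (use s in \<open>simp add: N_def r_id cyc\<close>)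
    then have "(1 / T) *\<^sub>R integral {0..T} (\<lambda>u. N u s) = (1 / T) *\<^sub>R (T *\<^sub>R C s + emb I)"
      by (simp add: integral_unique)
    also have "\<dots> = C s + emb ((1 / T) *\<^sub>R I)"
      using T by (simp add: scaleR_add_right linear_cmul[OF bounded_linear.linear[OF blemb]])
    also have "\<dots> = g_hat T g h s"
      by (simp add: g_hat_def time_mean_def I_def cyc)
    finally show ?thesis .
  qed
  ultimately show ?thesis using that Z(1) by blast
qed

text \<open>\<open>x\<close> plays the role of a limit from \<open>tonelli_limit\<close> with values
  in the ball where, off \<open>Z\<close>, \<open>N\<close> is the cyclic field itself. The two main
  lemmas treat the second and the first leg of the path.\<close>

context
  fixes T R l :: real and N :: "real \<Rightarrow> real^('n::{finite,linorder} \<times> 'm::finite) \<Rightarrow> real^('n \<times> 'm)"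
    and \<rho> :: "real \<Rightarrow> real" and Z :: "real set" and g :: "'n \<Rightarrow> real^'m \<Rightarrow> real^'m"
    and h :: "real \<Rightarrow> real^('n \<times> 'm) \<Rightarrow> real^'m" and x :: "real \<Rightarrow> real^('n \<times> 'm)"
  assumes cf: "caratheodory_field T N \<rho>" and Z: "negligible Z"
    and N: "\<And>t s. t \<in> {0..T} - Z \<Longrightarrow> norm s \<le> R \<Longrightarrow> N t s = cyclic_field g (h t s) s"
    and cont_x: "continuous_on {0..T} x" and x_le: "\<And>t. t \<in> {0..T} \<Longrightarrow> norm (x t) \<le> R"
    and eq: "\<And>t. t \<in> {0..T} \<Longrightarrow> x t = x 0 + scale_blocks l (field_integral N x t)"
    and int0: "field_integral N x T = 0"
begin

interpretation tonelli_scheme T N \<rho> scale_blocks 2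
  by (rule tonelli_scheme_scale_blocks[OF cf])

lemma measurable_x: "measurable_upto T x"
  by (rule continuous_on_imp_lebesgue_measurable[OF cont_x])

text \<open>For \<open>l \<ge> 1 / 2\<close> the blocks below \<open>n\<close> carry the factor
  \<open>min 1 (2 * l) = 1\<close> and block \<open>n\<close> carries \<open>2 * l - 1\<close>, the
  \<open>\<vartheta>\<close> of the problem. Periodicity is \<open>int0\<close> inserted into the
  equation at time \<open>T\<close>.\<close>

lemma integral_equation_imp_periodic_solution:
  assumes l: "1 / 2 \<le> l" "l \<le> 1"
  shows "periodic_solution T g (\<lambda>t s. (2 * l - 1) *\<^sub>R h t s) x"
proof -
  have bl: "bounded_linear (scale_blocks l :: real^('n \<times> 'm) \<Rightarrow> _)"
    by (simp add: linear_scale_blocks linear_linear)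
  define f where "f = (\<lambda>u. scale_blocks l (N u (x u)))"
  have f_int: "f integrable_on {0..T}"
    unfolding f_def using integrable_linear[OF integrable_composition[OF measurable_x] bl, of 0 T] by (simp add: o_def)
  have x_f: "x t = x 0 + integral {0..t} f" if "t \<in> {0..T}" for t
  proof -
    have "integral {0..t} f = scale_blocks l (field_integral N x t)"
      unfolding f_def using integral_linear[OF integrable_composition[OF measurable_x] bl, of 0 t] that by (simp add: o_def)
    then show ?thesis using eq[OF that] by simp
  qed
  have x_diff: "norm (x d - x c) \<le> integral {c..d} \<rho>" if "0 \<le> c" "c \<le> d" "d \<le> T" for c d
  proof -
    have "field_integral N x c + integral {c..d} (\<lambda>u. N u (x u)) = field_integral N x d"
      using that by (intro hk_integral_combine integrable_composition measurable_x) auto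
    then have "integral {c..d} (\<lambda>u. N u (x u)) = field_integral N x d - field_integral N x c"
      by (simp add: algebra_simps)
    then have "x d - x c = scale_blocks l (integral {c..d} (\<lambda>u. N u (x u)))"
      using eq[of c] eq[of d] that by (simp add: linear_diff[OF lin])
    then have "norm (x d - x c) \<le> norm (integral {c..d} (\<lambda>u. N u (x u)))"
      using norm_scale_blocks_le[of l] l by simp
    also have "\<dots> \<le> integral {c..d} \<rho>"
      by (rule norm_integral_composition_le[OF measurable_x]) (use that in auto)
    finally show ?thesis .
  qed
  have \<rho>_abs: "\<rho> absolutely_integrable_on {0..T}"
    by (rule nonnegative_absolutely_integrable_1[OF \<rho>_int \<rho>_nonneg])
  obtain Z' where Z': "negligible Z'"
    "\<And>t. t \<in> {0..T} - Z' \<Longrightarrow> ((\<lambda>t. integral {0..t} f) has_vector_derivative f t) (at t within {0..T})"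
    using indefinite_integral_has_vector_derivative_ae[OF f_int] by blast
  have "absolutely_continuous_on {0..T} (\<lambda>t. block (x t) i)" for i
  proof (rule absolutely_continuous_on_of_integral_bound[OF \<rho>_abs \<rho>_nonneg])
    fix c d :: real assume cd: "0 \<le> c" "c \<le> d" "d \<le> T"
    have "block (x d) i - block (x c) i = block (x d - x c) i"
      by (simp add: vec_eq_iff block_nth)
    then show "norm (block (x d) i - block (x c) i) \<le> integral {c..d} \<rho>"
      using norm_block_le[of "x d - x c" i] x_diff[OF cd] by simp
  qed
  moreover have "x 0 = x T"
    using eq[of T] T by (simp add: int0 linear_0[OF lin])
  moreover have "AE t in lebesgue_on {0..T}. \<forall>i. ((\<lambda>u. block (x u) i) has_vector_derivative
      block (cyclic_field g ((2 * l - 1) *\<^sub>R h t (x t)) (x t)) i) (at t within {0..T})"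
  proof (subst AE_lebesgue_on_iff_negligible, simp, intro exI[of _ "Z \<union> Z'"] conjI ballI allI)
    show "negligible (Z \<union> Z')" using Z Z'(1) by (rule negligible_Un)
    fix t i assume t: "t \<in> {0..T} - (Z \<union> Z')"
    have D: "((\<lambda>u. x 0 + integral {0..u} f) has_vector_derivative 0 + f t) (at t within {0..T})"
      by (rule has_vector_derivative_add[OF has_vector_derivative_const Z'(2)]) (use t in blast)
    have "(x has_vector_derivative f t) (at t within {0..T})"
      by (rule has_vector_derivative_transform[OF _ x_f D[unfolded add_0_left]]) (use t in blast)
    then have "((\<lambda>u. block (x u) i) has_vector_derivative block (f t) i) (at t within {0..T})"
      by (rule bounded_linear.has_vector_derivative[OF bounded_linear_block])
    moreover have "block (f t) i = block (cyclic_field g ((2 * l - 1) *\<^sub>R h t (x t)) (x t)) i"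
      using t N[of t "x t"] x_le[of t] l
      by (simp add: f_def block_scale_blocks block_cyclic_field)
    ultimately show "((\<lambda>u. block (x u) i) has_vector_derivative
      block (cyclic_field g ((2 * l - 1) *\<^sub>R h t (x t)) (x t)) i) (at t within {0..T})" by simp
  qed
  ultimately show ?thesis unfolding periodic_solution_def by simp
qed

text \<open>The block \<open>n\<close> of the solution is constant because its equation is switched off; going down
  through the blocks, \<open>x\<^sub>i' = a g\<^sub>i(x\<^sub>i\<^sub>+\<^sub>1)\<close> then has a constant right-hand side, which is zero by
  periodicity.\<close>

lemma integral_equation_imp_constant:
  assumes l: "l \<le> 1 / 2" and t: "t \<in> {0..T}"
  shows "x t = x 0"
proof -
  have bl0: "block (0 :: real^('n \<times> 'm)) i = 0" for i
    by (simp add: vec_eq_iff block_nth)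
  have bladd: "block (v + w :: real^('n \<times> 'm)) i = block v i + block w i" for v w i
    by (simp add: vec_eq_iff block_nth)
  have "\<forall>t\<in>{0..T}. block (x t) i = block (x 0) i" for i
  proof (induction i rule: index_induct_from_Max)
    case Max
    show ?case
    proof
      fix t assume "t \<in> {0..T}"
      then have "block (x t) (Max UNIV) = block (x 0 + scale_blocks l (field_integral N x t)) (Max UNIV)"
        using eq by metis
      also have "\<dots> = block (x 0) (Max UNIV)" using l by (simp add: bladd block_scale_blocks)
      finally show "block (x t) (Max UNIV) = block (x 0) (Max UNIV)" .
    qed
  next
    case (step i)
    define c where "c = g i (block (x 0) (next_index i))"
    have int: "block (field_integral N x t) i = t *\<^sub>R c" if t: "t \<in> {0..T}" for t
    proof -
      have "((\<lambda>u. N u (x u)) has_integral field_integral N x t) {0..t}"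
        by (rule integrable_integral[OF integrable_composition[OF measurable_x]]) (use t in auto)
      then have "((\<lambda>u. block (N u (x u)) i) has_integral block (field_integral N x t) i) {0..t}"
        using has_integral_linear[OF _ bounded_linear_block] by (simp add: o_def)
      moreover have "((\<lambda>u. block (N u (x u)) i) has_integral t *\<^sub>R c) {0..t}"
      proof (rule has_integral_spike[OF Z])
        show "((\<lambda>u. c) has_integral t *\<^sub>R c) {0..t}"
          using has_integral_const_real[of c 0 t] t by simp
        fix u assume "u \<in> {0..t} - Z"
        then have u: "u \<in> {0..T} - Z" "u \<in> {0..T}" using t by auto
        have "block (x u) (next_index i) = block (x 0) (next_index i)" using step(2) u(2) by blast
        then show "block (N u (x u)) i = c"
          unfolding N[OF u(1) x_le[OF u(2)]] block_cyclic_field c_def by (simp only: step(1) if_False)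
      qed
      ultimately show ?thesis by (rule has_integral_unique)
    qed
    have "T *\<^sub>R c = 0" using int[of T] T by (simp add: int0 bl0)
    then have c0: "c = 0" using T by simp
    show ?case
    proof
      fix t assume t: "t \<in> {0..T}"
      then have "block (x t) i = block (x 0 + scale_blocks l (field_integral N x t)) i"
        using eq by metis
      also have "\<dots> = block (x 0) i" by (simp add: bladd block_scale_blocks int[OF t] c0)
      finally show "block (x t) i = block (x 0) i" .
    qed
  qed
  then show ?thesis unfolding vec_eq_iff_block using t by blast
qed

end

section \<open>The degree argument and the limit of vanishing delay\<close>

lemma brouwer_degree_cong:
  assumes "\<And>x. x \<in> closure U \<Longrightarrow> f x = f' x"
  shows "brouwer_degree f U y = brouwer_degree f' U y"
  unfolding brouwer_degree_def using assms by (simp cong: ball_cong)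

theorem theorem3p2:
  fixes T :: real
    and g :: "'n::{finite,linorder} \<Rightarrow> real^'m::finite \<Rightarrow> real^'m"
    and h :: "real \<Rightarrow> real^('n \<times> 'm) \<Rightarrow> real^'m"
    and \<Omega> :: "(real \<Rightarrow> real^('n \<times> 'm)) set"
  assumes "T > 0"
    and "\<And>i. i < Max UNIV \<Longrightarrow> continuous_on UNIV (g i)"
    and "L1_Caratheodory T h"
    and "openin (mtopology_of (C_space T)) \<Omega>"
    and "Metric_space.mbounded (mspace (C_space T)) (mdist (C_space T)) \<Omega>"
    and c1: "\<And>\<theta>. 0 < \<theta> \<Longrightarrow> \<theta> < 1 \<Longrightarrow>
      \<not> (\<exists>x \<in> mtopology_of (C_space T) frontier_of \<Omega>. periodic_solution T g (\<lambda>t s. \<theta> *\<^sub>R h t s) x)"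
    and c2: "const_fun T ` (g_hat T g h -` {0}) \<inter> (mtopology_of (C_space T) frontier_of \<Omega>) = {}"
    and deg: "brouwer_degree (g_hat T g h) {s. const_fun T s \<in> \<Omega>} 0 \<noteq> 0"
  shows "\<exists>x \<in> mtopology_of (C_space T) closure_of \<Omega>. periodic_solution T g h x"
proof (rule ccontr)
  assume no_sol: "\<not> ?thesis"
  note T = assms(1) and op = assms(4)
  define cl where "cl = mtopology_of (C_space T) closure_of \<Omega>"
  define fr where "fr = mtopology_of (C_space T) frontier_of \<Omega>"
  have fr_eq: "fr = cl - \<Omega>"
    unfolding fr_def cl_def by (rule frontier_of_openin_C_space[OF op])
  have \<Omega>_sub: "\<Omega> \<subseteq> mspace (C_space T)"
    using openin_subset[OF op] by simp
  have \<Omega>_cl: "\<Omega> \<subseteq> cl"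
    unfolding cl_def using \<Omega>_sub by (intro closure_of_subset) simp
  note cl_iff = closure_of_C_space[OF T \<Omega>_sub, folded cl_def]
  obtain R where R: "0 < R" "\<And>x t. x \<in> \<Omega> \<Longrightarrow> t \<in> {0..T} \<Longrightarrow> norm (x t) \<le> R"
    using bounded_C_space[OF T assms(5)] by blast
  have cl_le: "norm (x t) \<le> R" if x: "x \<in> cl" and t: "t \<in> {0..T}" for x t
  proof (rule field_le_epsilon)
    fix e :: real assume "0 < e"
    then obtain y where "y \<in> \<Omega>" "\<forall>t\<in>{0..T}. dist (x t) (y t) \<le> e"
      using x cl_iff by blast
    then show "norm (x t) \<le> R + e"
      using R(2)[of y t] t norm_triangle_sub[of "x t" "y t"] by (fastforce simp: dist_norm)
  qed
  \<comment> \<open>By \<open>cl_le\<close> the same \<open>R\<close> bounds the closure of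
    \<open>\<Omega>\<close>, so the truncation is invisible to every candidate solution
    there.\<close>
  obtain N \<rho> Z where cf: "caratheodory_field T N \<rho>" and Z: "negligible Z"
    and N: "\<And>t s. t \<in> {0..T} - Z \<Longrightarrow> norm s \<le> R \<Longrightarrow> N t s = cyclic_field g (h t s) s"
    and mean: "\<And>s. norm s \<le> R \<Longrightarrow> (1 / T) *\<^sub>R integral {0..T} (\<lambda>u. N u s) = g_hat T g h s"
    using truncated_cyclic_field[of T g h R, OF T assms(2,3) R(1)] by blast
  interpret tonelli_scheme T N \<rho> scale_blocks 2
    by (rule tonelli_scheme_scale_blocks[OF cf])
  define res :: "(real \<Rightarrow> real^('n \<times> 'm)) \<Rightarrow> real \<Rightarrow> real^('n \<times> 'm)"
    where "res = (\<lambda>y. restrict y {0..T})"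
  have res_mspace: "res y \<in> mspace (C_space T)" if "continuous_on {0..T} y" for y
    unfolding mspace_C_space[OF T] res_def
    by (intro conjI restrict_extensional continuous_on_eq[OF that]) simp
  have res_nth: "res y t = y t" if "t \<in> {0..T}" for y t
    using that by (simp add: res_def)
  \<comment> \<open>These are the obstructions to deforming to a map without zeros: a zero on the
    frontier, or at the end of the path a zero anywhere in the closure. If some delay is free of
    them, the degree is zero; otherwise each delay has one, and these accumulate at a forbidden
    solution.\<close>
  define bad where "bad = (\<lambda>k l s. defect k l s = 0 \<and> (res (sol k l s) \<in> fr \<or> l = 1 \<and> res (sol k l s) \<in> cl))"
  show False
  proof (cases "\<exists>k. \<forall>l\<in>{0..1}. \<forall>s. \<not> bad k l s")
    case True
    then obtain k where k: "\<And>l s. l \<in> {0..1} \<Longrightarrow> \<not> bad k l s" by blast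
    define Q where "Q = {(l, s). l \<in> {0..1} \<and> res (sol k l s) \<in> \<Omega>}"
    have "openin (top_of_set ({0..1} \<times> UNIV)) Q"
      unfolding openin_euclidean_subtopology_iff
    proof (intro conjI ballI)
      show "Q \<subseteq> {0..1} \<times> UNIV" by (auto simp: Q_def)
      fix p assume "p \<in> Q"
      then obtain l s where p: "p = (l, s)" "l \<in> {0..1}" "res (sol k l s) \<in> \<Omega>" by (auto simp: Q_def)
      obtain e where e: "0 < e" "\<And>y. y \<in> mspace (C_space T) \<Longrightarrow>
          (\<forall>t\<in>{0..T}. dist (res (sol k l s) t) (y t) \<le> e) \<Longrightarrow> y \<in> \<Omega>"
        using openin_C_spaceD[OF T op p(3)] by blast
      obtain d where d: "d > 0" "\<And>l' s'. l' \<in> {0..1} \<Longrightarrow> dist (l', s') (l, s) < d \<Longrightarrow>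
          \<forall>t\<in>{0..T}. norm (sol k l' s' t - sol k l s t) \<le> e"
        using sol_uniformly_continuous_dependence[OF p(2) e(1), of s k] by blast
      have "p' \<in> Q" if p': "p' \<in> {0..1} \<times> UNIV" "dist p' p < d" for p'
      proof -
        obtain l' s' where p'_eq: "p' = (l', s')" by (cases p')
        have "res (sol k l' s') \<in> \<Omega>"
        proof (rule e(2)[OF res_mspace[OF continuous_on_sol]])
          show "\<forall>t\<in>{0..T}. dist (res (sol k l s) t) (res (sol k l' s') t) \<le> e"
            using d(2)[of l' s'] p' by (simp add: p p'_eq res_nth dist_norm norm_minus_commute)
        qed
        then show ?thesis using p' by (simp add: Q_def p'_eq)
      qed
      then show "\<exists>d>0. \<forall>p'\<in>{0..1} \<times> UNIV. dist p' p < d \<longrightarrow> p' \<in> Q" using d(1) by blast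
    qed
    moreover have "bounded Q"
    proof (rule bounded_subset)
      show "bounded ({0..1::real} \<times> cball (0 :: real^('n \<times> 'm)) R)" by (intro bounded_Times) auto
      show "Q \<subseteq> {0..1} \<times> cball 0 R"
        using R(2)[of _ 0] T by (fastforce simp: Q_def res_nth sol_0)
    qed
    moreover have clQ: "l \<in> {0..1} \<and> res (sol k l s) \<in> cl" if "(l, s) \<in> closure Q" for l s
    proof -
      have "closure Q \<subseteq> {0..1} \<times> UNIV"
        by (rule closure_minimal) (auto simp: Q_def intro!: closed_Times)
      then have l: "l \<in> {0..1}" using that by auto
      have "\<exists>y\<in>\<Omega>. \<forall>t\<in>{0..T}. dist (res (sol k l s) t) (y t) \<le> e" if e: "0 < e" for e
      proof -
        obtain d where d: "d > 0" "\<And>l' s'. l' \<in> {0..1} \<Longrightarrow> dist (l', s') (l, s) < d \<Longrightarrow>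
            \<forall>t\<in>{0..T}. norm (sol k l' s' t - sol k l s t) \<le> e"
          using sol_uniformly_continuous_dependence[OF l e, of s k] by blast
        obtain p where "p \<in> Q" "dist p (l, s) < d"
          using \<open>(l, s) \<in> closure Q\<close> d(1) unfolding closure_approachable by blast
        then obtain l' s' where l': "l' \<in> {0..1}" "res (sol k l' s') \<in> \<Omega>" "dist (l', s') (l, s) < d"
          by (auto simp: Q_def)
        show ?thesis
          using d(2)[OF l'(1,3)] by (intro bexI[OF _ l'(2)]) (simp add: res_nth dist_norm norm_minus_commute)
      qed
      then show ?thesis using l res_mspace[OF continuous_on_sol] cl_iff by blast
    qed
    moreover have "continuous_on ({0..1} \<times> UNIV) (\<lambda>(l, s). (1 / T) *\<^sub>R defect k l s)"
      using continuous_on_scaleR[OF continuous_on_const[of _ "1 / T"] continuous_on_defect[of k]]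
      by (simp add: split_beta)
    moreover have "(1 / T) *\<^sub>R defect k l s \<noteq> 0" if "(l, s) \<in> closure Q" "(l, s) \<notin> Q" for l s
      using k[of l s] clQ[OF that(1)] that(2) T by (auto simp: bad_def fr_eq Q_def)
    moreover have "(1 / T) *\<^sub>R defect k 1 s \<noteq> 0" if "(1, s) \<in> Q" for s
      using k[of 1 s] that \<Omega>_cl T by (auto simp: bad_def Q_def)
    ultimately have deg0: "brouwer_degree (\<lambda>s. (1 / T) *\<^sub>R defect k 0 s) {s. (0, s) \<in> Q} 0 = 0"
      by (intro brouwer_degree_homotopy_eq_0)
    \<comment> \<open>At \<open>l = 0\<close> both factors are zero, so the trajectory rests at
      \<open>s\<close>: the slice of \<open>Q\<close> consists of the constants in
      \<open>\<Omega>\<close>, and the mean is that of \<open>N u s\<close>.\<close>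
    have X0: "sol k 0 s t = s" if "t \<in> {0..T}" for s t
      using sol_eq[OF that, of k 0 s] by (simp add: scale_blocks_def vec_eq_iff)
    then have "res (sol k 0 s) = const_fun T s" for s
      by (auto simp: res_def const_fun_def restrict_def)
    then have sl: "{s. (0, s) \<in> Q} = {s. const_fun T s \<in> \<Omega>}" by (simp add: Q_def)
    \<comment> \<open>The mean of the truncated field is identified with \<open>g_hat\<close> on the
      ball of radius \<open>R\<close>, so the two degrees are compared by agreement on the closure
      of the slice.\<close>
    have "closure {s. const_fun T s \<in> \<Omega>} \<subseteq> cball 0 R"
      using R(2)[of _ 0] T by (intro closure_minimal) (fastforce simp: const_fun_def)+
    moreover have "(1 / T) *\<^sub>R defect k 0 s = g_hat T g h s" if "norm s \<le> R" for s
    proof -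
      have "defect k 0 s = integral {0..T} (\<lambda>u. N u s)"
        unfolding defect_def
      proof (rule hk_integral_cong)
        fix u assume "u \<in> {0..T}"
        then have "max 0 (u - delay k) \<in> {0..T}" using delay_nonneg[of k] by auto
        then show "N u (sol k 0 s (max 0 (u - delay k))) = N u s" by (simp only: X0)
      qed
      then show ?thesis using mean[OF that] by simp
    qed
    ultimately have "brouwer_degree (\<lambda>s. (1 / T) *\<^sub>R defect k 0 s) {s. const_fun T s \<in> \<Omega>} 0
       = brouwer_degree (g_hat T g h) {s. const_fun T s \<in> \<Omega>} 0"
      by (intro brouwer_degree_cong) auto
    then show False using deg deg0 by (simp add: sl)
  next
    case False
    then have "\<forall>k. \<exists>l s. l \<in> {0..1} \<and> bad k l s" by blast
    then obtain l s where ls: "\<And>k. l k \<in> {0..1}" "\<And>k. bad k (l k) (s k)" by metis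
    have Xcl: "res (sol k (l k) (s k)) \<in> cl" for k
      using ls(2)[of k] by (auto simp: bad_def fr_eq)
    have s_le: "norm (s k) \<le> R" for k
      using cl_le[OF Xcl[of k], of 0] T by (simp add: res_nth sol_0)
    have G0: "defect k (l k) (s k) = 0" for k using ls(2) by (simp add: bad_def)
    obtain r l' x where r: "strict_mono (r :: nat \<Rightarrow> nat)" and l': "l' \<in> {0..1}"
      and lim: "(\<lambda>k. l (r k)) \<longlonglongrightarrow> l'" and x: "continuous_on {0..T} x"
      and unif: "\<And>e. 0 < e \<Longrightarrow> \<exists>K. \<forall>k\<ge>K. \<forall>t\<in>{0..T}. norm (sol (r k) (l (r k)) (s (r k)) t - x t) < e"
      and eq: "\<And>t. t \<in> {0..T} \<Longrightarrow> x t = x 0 + scale_blocks l' (field_integral N x t)"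
      and int0: "field_integral N x T = 0"
      using tonelli_limit[OF ls(1) s_le G0] by blast
    let ?Y = "\<lambda>k. sol (r k) (l (r k)) (s (r k))"
    have y_m: "res x \<in> mspace (C_space T)" by (rule res_mspace[OF x])
    have "\<exists>y\<in>\<Omega>. \<forall>t\<in>{0..T}. dist (res x t) (y t) \<le> e" if e: "0 < e" for e
    proof -
      obtain K where K: "\<forall>k\<ge>K. \<forall>t\<in>{0..T}. norm (?Y k t - x t) < e / 2"
        using unif[of "e / 2"] e by auto
      have "\<forall>e>0. \<exists>y\<in>\<Omega>. \<forall>t\<in>{0..T}. dist (res (?Y K) t) (y t) \<le> e"
        using Xcl[of "r K"] cl_iff by blast
      then obtain y where y: "y \<in> \<Omega>" "\<forall>t\<in>{0..T}. dist (res (?Y K) t) (y t) \<le> e / 2"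
        using e by (meson half_gt_zero)
      have "dist (res x t) (y t) \<le> e" if t: "t \<in> {0..T}" for t
      proof -
        have "dist (?Y K t) (x t) < e / 2"
          using K t by (simp add: dist_norm)
        moreover have "dist (?Y K t) (y t) \<le> e / 2"
          using y(2) t by (simp add: res_nth)
        ultimately show ?thesis
          using dist_triangle3[of "x t" "y t" "?Y K t"] by (simp add: res_nth[OF t])
      qed
      then show ?thesis using y(1) by blast
    qed
    then have y_cl: "res x \<in> cl" using y_m cl_iff by blast
    \<comment> \<open>Since \<open>\<Omega>\<close> is open, trajectories close to such a limit lie
      in \<open>\<Omega>\<close> and hence off the frontier; \<open>bad\<close> then leaves only
      parameters equal to 1. Conversely, every limit with \<open>l' < 1\<close> is on the
      frontier.\<close>
    have l'1: "l' = 1" if in_\<Omega>: "res x \<in> \<Omega>"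
    proof -
      obtain e where e: "0 < e" "\<And>y. y \<in> mspace (C_space T) \<Longrightarrow>
          (\<forall>t\<in>{0..T}. dist (res x t) (y t) \<le> e) \<Longrightarrow> y \<in> \<Omega>"
        using openin_C_spaceD[OF T op in_\<Omega>] by blast
      obtain K where K: "\<forall>k\<ge>K. \<forall>t\<in>{0..T}. norm (?Y k t - x t) < e"
        using unif[OF e(1)] by blast
      have "l (r k) = 1" if "k \<ge> K" for k
      proof -
        have "res (?Y k) \<in> \<Omega>"
        proof (rule e(2)[OF res_mspace[OF continuous_on_sol]], rule ballI)
          fix t assume t: "t \<in> {0..T}"
          then have "norm (?Y k t - x t) < e" using K that by blast
          then show "dist (res x t) (res (?Y k) t) \<le> e"
            by (simp add: res_nth[OF t] dist_norm norm_minus_commute)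
        qed
        then show ?thesis using ls(2)[of "r k"] by (auto simp: bad_def fr_eq)
      qed
      then have "\<forall>\<^sub>F k in sequentially. l (r k) = 1" by (auto simp: eventually_sequentially)
      then have "(\<lambda>k. l (r k)) \<longlonglongrightarrow> 1" by (rule tendsto_eventually)
      then show ?thesis using lim LIMSEQ_unique by blast
    qed
    \<comment> \<open>Elements of \<open>C_space T\<close> are \<open>undefined\<close> outside
      \<open>[0, T]\<close>; \<open>y\<close> is the representative of \<open>x\<close> there, and
      the facts about \<open>x\<close> carry over because they only involve values on the
      interval.\<close>
    define y where "y = res x"
    have y_nth: "y t = x t" if "t \<in> {0..T}" for t using that by (simp add: y_def res_nth)
    have cont_y: "continuous_on {0..T} y"
      using x by (rule continuous_on_eq) (simp add: y_nth)
    have y_le: "norm (y t) \<le> R" if "t \<in> {0..T}" for t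
      using cl_le[OF y_cl that] by (simp add: y_def)
    have int_y: "field_integral N y t = field_integral N x t" if "t \<in> {0..T}" for t
      by (rule hk_integral_cong) (use that y_nth in auto)
    have y0: "y 0 = x 0" using T by (simp add: y_nth)
    have eq_y: "y t = y 0 + scale_blocks l' (field_integral N y t)" if "t \<in> {0..T}" for t
      unfolding int_y[OF that] y_nth[OF that] y0 by (rule eq[OF that])
    have int0_y: "field_integral N y T = 0" using int_y[of T] int0 T by simp
    consider "l' \<le> 1 / 2" | "1 / 2 < l'" "l' < 1" | "l' = 1" using l' by fastforce
    then show False
    proof cases
      case 1
      then have y_const: "y t = y 0" if "t \<in> {0..T}" for t
        using integral_equation_imp_constant[OF cf Z N cont_y y_le eq_y int0_y _ that] by blast
      have "integral {0..T} (\<lambda>u. N u (y 0)) = field_integral N y T"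
        by (rule hk_integral_cong) (simp only: y_const)
      then have "g_hat T g h (y 0) = 0"
        using mean[OF y_le[of 0]] int0_y T by simp
      moreover have "y = const_fun T (y 0)"
      proof
        fix t show "y t = const_fun T (y 0) t"
          using y_const[of t] by (cases "t \<in> {0..T}") (auto simp: const_fun_def y_def res_def)
      qed
      moreover have "y \<in> fr" using y_cl l'1 1 by (auto simp: fr_eq y_def)
      ultimately show False using c2 unfolding fr_def by blast
    next
      case 2
      then have "periodic_solution T g (\<lambda>t s. (2 * l' - 1) *\<^sub>R h t s) y"
        by (intro integral_equation_imp_periodic_solution[OF cf Z N cont_y y_le eq_y int0_y]) auto
      moreover have "y \<in> fr" using y_cl l'1 2 by (auto simp: fr_eq y_def)
      ultimately show False using c1[of "2 * l' - 1"] 2 unfolding fr_def by auto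
    next
      case 3
      then have "periodic_solution T g (\<lambda>t s. (2 * l' - 1) *\<^sub>R h t s) y"
        by (intro integral_equation_imp_periodic_solution[OF cf Z N cont_y y_le eq_y int0_y]) auto
      then have "periodic_solution T g h y" using 3 by simp
      then show False using no_sol y_cl unfolding cl_def y_def by blast
    qed
  qed
qed

end
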